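(* Consider the Markovian proximal Bellman-ADMM iteration described in the context, under the coverage assumption and the algorithmic-margin assumption stated there, with no additional observation noise (observed rewards are exact: $Y_{k,t}=r(S_{k,t},A_{k,t})$). If $\sum_k m_k^{-1}<\infty$, then almost surely $\Delta\pi_k\to0$, $\Delta V_k\to0$, $\Delta\lambda_k\to0$, and $R(\pi^k,V^k)\to0$. Moreover every accumulation point $(\pi^\star,V^\star,\lambda^\star)$ of $(\pi^k,V^k,\lambda^k)$ satisfies the KKT conditions $0\in\partial\psi(\pi^\star)+J_\pi(\pi^\star,V^\star)^{\mathsf T}\lambda^\star$, $c+M_{\pi^\star}^{\mathsf T}\lambda^\star=0$, $R(\pi^\star,V^\star)=0$ of the problem $\min_{\pi\in\Pi,V}\phi(\pi)+c^{\mathsf T}V$ subject to $R(\pi,V)=0$.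
   Context: Norms are Euclidean for vectors and spectral for matrices. MDP: $(\mathcal S,\mathcal A,P,r,\rho,\gamma)$ is a finite discounted MDP with $0<\gamma<1$. Policies are $\pi\in\Pi=\prod_{s\in\mathcal S}\Delta(\mathcal A)\subset\mathbb R^{|\mathcal S||\mathcal A|}$. Set $P_\pi(s,s')=\sum_a\pi(a|s)P(s'|s,a)$, $r_\pi(s)=\sum_a\pi(a|s)r(s,a)$, $M_\pi=I-\gamma P_\pi$, $R(\pi,V)=M_\pi V-r_\pi$ for $V\in\mathbb R^{|\mathcal S|}$, $J_\pi(\pi,V)=D_\pi R(\pi,V)$. The vector $c\in\mathbb R^{|\mathcal S|}$ is fixed and $\phi$ (possibly nonsmooth, nonconvex) is proper, lower semicontinuous and bounded below on $\Pi$ with $\operatorname{dom}\phi\cap\Pi\neq\varnothing$; $\psi=\phi+\delta_\Pi$ with $\delta_\Pi$ the indicator of $\Pi$, and $\partial\psi$ is the limiting subdifferential. The augmented Lagrangian is $\mathcal L_\beta(\pi,V,\lambda)=\phi(\pi)+c^{\mathsf T}V+\langle\lambda,R(\pi,V)\rangle+\frac\beta2\|R(\pi,V)\|^2$. Sampling: at outer iteration $k$ an exploratory behavior policy $\bar\pi^k$ is frozen and a batch of $m_k\geq1$ steps of the reset chain with kernel $K_k(s,s')=(1-\gamma)\rho(s')+\gamma P_{\bar\pi^k}(s,s')$ is simulated: at step $t$, in state $S_{k,t}$, an action $A_{k,t}\sim\bar\pi^k(\cdot|S_{k,t})$ and a reset indicator (reset with probability $1-\gamma$) are drawn; on a reset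 the next state is drawn from $\rho$, otherwise an environment transition from $P(\cdot|S_{k,t},A_{k,t})$ is observed with reward observation $Y_{k,t}$. Fresh reset coins, reset states and action randomization are independent of the preceding history. From the non-reset transitions of batch $k$ only, form the empirical conditional transition rows $\widehat P_k(\cdot|s,a)$ and average observed rewards $\widehat r_k(s,a)$ for each $(s,a)$; an unvisited transition row is replaced by a fixed probability vector and an unvisited reward entry by a fixed bounded value. Set $\widehat P_{\pi,k}(s,\cdot)=\sum_a\pi(a|s)\widehat P_k(\cdot|s,a)$, $\widehat r_{\pi,k}(s)=\sum_a\pi(a|s)\widehat r_k(s,a)$, $\widehat M_{\pi,k}=I-\gamma\widehat P_{\pi,k}$, $\widehat R_k(\pi,V)=\widehat M_{\pi,k}V-\widehat r_{\pi,k}$, and let $\widehat{\mathcal L}_{\beta,k}$ be $\mathcal L_\beta$ with $R$ replaced by $\widehat R_k$. The constant $\bar\kappa<\infty$ satisfies $\|M_\pi^{-1}\|\le\bar\kappa$ and $\|\widehat M_{\pi,k}^{-1}\|\le\bar\kappa$ for all $\pi,k$ and all realizations (it exists since all rows are stochastic). Algorithm: from $(\pi^0,V^0,\lambda^0)$, with $\beta,\eta_\pi,\eta_V>0$, for $k=0,1,\dots$: $\pi^{k+1}\in\arg\min_{\pi\in\Pi}\{\widehat{\mathcal L}_{\beta,k}(\pi,V^k,\lambda^k)+\frac1{2\eta_\pi}\|\pi-\pi^k\|^2\}$; $V^{k+1}=\arg\min_V\{\widehat{\mathcal L}_{\beta,k}(\pi^{k+1},V,\lambda^k)+\frac1{2\eta_V}\|V-V^k\|^2\}$;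 $\lambda^{k+1}=\lambda^k+\beta\widehat R_k(\pi^{k+1},V^{k+1})$. Write $\Delta\pi_{k+1}=\pi^{k+1}-\pi^k$, and similarly $\Delta V_{k+1},\Delta\lambda_{k+1}$. All of $(\pi^k,V^k,\lambda^k,\bar\pi^k)$ is determined before batch $k$ is drawn. Coverage assumption: there are $\rho_{\min},\alpha>0$, $R_{\max}<\infty$ with $\rho(s)\ge\rho_{\min}$, $\bar\pi^k(a|s)\ge\alpha$, $|r(s,a)|\le R_{\max}$ for all $k,s,a$. Algorithmic-margin assumption: the policy subproblem admits a global minimizer and is solved exactly; the value subproblem is solved exactly; $\pi^0$ is deterministic and lies in $\operatorname{dom}\psi$; $\|M_{\pi'}-M_\pi\|\le L_M\|\pi'-\pi\|$ for some $L_M<\infty$; $b(\pi)=\phi(\pi)+c^{\mathsf T}M_\pi^{-1}r_\pi$ is bounded below on $\Pi$; $\beta>\max\{60\bar\kappa^2/\eta_V,\;30\eta_\pi\bar\kappa^4L_M^2\|c\|^2\}$; $\mathbb E\|V^0\|^4+\mathbb E\|\lambda^0\|^4<\infty$. *)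

theory Defs
  imports "HOL-Probability.Probability"
begin

text \<open>
  States and actions are finite types \<open>'s\<close>, \<open>'a\<close>; a policy is an element of \<open>real ^ 'a ^ 's\<close>,
  whose library norm and inner product are the Euclidean ones of R^(|S||A|). On matrices the
  library norm is the Frobenius norm, hence the separate \<open>spectral_norm\<close>.
\<close>

definition spectral_norm :: "real ^ 'n ^ 'm \<Rightarrow> real" where
  "spectral_norm A = onorm (\<lambda>x. A *v x)"

definition prob_vec :: "('x::finite \<Rightarrow> real) \<Rightarrow> bool" where
  "prob_vec p \<longleftrightarrow> (\<forall>x. 0 \<le> p x) \<and> (\<Sum>x\<in>UNIV. p x) = 1"

definition discounted_mdp ::
  "('s::finite \<Rightarrow> 'a::finite \<Rightarrow> 's \<Rightarrow> real) \<Rightarrow> ('s \<Rightarrow> real) \<Rightarrow> real \<Rightarrow> bool" where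
  "discounted_mdp P \<rho> \<gamma> \<longleftrightarrow> (\<forall>s a. prob_vec (P s a)) \<and> prob_vec \<rho> \<and> 0 < \<gamma> \<and> \<gamma> < 1"

definition policies :: "(real ^ 'a::finite ^ 's::finite) set" where
  "policies = {\<pi>. \<forall>s. prob_vec (\<lambda>a. \<pi> $ s $ a)}"


section \<open>Bellman objects\<close>

text \<open>
  These are functions of an arbitrary kernel and reward table: they are used both with the true
  \<open>(P, r)\<close> and with the empirical tables of a batch. They are defined on all of
  \<open>real ^ 'a ^ 's\<close>, so that the residual can be differentiated in \<open>\<pi>\<close>.
\<close>

definition P_pol :: "('s::finite \<Rightarrow> 'a::finite \<Rightarrow> 's \<Rightarrow> real) \<Rightarrow> real ^ 'a ^ 's \<Rightarrow> real ^ 's ^ 's" where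
  "P_pol P \<pi> = (\<chi> s s'. \<Sum>a\<in>UNIV. \<pi> $ s $ a * P s a s')"

definition r_pol :: "('s::finite \<Rightarrow> 'a::finite \<Rightarrow> real) \<Rightarrow> real ^ 'a ^ 's \<Rightarrow> real ^ 's" where
  "r_pol r \<pi> = (\<chi> s. \<Sum>a\<in>UNIV. \<pi> $ s $ a * r s a)"

definition M_pol ::
  "real \<Rightarrow> ('s::finite \<Rightarrow> 'a::finite \<Rightarrow> 's \<Rightarrow> real) \<Rightarrow> real ^ 'a ^ 's \<Rightarrow> real ^ 's ^ 's" where
  "M_pol \<gamma> P \<pi> = mat 1 - \<gamma> *\<^sub>R P_pol P \<pi>"

definition bellman_res ::
  "real \<Rightarrow> ('s::finite \<Rightarrow> 'a::finite \<Rightarrow> 's \<Rightarrow> real) \<Rightarrow> ('s \<Rightarrow> 'a \<Rightarrow> real)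
    \<Rightarrow> real ^ 'a ^ 's \<Rightarrow> real ^ 's \<Rightarrow> real ^ 's" where
  "bellman_res \<gamma> P r \<pi> V = M_pol \<gamma> P \<pi> *v V - r_pol r \<pi>"

definition J_pol ::
  "real \<Rightarrow> ('s::finite \<Rightarrow> 'a::finite \<Rightarrow> 's \<Rightarrow> real) \<Rightarrow> ('s \<Rightarrow> 'a \<Rightarrow> real)
    \<Rightarrow> real ^ 'a ^ 's \<Rightarrow> real ^ 's \<Rightarrow> real ^ 'a ^ 's \<Rightarrow> real ^ 's" where
  "J_pol \<gamma> P r \<pi> V = frechet_derivative (\<lambda>p. bellman_res \<gamma> P r p V) (at \<pi>)"


section \<open>Extended-real-valued functions and the limiting subdifferential\<close>

definition proper_on :: "'x set \<Rightarrow> ('x \<Rightarrow> ereal) \<Rightarrow> bool" where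
  "proper_on X f \<longleftrightarrow> (\<forall>x\<in>X. f x \<noteq> -\<infinity>) \<and> (\<exists>x\<in>X. f x \<noteq> \<infinity>)"

definition lsc_on :: "'x::topological_space set \<Rightarrow> ('x \<Rightarrow> ereal) \<Rightarrow> bool" where
  "lsc_on X f \<longleftrightarrow> (\<forall>x\<in>X. f x \<le> Liminf (at x within X) f)"

definition bdd_below_on :: "'x set \<Rightarrow> ('x \<Rightarrow> ereal) \<Rightarrow> bool" where
  "bdd_below_on X f \<longleftrightarrow> (\<exists>b::real. \<forall>x\<in>X. ereal b \<le> f x)"

definition indicator_fun :: "'x set \<Rightarrow> 'x \<Rightarrow> ereal" where
  "indicator_fun X x = (if x \<in> X then 0 else \<infinity>)"

definition regular_subdiff :: "('x::euclidean_space \<Rightarrow> ereal) \<Rightarrow> 'x \<Rightarrow> 'x set" where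
  "regular_subdiff f x = {v. \<bar>f x\<bar> \<noteq> \<infinity> \<and>
     0 \<le> Liminf (at x) (\<lambda>y. (f y - f x - ereal (v \<bullet> (y - x))) / ereal (norm (y - x)))}"

definition limiting_subdiff :: "('x::euclidean_space \<Rightarrow> ereal) \<Rightarrow> 'x \<Rightarrow> 'x set" where
  "limiting_subdiff f x = {v. \<bar>f x\<bar> \<noteq> \<infinity> \<and>
     (\<exists>xs vs. xs \<longlonglongrightarrow> x \<and> (\<lambda>n. f (xs n)) \<longlonglongrightarrow> f x \<and>
        (\<forall>n. vs n \<in> regular_subdiff f (xs n)) \<and> vs \<longlonglongrightarrow> v)}"


section \<open>Augmented Lagrangian and KKT conditions\<close>

text \<open>The argument \<open>R\<close> is the residual map, either the true or the empirical one.\<close>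

definition aug_lagrangian ::
  "(real ^ 'a::finite ^ 's::finite \<Rightarrow> ereal) \<Rightarrow> real ^ 's \<Rightarrow> real
    \<Rightarrow> (real ^ 'a ^ 's \<Rightarrow> real ^ 's \<Rightarrow> real ^ 's)
    \<Rightarrow> real ^ 'a ^ 's \<Rightarrow> real ^ 's \<Rightarrow> real ^ 's \<Rightarrow> ereal" where
  "aug_lagrangian \<phi> c \<beta> R \<pi> V l =
     \<phi> \<pi> + ereal (c \<bullet> V + l \<bullet> R \<pi> V + \<beta> / 2 * (norm (R \<pi> V))\<^sup>2)"

definition kkt_point ::
  "(real ^ 'a::finite ^ 's::finite \<Rightarrow> ereal) \<Rightarrow> real ^ 's \<Rightarrow> real
    \<Rightarrow> ('s \<Rightarrow> 'a \<Rightarrow> 's \<Rightarrow> real) \<Rightarrow> ('s \<Rightarrow> 'a \<Rightarrow> real)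
    \<Rightarrow> real ^ 'a ^ 's \<Rightarrow> real ^ 's \<Rightarrow> real ^ 's \<Rightarrow> bool" where
  "kkt_point \<phi> c \<gamma> P r \<pi> V l \<longleftrightarrow>
     0 \<in> (\<lambda>g. g + adjoint (J_pol \<gamma> P r \<pi> V) l) `
           limiting_subdiff (\<lambda>p. \<phi> p + indicator_fun policies p) \<pi> \<and>
     c + transpose (M_pol \<gamma> P \<pi>) *v l = 0 \<and>
     bellman_res \<gamma> P r \<pi> V = 0"


section \<open>Markovian batch sampling\<close>

text \<open>
  \<open>F k t\<close> is the information available just before step \<open>t\<close> of batch \<open>k\<close>. Step \<open>t < m k\<close> starts in
  \<open>S k t\<close>, draws the action \<open>A k t\<close> and the reset indicator \<open>Z k t\<close> (\<open>True\<close> meaning reset) and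
  moves to \<open>S k (Suc t)\<close>. The last clause gives the conditional law of a step: the action and
  the coin are independent given the past, and the next state is drawn from \<open>\<rho>\<close> on a reset and
  from \<open>P\<close> otherwise; summing out action and coin yields the kernel
  \<open>(1 - \<gamma>) \<rho>(s') + \<gamma> P_pol P (bp k) s s'\<close>. The initial state of a batch is any state known when
  the batch starts, e.g. the final state of the previous one.
\<close>

definition reset_sampling ::
  "'w measure \<Rightarrow> (nat \<Rightarrow> nat \<Rightarrow> 'w measure)
    \<Rightarrow> ('s::finite \<Rightarrow> 'a::finite \<Rightarrow> 's \<Rightarrow> real) \<Rightarrow> ('s \<Rightarrow> real) \<Rightarrow> real
    \<Rightarrow> (nat \<Rightarrow> nat) \<Rightarrow> (nat \<Rightarrow> 'w \<Rightarrow> real ^ 'a ^ 's)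
    \<Rightarrow> (nat \<Rightarrow> nat \<Rightarrow> 'w \<Rightarrow> 's) \<Rightarrow> (nat \<Rightarrow> nat \<Rightarrow> 'w \<Rightarrow> 'a) \<Rightarrow> (nat \<Rightarrow> nat \<Rightarrow> 'w \<Rightarrow> bool) \<Rightarrow> bool" where
  "reset_sampling \<Omega> F P \<rho> \<gamma> m bp S A Z \<longleftrightarrow>
     (\<forall>k t. t \<le> m k \<longrightarrow> subalgebra \<Omega> (F k t) \<and> S k t \<in> measurable (F k t) (count_space UNIV)) \<and>
     (\<forall>k t. t < m k \<longrightarrow> subalgebra (F k (Suc t)) (F k t) \<and>
        A k t \<in> measurable (F k (Suc t)) (count_space UNIV) \<and>
        Z k t \<in> measurable (F k (Suc t)) (count_space UNIV)) \<and>
     (\<forall>k. subalgebra (F (Suc k) 0) (F k (m k))) \<and>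
     (\<forall>k. bp k \<in> borel_measurable (F k 0) \<and> (\<forall>\<omega>\<in>space \<Omega>. bp k \<omega> \<in> policies)) \<and>
     (\<forall>k t. t < m k \<longrightarrow> (\<forall>a z s'.
        AE \<omega> in \<Omega>.
          real_cond_exp \<Omega> (F k t)
            (indicator {\<omega> \<in> space \<Omega>. A k t \<omega> = a \<and> Z k t \<omega> = z \<and> S k (Suc t) \<omega> = s'}) \<omega> =
          bp k \<omega> $ S k t \<omega> $ a *
            (if z then (1 - \<gamma>) * \<rho> s' else \<gamma> * P (S k t \<omega>) a s')))"

definition env_visits ::
  "(nat \<Rightarrow> nat) \<Rightarrow> (nat \<Rightarrow> nat \<Rightarrow> 'w \<Rightarrow> 's) \<Rightarrow> (nat \<Rightarrow> nat \<Rightarrow> 'w \<Rightarrow> 'a) \<Rightarrow> (nat \<Rightarrow> nat \<Rightarrow> 'w \<Rightarrow> bool)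
    \<Rightarrow> nat \<Rightarrow> 'w \<Rightarrow> 's \<Rightarrow> 'a \<Rightarrow> nat set" where
  "env_visits m S A Z k \<omega> s a = {t. t < m k \<and> \<not> Z k t \<omega> \<and> S k t \<omega> = s \<and> A k t \<omega> = a}"

definition P_hat ::
  "('s \<Rightarrow> 'a \<Rightarrow> 's \<Rightarrow> real) \<Rightarrow> (nat \<Rightarrow> nat) \<Rightarrow> (nat \<Rightarrow> nat \<Rightarrow> 'w \<Rightarrow> 's) \<Rightarrow> (nat \<Rightarrow> nat \<Rightarrow> 'w \<Rightarrow> 'a)
    \<Rightarrow> (nat \<Rightarrow> nat \<Rightarrow> 'w \<Rightarrow> bool) \<Rightarrow> nat \<Rightarrow> 'w \<Rightarrow> 's \<Rightarrow> 'a \<Rightarrow> 's \<Rightarrow> real" where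
  "P_hat P0 m S A Z k \<omega> s a s' =
     (if env_visits m S A Z k \<omega> s a = {} then P0 s a s'
      else real (card {t \<in> env_visits m S A Z k \<omega> s a. S k (Suc t) \<omega> = s'})
           / real (card (env_visits m S A Z k \<omega> s a)))"

definition r_hat ::
  "('s \<Rightarrow> 'a \<Rightarrow> real) \<Rightarrow> (nat \<Rightarrow> nat) \<Rightarrow> (nat \<Rightarrow> nat \<Rightarrow> 'w \<Rightarrow> 's) \<Rightarrow> (nat \<Rightarrow> nat \<Rightarrow> 'w \<Rightarrow> 'a)
    \<Rightarrow> (nat \<Rightarrow> nat \<Rightarrow> 'w \<Rightarrow> bool) \<Rightarrow> (nat \<Rightarrow> nat \<Rightarrow> 'w \<Rightarrow> real) \<Rightarrow> nat \<Rightarrow> 'w \<Rightarrow> 's \<Rightarrow> 'a \<Rightarrow> real" where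
  "r_hat r0 m S A Z Y k \<omega> s a =
     (if env_visits m S A Z k \<omega> s a = {} then r0 s a
      else (\<Sum>t\<in>env_visits m S A Z k \<omega> s a. Y k t \<omega>)
           / real (card (env_visits m S A Z k \<omega> s a)))"


section \<open>The proximal Bellman-ADMM step\<close>

definition admm_step ::
  "(real ^ 'a::finite ^ 's::finite \<Rightarrow> ereal) \<Rightarrow> real ^ 's \<Rightarrow> real \<Rightarrow> real \<Rightarrow> real
    \<Rightarrow> (real ^ 'a ^ 's \<Rightarrow> real ^ 's \<Rightarrow> real ^ 's)
    \<Rightarrow> real ^ 'a ^ 's \<Rightarrow> real ^ 's \<Rightarrow> real ^ 's
    \<Rightarrow> real ^ 'a ^ 's \<Rightarrow> real ^ 's \<Rightarrow> real ^ 's \<Rightarrow> bool" where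
  "admm_step \<phi> c \<beta> \<eta>\<^sub>\<pi> \<eta>\<^sub>V R \<pi> V l \<pi>' V' l' \<longleftrightarrow>
     is_arg_min (\<lambda>p. aug_lagrangian \<phi> c \<beta> R p V l + ereal (1 / (2 * \<eta>\<^sub>\<pi>) * (norm (p - \<pi>))\<^sup>2))
       (\<lambda>p. p \<in> policies) \<pi>' \<and>
     is_arg_min (\<lambda>W. aug_lagrangian \<phi> c \<beta> R \<pi>' W l + ereal (1 / (2 * \<eta>\<^sub>V) * (norm (W - V))\<^sup>2))
       (\<lambda>W. True) V' \<and>
     l' = l + \<beta> *\<^sub>R R \<pi>' V'"

end

theory Submission
  imports Defs
begin

text \<open>
  Everything is pathwise once the squared estimation errors are almost surely summable. For a
  fixed state-action pair the visit count is at least a multiple of the batch length plus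
  martingale terms whose second moments grow linearly in \<open>m k\<close>; hence the squared errors are
  \<open>O(1 / m k)\<close> in expectation.

  On a fixed path, the joint update of value and multiplier is the resolvent of a coercive
  skew affine map and contracts in a norm that does not depend on the empirical kernel, so
  values and multipliers stay bounded. The augmented Lagrangian with the true residual, plus a
  multiple of the last squared value increment, then decreases up to squared errors: the noise
  only acts through the increments of the iterates. So the squared increments are summable, and
  the KKT system is the limit of the optimality conditions of the subproblems.
\<close>


section \<open>Bellman residuals\<close>

text \<open>Finiteness of the sum of \<open>1 / m k\<close> makes the estimation errors square
  summable, but not necessarily summable. A perturbation of the Lagrangian of first order in the
  error could therefore add up to infinity, and the estimates are arranged so that every error is
  multiplied by a step length or by another error. This is possible because both subproblems of an
  iteration use the same batch: comparing the empirical with the true penalty at two consecutive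
  iterates leaves a second difference, of order error times step. Its constant involves the size of
  values and multipliers, so these have to be bounded before any descent is available, which is the
  purpose of the contraction.

  The constants of the margin are the price of the multiplier step. Its squared increment is split
  into four parts (factor 4) and enters the descent with factor 5/4, together 5. The proximal terms
  can spare \<open>1 / (12 * \<eta>\<^sub>V)\<close> and \<open>1 / (6 * \<eta>\<^sub>\<pi>)\<close>
  times the squared increments to pay for it, whence 60 = 5 * 12 and 30 = 5 * 6.\<close>

lemma norm_mult_vec_le_spectral: "norm (A *v x) \<le> spectral_norm A * norm x"
  unfolding spectral_norm_def
  by (rule onorm) (rule matrix_vector_mul_bounded_linear)

lemma inner_transpose_mult_vec: "(transpose A *v y) \<bullet> x = y \<bullet> (A *v (x :: real ^ 'n))"
  by (simp add: dot_lmul_matrix)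

text \<open>The square of the norm of \<open>transpose A *v y\<close> is the inner product of
  \<open>y\<close> with \<open>A *v (transpose A *v y)\<close>, so the bound for \<open>A\<close>
  applies and one factor cancels.\<close>

lemma norm_transpose_mult_vec_le:
  fixes A :: "real ^ 'n ^ 'm"
  assumes "\<And>x. norm (A *v x) \<le> C * norm x"
  shows "norm (transpose A *v y) \<le> C * norm y"
proof (cases "transpose A *v y = 0")
  case True
  show ?thesis
  proof (cases "y = 0")
    case False
    obtain b :: "real ^ 'n" where "b \<in> Basis" using nonempty_Basis by blast
    then have "0 \<le> C" using order_trans[OF norm_ge_zero assms[of b]] by simp
    then show ?thesis using True by simp
  qed auto
next
  case False
  have "norm (transpose A *v y) * norm (transpose A *v y) = y \<bullet> (A *v (transpose A *v y))"
    by (metis inner_transpose_mult_vec dot_square_norm power2_eq_square)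
  also have "\<dots> \<le> norm y * norm (A *v (transpose A *v y))"
    by (rule norm_cauchy_schwarz)
  also have "\<dots> \<le> norm y * (C * norm (transpose A *v y))"
    by (intro mult_left_mono assms) auto
  finally have "norm (transpose A *v y) * norm (transpose A *v y)
      \<le> (C * norm y) * norm (transpose A *v y)" by (simp add: mult_ac)
  then show ?thesis using False by (simp add: mult_le_cancel_right)
qed

lemma mult_vec_minus: "A *v (- x) = - (A *v (x :: real ^ 'n))"
  by (simp add: matrix_vector_mult_def vec_eq_iff sum_negf)

lemma transpose_diff: "transpose (A - B) = transpose A - transpose (B :: real ^ 'n ^ 'm)"
  by (simp add: transpose_def vec_eq_iff)

lemma norm_table_le:
  fixes X :: "real ^ 'a::finite ^ 's::finite"
  assumes "\<And>s a. \<bar>X $ s $ a\<bar> \<le> b"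
  shows "norm X \<le> real CARD('s) * (real CARD('a) * b)"
proof -
  have 1: "norm (X $ s) \<le> real CARD('a) * b" for s
  proof -
    have "norm (X $ s) \<le> (\<Sum>a\<in>UNIV. \<bar>X $ s $ a\<bar>)" by (rule norm_le_l1_cart)
    also have "\<dots> \<le> real (card (UNIV :: 'a set)) * b"
      by (rule sum_bounded_above) (use assms in auto)
    finally show ?thesis .
  qed
  have "norm X \<le> (\<Sum>s\<in>UNIV. norm (X $ s))"
    unfolding norm_vec_def by (rule L2_set_le_sum) auto
  also have "\<dots> \<le> real (card (UNIV :: 's set)) * (real CARD('a) * b)"
    by (rule sum_bounded_above) (use 1 in auto)
  finally show ?thesis .
qed

section \<open>The residual as a row-wise bilinear form in policy and lookahead table\<close>

definition row_prod :: "real ^ 'a ^ 's \<Rightarrow> real ^ 'a ^ 's \<Rightarrow> real ^ 's" where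
  "row_prod p q = (\<chi> s. p $ s \<bullet> q $ s)"

text \<open>For fixed \<open>q\<close> this is the adjoint of
  \<open>p \<mapsto> row_prod p q\<close>; it expresses policy gradients of the residual.\<close>

definition row_scale :: "real ^ 's \<Rightarrow> real ^ 'a ^ 's \<Rightarrow> real ^ 'a ^ 's" where
  "row_scale l q = (\<chi> s. l $ s *\<^sub>R q $ s)"

text \<open>The one-step lookahead table of state-action values. With zero rewards it is the part
  linear in \<open>V\<close>, with \<open>V = 0\<close> it is the reward table.\<close>

definition q_table ::
  "real \<Rightarrow> ('s::finite \<Rightarrow> 'a::finite \<Rightarrow> 's \<Rightarrow> real) \<Rightarrow> ('s \<Rightarrow> 'a \<Rightarrow> real) \<Rightarrow> real ^ 's \<Rightarrow> real ^ 'a ^ 's" where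
  "q_table \<gamma> P r V = (\<chi> s a. r s a + \<gamma> * (\<Sum>s'\<in>UNIV. P s a s' * V $ s'))"

lemma norm_row_prod_le: "norm (row_prod p q) \<le> norm p * norm q"
proof -
  have "norm (row_prod p q) = L2_set (\<lambda>s. norm (p $ s \<bullet> q $ s)) UNIV"
    by (simp add: norm_vec_def row_prod_def)
  also have "\<dots> \<le> L2_set (\<lambda>s. norm (p $ s) * norm q) UNIV"
  proof (rule L2_set_mono)
    fix s
    have "norm (p $ s \<bullet> q $ s) \<le> norm (p $ s) * norm (q $ s)"
      by (simp add: Cauchy_Schwarz_ineq2)
    also have "\<dots> \<le> norm (p $ s) * norm q"
      by (intro mult_left_mono Finite_Cartesian_Product.norm_nth_le) auto
    finally show "norm (p $ s \<bullet> q $ s) \<le> norm (p $ s) * norm q" .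
  qed auto
  also have "\<dots> = norm p * norm q"
    by (simp add: norm_vec_def L2_set_left_distrib)
  finally show ?thesis .
qed

lemma bounded_bilinear_row_prod: "bounded_bilinear row_prod"
proof
  show "\<exists>K. \<forall>a b. norm (row_prod a b) \<le> norm a * norm b * K"
    by (rule exI[of _ 1]) (simp add: norm_row_prod_le)
qed (simp_all add: row_prod_def vec_eq_iff inner_add_left inner_add_right)

interpretation row_prod: bounded_bilinear row_prod
  by (rule bounded_bilinear_row_prod)

lemma inner_row_prod: "row_prod p q \<bullet> l = p \<bullet> row_scale l q"
  by (simp add: inner_vec_def row_prod_def row_scale_def sum_distrib_left mult_ac sum_distrib_right)

lemma tendsto_row_scale:
  "(f \<longlongrightarrow> l) F \<Longrightarrow> (g \<longlongrightarrow> q) F \<Longrightarrow> ((\<lambda>x. row_scale (f x) (g x)) \<longlongrightarrow> row_scale l q) F"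
  unfolding row_scale_def by (intro tendsto_intros)

lemma M_pol_mult_vec:
  "M_pol \<gamma> P p *v V = V - row_prod p (q_table \<gamma> P (\<lambda>_ _. 0) V)"
proof -
  have "(P_pol P p *v V) $ s = (\<Sum>a\<in>UNIV. p $ s $ a * (\<Sum>s'\<in>UNIV. P s a s' * V $ s'))" for s
    unfolding P_pol_def matrix_vector_mult_def
    by (simp add: sum_distrib_left sum_distrib_right mult_ac) (rule sum.swap)
  then have "\<gamma> *\<^sub>R (P_pol P p *v V) = row_prod p (q_table \<gamma> P (\<lambda>_ _. 0) V)"
    by (simp add: vec_eq_iff row_prod_def q_table_def inner_vec_def sum_distrib_left mult_ac)
  then show ?thesis
    by (simp add: M_pol_def matrix_vector_mult_diff_rdistrib scaleR_matrix_vector_assoc)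
qed

lemma r_pol_eq: "r_pol r p = row_prod p (q_table \<gamma> P r 0)"
  by (simp add: r_pol_def row_prod_def q_table_def inner_vec_def vec_eq_iff)

lemma q_table_split: "q_table \<gamma> P r V = q_table \<gamma> P (\<lambda>_ _. 0) V + q_table \<gamma> P r 0"
  by (simp add: q_table_def vec_eq_iff)

lemma q_table_diff:
  "q_table \<gamma> P r V - q_table \<gamma> P r W = q_table \<gamma> P (\<lambda>_ _. 0) (V - W)"
  by (simp add: q_table_def vec_eq_iff right_diff_distrib sum_subtractf)

lemma bellman_res_eq: "bellman_res \<gamma> P r p V = V - row_prod p (q_table \<gamma> P r V)"
  by (simp add: bellman_res_def M_pol_mult_vec r_pol_eq[of r p \<gamma> P] q_table_split[of \<gamma> P r V]
      row_prod.add_right)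

lemma adjoint_J_pol:
  "adjoint (J_pol \<gamma> P r p V) l = - row_scale l (q_table \<gamma> P r V)"
proof -
  have "((\<lambda>p. bellman_res \<gamma> P r p V) has_derivative (\<lambda>h. - row_prod h (q_table \<gamma> P r V))) (at p)"
    unfolding bellman_res_eq
    by (auto intro!: derivative_eq_intros
        bounded_linear.has_derivative[OF row_prod.bounded_linear_left])
  then have "J_pol \<gamma> P r p V = (\<lambda>h. - row_prod h (q_table \<gamma> P r V))"
    unfolding J_pol_def by (rule frechet_derivative_at[symmetric])
  moreover have "adjoint (\<lambda>h. - row_prod h (q_table \<gamma> P r V)) = (\<lambda>l. - row_scale l (q_table \<gamma> P r V))"
    by (rule adjoint_unique) (simp add: inner_row_prod)
  ultimately show ?thesis by simp
qed

lemma abs_inner_row_le: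
  fixes V :: "real ^ 's"
  assumes "\<And>s'. \<bar>P s'\<bar> \<le> e" "0 \<le> \<gamma>" "\<gamma> \<le> 1"
  shows "\<bar>\<gamma> * (\<Sum>s'\<in>UNIV. P s' * V $ s')\<bar> \<le> real CARD('s) * (e * norm V)"
proof -
  have "\<bar>\<Sum>s'\<in>UNIV. P s' * V $ s'\<bar> \<le> (\<Sum>s'\<in>UNIV. \<bar>P s' * V $ s'\<bar>)" by (rule sum_abs)
  also have "\<dots> \<le> real (card (UNIV :: 's set)) * (e * norm V)"
  proof (rule sum_bounded_above)
    fix s'
    have "0 \<le> e" using assms(1)[of s'] by linarith
    then show "\<bar>P s' * V $ s'\<bar> \<le> e * norm V"
      unfolding abs_mult by (intro mult_mono assms component_le_norm_cart) auto
  qed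
  finally have *: "\<bar>\<Sum>s'\<in>UNIV. P s' * V $ s'\<bar> \<le> real CARD('s) * (e * norm V)" .
  have "\<bar>\<gamma> * (\<Sum>s'\<in>UNIV. P s' * V $ s')\<bar> \<le> 1 * \<bar>\<Sum>s'\<in>UNIV. P s' * V $ s'\<bar>"
    unfolding abs_mult using assms by (intro mult_right_mono) auto
  with * show ?thesis by linarith
qed

lemma norm_q_table_diff_le:
  fixes V :: "real ^ 's"
    and P P' :: "'s::finite \<Rightarrow> 'a::finite \<Rightarrow> 's \<Rightarrow> real"
  assumes P: "\<And>s a s'. \<bar>P s a s' - P' s a s'\<bar> \<le> e"
    and r: "\<And>s a. \<bar>r s a - r' s a\<bar> \<le> e'" and \<gamma>: "0 \<le> \<gamma>" "\<gamma> \<le> 1"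
  shows "norm (q_table \<gamma> P r V - q_table \<gamma> P' r' V)
    \<le> real CARD('s) * (real CARD('a) * (e' + real CARD('s) * (e * norm V)))"
proof (rule norm_table_le)
  fix s a
  have "(q_table \<gamma> P r V - q_table \<gamma> P' r' V) $ s $ a
      = (r s a - r' s a) + \<gamma> * (\<Sum>s'\<in>UNIV. (P s a s' - P' s a s') * V $ s')"
    by (simp add: q_table_def left_diff_distrib sum_subtractf right_diff_distrib)
  then show "\<bar>(q_table \<gamma> P r V - q_table \<gamma> P' r' V) $ s $ a\<bar> \<le> e' + real CARD('s) * (e * norm V)"
    using r[of s a] abs_inner_row_le[of "\<lambda>s'. P s a s' - P' s a s'" e \<gamma> V, OF P \<gamma>] by linarith
qed

lemma abs_prob_vec_le: "prob_vec p \<Longrightarrow> \<bar>p x\<bar> \<le> 1"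
  unfolding prob_vec_def
  by (metis abs_of_nonneg finite member_le_sum UNIV_I)

lemma norm_policy_le:
  fixes p :: "real ^ 'a::finite ^ 's::finite"
  assumes "p \<in> policies"
  shows "norm p \<le> real CARD('s) * real CARD('a)"
  using norm_table_le[of p 1] abs_prob_vec_le assms unfolding policies_def by force

lemma closed_policies: "closed (policies :: (real ^ 'a::finite ^ 's::finite) set)"
  unfolding policies_def prob_vec_def
  by (intro closed_Collect_all closed_Collect_conj closed_Collect_le closed_Collect_eq continuous_intros)

lemma P_pol_row:
  assumes "p \<in> policies" "\<And>s a. prob_vec (P s a)"
  shows "prob_vec (\<lambda>s'. P_pol P p $ s $ s')"
proof -
  have "(\<Sum>s'\<in>UNIV. \<Sum>a\<in>UNIV. p $ s $ a * P s a s') = (\<Sum>a\<in>UNIV. p $ s $ a * (\<Sum>s'\<in>UNIV. P s a s'))"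
    unfolding sum_distrib_left by (rule sum.swap)
  also have "\<dots> = 1"
    using assms by (auto simp: prob_vec_def policies_def)
  finally show ?thesis
    using assms by (auto simp: prob_vec_def policies_def P_pol_def intro!: sum_nonneg mult_nonneg_nonneg)
qed

text \<open>Maximum principle: at a coordinate where a kernel vector is largest in modulus,
  averaging over a stochastic row cannot increase the modulus, while \<open>\<gamma>\<close>
  strictly shrinks it. Invertibility has to be known separately, since \<open>matrix_inv\<close> is
  a choice operator and a bound on its norm says something about \<open>M_pol\<close> only if an
  inverse exists.\<close>

lemma invertible_M_pol:
  fixes P :: "'s::finite \<Rightarrow> 'a::finite \<Rightarrow> 's \<Rightarrow> real"
  assumes p: "p \<in> policies" and P: "\<And>s a. prob_vec (P s a)" and \<gamma>: "0 \<le> \<gamma>" "\<gamma> < 1"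
  shows "invertible (M_pol \<gamma> P p)"
proof -
  have "x = 0" if x: "M_pol \<gamma> P p *v x = 0" for x :: "real ^ 's"
  proof -
    have "Max (range (\<lambda>s. \<bar>x $ s\<bar>)) \<in> range (\<lambda>s. \<bar>x $ s\<bar>)"
      by (rule Max_in) auto
    then obtain s where s: "\<bar>x $ s\<bar> = Max (range (\<lambda>s. \<bar>x $ s\<bar>))"
      by (metis imageE)
    then have le: "\<bar>x $ s'\<bar> \<le> \<bar>x $ s\<bar>" for s'
      by (simp add: s)
    have "x = \<gamma> *\<^sub>R (P_pol P p *v x)"
      using x by (simp add: M_pol_def matrix_vector_mult_diff_rdistrib scaleR_matrix_vector_assoc)
    from arg_cong[OF this, of "\<lambda>y. y $ s"]
    have "x $ s = \<gamma> * (\<Sum>s'\<in>UNIV. P_pol P p $ s $ s' * x $ s')"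
      by (simp add: matrix_vector_mult_def)
    moreover have "\<bar>\<Sum>s'\<in>UNIV. P_pol P p $ s $ s' * x $ s'\<bar> \<le> \<bar>x $ s\<bar>"
    proof -
      have pr: "prob_vec (\<lambda>s'. P_pol P p $ s $ s')" by (rule P_pol_row[OF p P])
      have "\<bar>\<Sum>s'\<in>UNIV. P_pol P p $ s $ s' * x $ s'\<bar> \<le> (\<Sum>s'\<in>UNIV. \<bar>P_pol P p $ s $ s' * x $ s'\<bar>)"
        by (rule sum_abs)
      also have "\<dots> \<le> (\<Sum>s'\<in>UNIV. P_pol P p $ s $ s' * \<bar>x $ s\<bar>)"
        using pr le by (intro sum_mono) (auto simp: abs_mult prob_vec_def intro: mult_left_mono)
      also have "\<dots> = \<bar>x $ s\<bar>"
        using pr by (simp add: sum_distrib_right[symmetric] prob_vec_def)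
      finally show ?thesis .
    qed
    ultimately have "\<bar>x $ s\<bar> \<le> \<gamma> * \<bar>x $ s\<bar>"
      using \<gamma> by (simp add: abs_mult mult_left_mono)
    then have "(1 - \<gamma>) * \<bar>x $ s\<bar> \<le> 0" by (simp add: algebra_simps)
    then have "x $ s = 0" using \<gamma> by (simp add: mult_le_0_iff)
    then show ?thesis using le by (simp add: vec_eq_iff)
  qed
  then show ?thesis
    unfolding invertible_left_inverse matrix_left_invertible_ker by blast
qed


section \<open>Estimates for a single step\<close>

text \<open>First-order optimality without derivatives: along a line, the excess of a quadratic
  objective over its minimum is exactly of this form. A step \<open>- a / k\<close> with
  \<open>k > K\<close> makes it negative unless \<open>a = 0\<close>.\<close>

lemma quadratic_nonneg_linear_zero:
  fixes a K :: real
  assumes "\<And>t. 0 \<le> t * a + t\<^sup>2 * K"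
  shows "a = 0"
proof -
  define k where "k = \<bar>K\<bar> + 1"
  have k: "k > 0" "K < k" by (auto simp: k_def)
  have "0 \<le> (- a / k) * a + (- a / k)\<^sup>2 * K" by (rule assms)
  also have "\<dots> = a\<^sup>2 * (K - k) / k\<^sup>2"
    using k by (simp add: field_simps power2_eq_square)
  finally have "0 \<le> a\<^sup>2 * (K - k)" using k by (simp add: zero_le_divide_iff)
  then have "a\<^sup>2 \<le> 0" using k by (simp add: zero_le_mult_iff)
  then show ?thesis by simp
qed

lemma quadratic_expand:
  fixes x d :: "'x::real_inner"
  shows "(norm (x + t *\<^sub>R d))\<^sup>2 = (norm x)\<^sup>2 + 2 * t * (x \<bullet> d) + t\<^sup>2 * (norm d)\<^sup>2"
  unfolding power2_norm_eq_inner
  by (simp add: inner_add_left inner_add_right inner_commute algebra_simps power2_eq_square)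

text \<open>The minimizer is perturbed in the direction of the candidate gradient \<open>g\<close>
  itself. The linear coefficient is then \<open>g \<bullet> g\<close>, which has to vanish.\<close>

lemma value_step_stationary:
  fixes M :: "real ^ 'n ^ 'm" and \<eta> :: real
  assumes "\<eta> > 0" and min: "\<And>W. c \<bullet> V' + l \<bullet> (M *v V' - b) + \<beta> / 2 * (norm (M *v V' - b))\<^sup>2
        + 1 / (2 * \<eta>) * (norm (V' - V))\<^sup>2
      \<le> c \<bullet> W + l \<bullet> (M *v W - b) + \<beta> / 2 * (norm (M *v W - b))\<^sup>2 + 1 / (2 * \<eta>) * (norm (W - V))\<^sup>2"
  shows "c + transpose M *v (l + \<beta> *\<^sub>R (M *v V' - b)) + (1 / \<eta>) *\<^sub>R (V' - V) = 0"
proof -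
  define g where "g = c + transpose M *v (l + \<beta> *\<^sub>R (M *v V' - b)) + (1 / \<eta>) *\<^sub>R (V' - V)"
  define K where "K = \<beta> / 2 * (norm (M *v g))\<^sup>2 + 1 / (2 * \<eta>) * (norm g)\<^sup>2"
  have "0 \<le> t * (g \<bullet> g) + t\<^sup>2 * K" for t
  proof -
    have 1: "M *v (V' + t *\<^sub>R g) - b = (M *v V' - b) + t *\<^sub>R (M *v g)"
      by (simp add: matrix_vector_right_distrib matrix_vector_mult_scaleR)
    have 2: "V' + t *\<^sub>R g - V = (V' - V) + t *\<^sub>R g" by simp
    have h: "1 / \<eta> = 2 * (1 / (2 * \<eta>))" by simp
    have "0 \<le> t * (c \<bullet> g) + t * (l \<bullet> (M *v g)) + \<beta> * t * ((M *v V' - b) \<bullet> (M *v g))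
        + t\<^sup>2 * (\<beta> / 2 * (norm (M *v g))\<^sup>2) + (1 / \<eta>) * t * ((V' - V) \<bullet> g)
        + t\<^sup>2 * (1 / (2 * \<eta>) * (norm g)\<^sup>2)"
      using min[of "V' + t *\<^sub>R g"] unfolding 1 2 h quadratic_expand inner_add_right
      by (simp add: distrib_left mult_ac)
    also have "\<dots> = t * (g \<bullet> g) + t\<^sup>2 * K"
    proof -
      have "g \<bullet> g = (c + transpose M *v (l + \<beta> *\<^sub>R (M *v V' - b)) + (1 / \<eta>) *\<^sub>R (V' - V)) \<bullet> g"
        by (simp add: g_def)
      also have "\<dots> = c \<bullet> g + l \<bullet> (M *v g) + \<beta> * ((M *v V' - b) \<bullet> (M *v g)) + (1 / \<eta>) * ((V' - V) \<bullet> g)"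
        by (simp only: inner_add_left inner_transpose_mult_vec inner_scaleR_left)
      finally have gg: "g \<bullet> g = \<dots>" .
      show ?thesis unfolding gg K_def by (simp only: distrib_left mult_ac)
    qed
    finally show ?thesis .
  qed
  then have "g \<bullet> g = 0" by (rule quadratic_nonneg_linear_zero)
  then show ?thesis by (simp add: g_def)
qed

text \<open>
  The skew part of the update is coercive, so the cross terms cancel and the resolvent
  contracts in the weighted norm, whatever the kernel.
\<close>

lemma value_multiplier_contraction:
  fixes M :: "real ^ 'n ^ 'm" and \<beta> \<eta> :: real
  assumes pos: "\<beta> > 0" "\<eta> > 0"
    and M: "\<And>x. norm x \<le> \<kappa> * norm (M *v x)" "\<And>y. norm y \<le> \<kappa> * norm (transpose M *v y)"
    and u: "u = u' + \<eta> *\<^sub>R (transpose M *v w')" and w: "w = w' - \<beta> *\<^sub>R (M *v u')"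
    and margin: "60 * \<kappa>\<^sup>2 \<le> \<beta> * \<eta>"
  shows "61 * ((norm u')\<^sup>2 / \<eta> + (norm w')\<^sup>2 / \<beta>) \<le> (norm u)\<^sup>2 / \<eta> + (norm w)\<^sup>2 / \<beta>"
proof -
  have skew: "u' \<bullet> (transpose M *v w') = w' \<bullet> (M *v u')"
    by (metis inner_commute inner_transpose_mult_vec)
  have 1: "(norm u)\<^sup>2 = (norm u')\<^sup>2 + 2 * \<eta> * (w' \<bullet> (M *v u')) + \<eta>\<^sup>2 * (norm (transpose M *v w'))\<^sup>2"
    unfolding u quadratic_expand skew by simp
  have 2: "(norm w)\<^sup>2 = (norm w')\<^sup>2 - 2 * \<beta> * (w' \<bullet> (M *v u')) + \<beta>\<^sup>2 * (norm (M *v u'))\<^sup>2"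
    using quadratic_expand[of w' "- \<beta>" "M *v u'"] unfolding w by simp
  have eq: "(norm u)\<^sup>2 / \<eta> + (norm w)\<^sup>2 / \<beta> = (norm u')\<^sup>2 / \<eta> + (norm w')\<^sup>2 / \<beta>
      + \<eta> * (norm (transpose M *v w'))\<^sup>2 + \<beta> * (norm (M *v u'))\<^sup>2"
    unfolding 1 2 using pos by (simp add: field_simps power2_eq_square)
  have coer: "60 * (x\<^sup>2 / b) \<le> a * y\<^sup>2"
    if "x \<le> \<kappa> * y" "60 * \<kappa>\<^sup>2 \<le> b * a" "0 \<le> x" "0 < a" "0 < b" for x y a b :: real
  proof -
    have "60 * x\<^sup>2 \<le> 60 * (\<kappa> * y)\<^sup>2" using that by (simp add: power_mono)
    also have "\<dots> = 60 * \<kappa>\<^sup>2 * y\<^sup>2" by (simp add: power_mult_distrib)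
    also have "\<dots> \<le> b * a * y\<^sup>2" using that by (intro mult_right_mono) auto
    finally show ?thesis using that by (simp add: field_simps)
  qed
  \<comment> \<open>The weights cross over: the term with \<open>\<eta>\<close> controls the
    multiplier part, weighted by \<open>1 / \<beta>\<close>, and the term with
    \<open>\<beta>\<close> the value part, weighted by \<open>1 / \<eta>\<close>. Hence one margin
    on the product \<open>\<beta> * \<eta>\<close> serves both; the gain 60 on top of the original
    norm gives 61.\<close>
  have "60 * ((norm w')\<^sup>2 / \<beta>) \<le> \<eta> * (norm (transpose M *v w'))\<^sup>2"
    by (rule coer[OF M(2)]) (use pos margin in auto)
  moreover have "60 * ((norm u')\<^sup>2 / \<eta>) \<le> \<beta> * (norm (M *v u'))\<^sup>2"
    by (rule coer[OF M(1)]) (use pos margin in \<open>auto simp: mult.commute\<close>)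
  ultimately show ?thesis using eq unfolding distrib_left by linarith
qed

text \<open>The number \<open>2 * C\<close> is the fixed point of
  \<open>x \<mapsto> x / 2 + C\<close>, so every half-line ending at or above it is
  invariant.\<close>

lemma affine_recursion_bounded:
  fixes a :: "nat \<Rightarrow> real"
  assumes "\<And>k. a (Suc k) \<le> a k / 2 + C"
  shows "a k \<le> max (a 0) (2 * C)"
proof (induction k)
  case (Suc k)
  then show ?case using assms[of k] by auto
qed auto

text \<open>Telescoping, as in a deterministic version of the almost-supermartingale theorem: the
  total decrease is at most the initial value, minus the lower bound, plus the total
  perturbation.\<close>

lemma summable_of_descent:
  fixes a b d :: "nat \<Rightarrow> real"
  assumes descent: "\<And>k. a (Suc k) \<le> a k - b k + d k"
    and "\<And>k. lo \<le> a k" "\<And>k. 0 \<le> b k" "\<And>k. 0 \<le> d k" "summable d"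
  shows "summable b"
proof (rule summableI_nonneg_bounded)
  fix n
  have tele: "sum b {..<n} \<le> a 0 - a n + sum d {..<n}" for n
  proof (induction n)
    case (Suc n)
    then show ?case using descent[of n] by simp
  qed simp
  moreover have "sum d {..<n} \<le> suminf d"
    using assms by (intro sum_le_suminf) auto
  ultimately show "sum b {..<n} \<le> a 0 - lo + suminf d"
    using tele[of n] assms(2)[of n] by linarith
qed (use assms in auto)

text \<open>Here \<open>x\<close> and \<open>y\<close> are true residuals at two iterates at
  distance \<delta>, and \<open>dx\<close>, \<open>dy\<close> are the errors made there. Each
  bracket alone is of order \<open>e\<close>; their difference is of order
  \<open>e * \<delta>\<close>, because residual and noise both vary by at most a multiple of
  \<delta>. Sums of the latter can be handled with square summable errors.\<close>

lemma penalty_noise_diff_le: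
  fixes x y dx dy l :: "'x::real_inner"
  assumes l: "norm l \<le> B" and y: "norm y \<le> C" and xy: "norm (x - y) \<le> C * \<delta>"
    and dx: "norm dx \<le> C * e" and dy: "norm dy \<le> C * e" and dxy: "norm (dx - dy) \<le> C * e * \<delta>"
    and e: "0 \<le> e" "e \<le> E" and nn: "0 \<le> \<delta>" "0 \<le> C" "0 \<le> \<beta>"
  defines "g \<equiv> \<lambda>z. l \<bullet> z + \<beta> / 2 * (norm z)\<^sup>2"
  shows "\<bar>(g (x + dx) - g x) - (g (y + dy) - g y)\<bar>
    \<le> (B * C + 2 * \<beta> * C\<^sup>2 + \<beta> * C\<^sup>2 * E) * (e * \<delta>)"
proof -
  \<comment> \<open>Exact, as \<open>g\<close> is quadratic. Every summand contains
    \<open>x - y\<close> or \<open>dx - dy\<close>, which supplies the factor \<delta>, and also a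
    factor of order \<open>e\<close>.\<close>
  have eq: "(g (x + dx) - g x) - (g (y + dy) - g y)
      = l \<bullet> (dx - dy) + \<beta> * ((x - y) \<bullet> dx) + \<beta> * (y \<bullet> (dx - dy)) + \<beta> / 2 * ((dx - dy) \<bullet> (dx + dy))"
    unfolding g_def power2_norm_eq_inner
    by (simp add: inner_add_left inner_add_right inner_diff_left inner_diff_right inner_commute
        field_simps)
  have B: "0 \<le> B" using l norm_ge_zero order_trans by blast
  have in1: "\<bar>l \<bullet> (dx - dy)\<bar> \<le> B * (C * e * \<delta>)"
    by (rule order_trans[OF Cauchy_Schwarz_ineq2]) (intro mult_mono l dxy B norm_ge_zero)
  have in2: "\<bar>(x - y) \<bullet> dx\<bar> \<le> (C * \<delta>) * (C * e)"
    by (rule order_trans[OF Cauchy_Schwarz_ineq2]) (intro mult_mono xy dx norm_ge_zero mult_nonneg_nonneg nn)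
  have in3: "\<bar>y \<bullet> (dx - dy)\<bar> \<le> C * (C * e * \<delta>)"
    by (rule order_trans[OF Cauchy_Schwarz_ineq2]) (intro mult_mono y dxy norm_ge_zero nn)
  have "norm (dx + dy) \<le> 2 * (C * E)"
  proof -
    have "C * e \<le> C * E" using e nn by (intro mult_left_mono)
    then show ?thesis using norm_triangle_ineq[of dx dy] dx dy by linarith
  qed
  then have in4: "\<bar>(dx - dy) \<bullet> (dx + dy)\<bar> \<le> (C * e * \<delta>) * (2 * (C * E))"
    by (intro order_trans[OF Cauchy_Schwarz_ineq2] mult_mono dxy norm_ge_zero mult_nonneg_nonneg nn e) auto
  have "\<bar>\<beta> * ((x - y) \<bullet> dx)\<bar> \<le> \<beta> * ((C * \<delta>) * (C * e))"
    "\<bar>\<beta> * (y \<bullet> (dx - dy))\<bar> \<le> \<beta> * (C * (C * e * \<delta>))"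
    "\<bar>\<beta> / 2 * ((dx - dy) \<bullet> (dx + dy))\<bar> \<le> \<beta> / 2 * ((C * e * \<delta>) * (2 * (C * E)))"
    using in2 in3 in4 nn by (auto simp only: abs_mult abs_of_nonneg intro!: mult_left_mono)
  with in1 have "\<bar>(g (x + dx) - g x) - (g (y + dy) - g y)\<bar>
      \<le> B * (C * e * \<delta>) + \<beta> * ((C * \<delta>) * (C * e)) + \<beta> * (C * (C * e * \<delta>))
        + \<beta> / 2 * ((C * e * \<delta>) * (2 * (C * E)))"
    unfolding eq by linarith
  also have "\<dots> = (B * C + 2 * \<beta> * C\<^sup>2 + \<beta> * C\<^sup>2 * E) * (e * \<delta>)"
    by (simp add: algebra_simps power2_eq_square)
  finally show ?thesis .
qed

lemma square_sum4_le: "(a + b + x + y)\<^sup>2 \<le> 4 * (a\<^sup>2 + b\<^sup>2 + x\<^sup>2 + (y :: real)\<^sup>2)"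
proof -
  have "0 \<le> (a - b)\<^sup>2 + (a - x)\<^sup>2 + (a - y)\<^sup>2 + (b - x)\<^sup>2 + (b - y)\<^sup>2 + (x - y)\<^sup>2" by simp
  then show ?thesis by (simp add: power2_eq_square algebra_simps)
qed

lemma young_le:
  fixes x y s :: real
  assumes "s > 0"
  shows "x * y \<le> s * x\<^sup>2 + y\<^sup>2 / (4 * s)"
proof -
  have "0 \<le> (2 * s * x - y)\<^sup>2 / (4 * s)" using assms by simp
  also have "\<dots> = s * x\<^sup>2 + y\<^sup>2 / (4 * s) - x * y"
    using assms by (simp add: power2_eq_square field_simps)
  finally show ?thesis by simp
qed

lemma matrix_inv_inverse:
  fixes M :: "real ^ 'n ^ 'n"
  assumes "invertible M"
  shows "M ** matrix_inv M = mat 1" "matrix_inv M ** M = mat 1"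
  using someI_ex[OF assms[unfolded invertible_def]] unfolding matrix_inv_def by auto

lemma invertible_norm_bounds:
  fixes M :: "real ^ 'n ^ 'n"
  assumes inv: "invertible M" and \<kappa>: "spectral_norm (matrix_inv M) \<le> \<kappa>"
  shows "M *v (matrix_inv M *v x) = x" "matrix_inv M *v (M *v x) = x"
    and "transpose M *v (transpose (matrix_inv M) *v x) = x"
    and "transpose (matrix_inv M) *v (transpose M *v x) = x"
    and "norm (matrix_inv M *v x) \<le> \<kappa> * norm x"
    and "norm (transpose (matrix_inv M) *v x) \<le> \<kappa> * norm x"
    and "norm x \<le> \<kappa> * norm (M *v x)" "norm x \<le> \<kappa> * norm (transpose M *v x)"
proof -
  show 1: "M *v (matrix_inv M *v x) = x" "matrix_inv M *v (M *v x) = x" for x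
    using matrix_inv_inverse[OF inv] by (simp_all add: matrix_vector_mul_assoc)
  show 2: "transpose M *v (transpose (matrix_inv M) *v x) = x"
    "transpose (matrix_inv M) *v (transpose M *v x) = x" for x
    unfolding matrix_vector_mul_assoc matrix_transpose_mul[symmetric]
    using matrix_inv_inverse[OF inv] by (simp_all add: transpose_mat)
  show 3: "norm (matrix_inv M *v x) \<le> \<kappa> * norm x" for x
    by (rule order_trans[OF norm_mult_vec_le_spectral mult_right_mono[OF \<kappa>]]) simp
  show 4: "norm (transpose (matrix_inv M) *v x) \<le> \<kappa> * norm x" for x
    by (rule norm_transpose_mult_vec_le[OF 3])
  show "norm x \<le> \<kappa> * norm (M *v x)" "norm x \<le> \<kappa> * norm (transpose M *v x)"
    using 3[of "M *v x"] 4[of "transpose M *v x"] unfolding 1 2 by auto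
qed


section \<open>The iteration along a path\<close>

text \<open>One fixed sample path. The origin of the tables \<open>Ph\<close> and \<open>rh\<close>
  is forgotten except for stochastic rows, the uniform inverse bound and entrywise square
  summability of the errors. The margin is multiplied out so that no quotient by
  \<open>\<eta>\<^sub>V\<close> appears.\<close>

locale noisy_admm =
  fixes P :: "'s::finite \<Rightarrow> 'a::finite \<Rightarrow> 's \<Rightarrow> real"
    and r :: "'s \<Rightarrow> 'a \<Rightarrow> real"
    and \<gamma> :: real
    and c :: "real ^ 's"
    and \<phi> :: "real ^ 'a ^ 's \<Rightarrow> ereal"
    and \<beta> \<eta>\<^sub>\<pi> \<eta>\<^sub>V \<kappa> L\<^sub>M :: real
    and Ph :: "nat \<Rightarrow> 's \<Rightarrow> 'a \<Rightarrow> 's \<Rightarrow> real"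
    and rh :: "nat \<Rightarrow> 's \<Rightarrow> 'a \<Rightarrow> real"
    and pol :: "nat \<Rightarrow> real ^ 'a ^ 's"
    and V l :: "nat \<Rightarrow> real ^ 's"
  assumes P: "\<And>s a. prob_vec (P s a)" and Ph: "\<And>k s a. prob_vec (Ph k s a)"
    and \<gamma>: "0 < \<gamma>" "\<gamma> < 1"
    and phi: "proper_on policies \<phi>" "lsc_on policies \<phi>" "bdd_below_on policies \<phi>"
    and kappa_hat: "\<And>p k. p \<in> policies \<Longrightarrow> spectral_norm (matrix_inv (M_pol \<gamma> (Ph k) p)) \<le> \<kappa>"
    and steps: "\<beta> > 0" "\<eta>\<^sub>\<pi> > 0" "\<eta>\<^sub>V > 0"
    and admm: "\<And>k. admm_step \<phi> c \<beta> \<eta>\<^sub>\<pi> \<eta>\<^sub>V (bellman_res \<gamma> (Ph k) (rh k))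
          (pol k) (V k) (l k) (pol (Suc k)) (V (Suc k)) (l (Suc k))"
    and init: "pol 0 \<in> policies" "\<phi> (pol 0) \<noteq> \<infinity>"
    and lipschitz: "\<And>p q. p \<in> policies \<Longrightarrow> q \<in> policies \<Longrightarrow>
        spectral_norm (M_pol \<gamma> P q - M_pol \<gamma> P p) \<le> L\<^sub>M * norm (q - p)"
    and margin: "60 * \<kappa>\<^sup>2 \<le> \<beta> * \<eta>\<^sub>V" "30 * \<eta>\<^sub>\<pi> * \<kappa> ^ 4 * L\<^sub>M\<^sup>2 * (norm c)\<^sup>2 \<le> \<beta>"
    and err_P: "\<And>s a s'. summable (\<lambda>k. (Ph k s a s' - P s a s')\<^sup>2)"
    and err_r: "\<And>s a. summable (\<lambda>k. (rh k s a - r s a)\<^sup>2)"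
begin

abbreviation "R \<equiv> bellman_res \<gamma> P r"
abbreviation "Rh k \<equiv> bellman_res \<gamma> (Ph k) (rh k)"
abbreviation "M p \<equiv> M_pol \<gamma> P p"
abbreviation "Mh k \<equiv> M_pol \<gamma> (Ph k) (pol (Suc k))"

text \<open>A Euclidean distance between tables: its square is a finite sum of sequences known to be
  summable, and it still dominates every entry.\<close>

definition err :: "nat \<Rightarrow> real" where
  "err k = sqrt (\<Sum>s\<in>UNIV. \<Sum>a\<in>UNIV. (rh k s a - r s a)\<^sup>2 + (\<Sum>s'\<in>UNIV. (Ph k s a s' - P s a s')\<^sup>2))"

lemma err_nonneg: "0 \<le> err k"
  by (auto simp: err_def intro!: sum_nonneg add_nonneg_nonneg)

lemma err_sq: "(err k)\<^sup>2
    = (\<Sum>s\<in>UNIV. \<Sum>a\<in>UNIV. (rh k s a - r s a)\<^sup>2 + (\<Sum>s'\<in>UNIV. (Ph k s a s' - P s a s')\<^sup>2))"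
  unfolding err_def by (rule real_sqrt_pow2) (auto intro!: sum_nonneg add_nonneg_nonneg)

lemma summable_err_sq: "summable (\<lambda>k. (err k)\<^sup>2)"
  unfolding err_sq by (intro summable_sum summable_add err_P err_r)

lemma err_tendsto: "err \<longlonglongrightarrow> 0"
proof -
  have "(\<lambda>k. (err k)\<^sup>2) \<longlonglongrightarrow> 0" by (rule summable_LIMSEQ_zero[OF summable_err_sq])
  from tendsto_real_sqrt[OF this] show ?thesis by (simp add: err_nonneg)
qed

lemma err_bounded: "\<exists>E. \<forall>k. err k \<le> E"
proof -
  have "Bseq err" using err_tendsto by (meson convergentI convergent_imp_Bseq)
  then show ?thesis by (metis BseqD abs_le_D1 real_norm_def)
qed

lemma err_entries: "\<bar>rh k s a - r s a\<bar> \<le> err k" "\<bar>Ph k s a s' - P s a s'\<bar> \<le> err k"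
proof -
  define h where "h s a = (rh k s a - r s a)\<^sup>2 + (\<Sum>s'\<in>UNIV. (Ph k s a s' - P s a s')\<^sup>2)" for s a
  have nn: "0 \<le> h s a" for s a by (auto simp: h_def intro!: sum_nonneg add_nonneg_nonneg)
  have "h s a \<le> (\<Sum>a\<in>UNIV. h s a)"
    by (rule member_le_sum) (use nn in auto)
  also have "\<dots> \<le> (\<Sum>s\<in>UNIV. \<Sum>a\<in>UNIV. h s a)"
    by (rule member_le_sum) (use nn in \<open>auto intro: sum_nonneg\<close>)
  also have "\<dots> = (err k)\<^sup>2" by (simp add: err_sq h_def)
  finally have le: "h s a \<le> (err k)\<^sup>2" .
  have "(rh k s a - r s a)\<^sup>2 \<le> h s a" by (auto simp: h_def intro!: sum_nonneg)
  with le show "\<bar>rh k s a - r s a\<bar> \<le> err k"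
    by (intro abs_le_square_iff[THEN iffD2, of _ "err k", simplified abs_of_nonneg[OF err_nonneg]]) simp
  have "(Ph k s a s' - P s a s')\<^sup>2 \<le> (\<Sum>s'\<in>UNIV. (Ph k s a s' - P s a s')\<^sup>2)"
    by (rule member_le_sum) auto
  also have "\<dots> \<le> h s a" by (simp add: h_def)
  finally show "\<bar>Ph k s a s' - P s a s'\<bar> \<le> err k"
    using le by (intro abs_le_square_iff[THEN iffD2, of _ "err k", simplified abs_of_nonneg[OF err_nonneg]]) simp
qed

text \<open>Depends only on the numbers of states and actions; it pays for the passage from
  entrywise bounds to Euclidean norms.\<close>

definition K :: real where
  "K = real CARD('s) * (real CARD('a) * (1 + real CARD('s)))"

lemma K_nonneg: "0 \<le> K" by (simp add: K_def)

lemma q_table_noise: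
  "norm (q_table \<gamma> (Ph k) (rh k) W - q_table \<gamma> P r W) \<le> K * (err k * (1 + norm W))"
proof -
  have "norm (q_table \<gamma> (Ph k) (rh k) W - q_table \<gamma> P r W)
    \<le> real CARD('s) * (real CARD('a) * (err k + real CARD('s) * (err k * norm W)))"
    by (rule norm_q_table_diff_le) (use err_entries \<gamma> in auto)
  also have "\<dots> \<le> real CARD('s) * (real CARD('a) * ((1 + real CARD('s)) * (err k * (1 + norm W))))"
    by (intro mult_left_mono) (auto simp: algebra_simps err_nonneg)
  finally show ?thesis by (simp add: K_def mult_ac)
qed

lemma q_table_linear_noise:
  "norm (q_table \<gamma> (Ph k) (\<lambda>_ _. 0) W - q_table \<gamma> P (\<lambda>_ _. 0) W) \<le> K * (err k * norm W)"
proof -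
  have "norm (q_table \<gamma> (Ph k) (\<lambda>_ _. 0) W - q_table \<gamma> P (\<lambda>_ _. 0) W)
    \<le> real CARD('s) * (real CARD('a) * (0 + real CARD('s) * (err k * norm W)))"
    by (rule norm_q_table_diff_le) (use err_entries \<gamma> in auto)
  also have "\<dots> \<le> real CARD('s) * (real CARD('a) * ((1 + real CARD('s)) * (err k * norm W)))"
    by (intro mult_left_mono) (auto simp: algebra_simps err_nonneg)
  finally show ?thesis by (simp add: K_def mult_ac)
qed

lemma q_table_linear_bound: "norm (q_table \<gamma> P (\<lambda>_ _. 0) W) \<le> K * norm W"
proof -
  have "norm (q_table \<gamma> P (\<lambda>_ _. 0) W - q_table \<gamma> (\<lambda>_ _ _. 0) (\<lambda>_ _. 0) W)
    \<le> real CARD('s) * (real CARD('a) * (0 + real CARD('s) * (1 * norm W)))"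
    by (rule norm_q_table_diff_le) (use abs_prob_vec_le[OF P] \<gamma> in auto)
  also have "\<dots> \<le> real CARD('s) * (real CARD('a) * ((1 + real CARD('s)) * norm W))"
    by (intro mult_left_mono) (auto simp: algebra_simps)
  also have "q_table \<gamma> (\<lambda>_ _ _. 0) (\<lambda>_ _. 0) W = 0" by (simp add: q_table_def vec_eq_iff)
  finally show ?thesis by (simp add: K_def mult_ac)
qed

lemma q_table_bound: "norm (q_table \<gamma> P r W) \<le> norm (q_table \<gamma> P r 0) + K * norm W"
  using q_table_linear_bound[of W] norm_triangle_ineq[of "q_table \<gamma> P (\<lambda>_ _. 0) W" "q_table \<gamma> P r 0"]
  by (simp add: q_table_split[of \<gamma> P r W])

lemma policy_in: "pol k \<in> policies"
proof (cases k)
  case (Suc j)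
  then show ?thesis using admm[of j] by (auto simp: admm_step_def is_arg_min_def)
qed (use init in simp)

section \<open>Consequences of minimality in the two subproblems\<close>

definition pen :: "real ^ 's \<Rightarrow> real ^ 's \<Rightarrow> real" where
  "pen w z = w \<bullet> z + \<beta> / 2 * (norm z)\<^sup>2"

lemma phi_not_MInf: "p \<in> policies \<Longrightarrow> \<phi> p \<noteq> - \<infinity>"
  using phi(1) by (auto simp: proper_on_def)

text \<open>The term \<open>c \<bullet> V k\<close> is the same finite number on both sides and
  drops out. The inequality stays in \<open>ereal\<close>, because the competitor may have infinite
  cost.\<close>

lemma policy_step_le:
  assumes "p \<in> policies"
  shows "\<phi> (pol (Suc k)) + ereal (pen (l k) (Rh k (pol (Suc k)) (V k))
      + 1 / (2 * \<eta>\<^sub>\<pi>) * (norm (pol (Suc k) - pol k))\<^sup>2)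
    \<le> \<phi> p + ereal (pen (l k) (Rh k p (V k)) + 1 / (2 * \<eta>\<^sub>\<pi>) * (norm (p - pol k))\<^sup>2)"
proof -
  have "aug_lagrangian \<phi> c \<beta> (Rh k) (pol (Suc k)) (V k) (l k) + ereal (1 / (2 * \<eta>\<^sub>\<pi>) * (norm (pol (Suc k) - pol k))\<^sup>2)
    \<le> aug_lagrangian \<phi> c \<beta> (Rh k) p (V k) (l k) + ereal (1 / (2 * \<eta>\<^sub>\<pi>) * (norm (p - pol k))\<^sup>2)"
    using admm[of k] assms by (auto simp: admm_step_def is_arg_min_def not_less)
  then show ?thesis
    using phi_not_MInf[OF policy_in[of "Suc k"]] phi_not_MInf[OF assms]
    unfolding aug_lagrangian_def pen_def
    by (cases "\<phi> (pol (Suc k))"; cases "\<phi> p") auto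
qed

text \<open>The initial policy is a competitor of finite cost in every policy subproblem, so each
  minimizer has finite cost as well.\<close>

lemma phi_finite: "\<bar>\<phi> (pol k)\<bar> \<noteq> \<infinity>"
proof (cases k)
  case 0
  then show ?thesis using phi_not_MInf[OF init(1)] init(2) by auto
next
  case (Suc j)
  show ?thesis
    using policy_step_le[OF init(1), of j] phi_not_MInf[OF policy_in[of k]] init(2)
      phi_not_MInf[OF init(1)]
    unfolding Suc by (cases "\<phi> (pol (Suc j))"; cases "\<phi> (pol 0)") auto
qed

definition phir :: "nat \<Rightarrow> real" where "phir k = real_of_ereal (\<phi> (pol k))"

lemma phi_eq: "\<phi> (pol k) = ereal (phir k)"
  using phi_finite[of k] by (simp add: phir_def ereal_real)

lemma phir_bounded_below: "\<exists>b. \<forall>k. b \<le> phir k"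
  using phi(3) policy_in unfolding bdd_below_on_def by (metis phi_eq ereal_less_eq(3))

lemma policy_descent:
  "phir (Suc k) + pen (l k) (Rh k (pol (Suc k)) (V k)) + 1 / (2 * \<eta>\<^sub>\<pi>) * (norm (pol (Suc k) - pol k))\<^sup>2
    \<le> phir k + pen (l k) (Rh k (pol k) (V k))"
  using policy_step_le[OF policy_in[of k], of k] by (simp add: phi_eq)

lemma value_step_le:
  "c \<bullet> V (Suc k) + pen (l k) (Rh k (pol (Suc k)) (V (Suc k))) + 1 / (2 * \<eta>\<^sub>V) * (norm (V (Suc k) - V k))\<^sup>2
    \<le> c \<bullet> W + pen (l k) (Rh k (pol (Suc k)) W) + 1 / (2 * \<eta>\<^sub>V) * (norm (W - V k))\<^sup>2"
proof -
  have "aug_lagrangian \<phi> c \<beta> (Rh k) (pol (Suc k)) (V (Suc k)) (l k) + ereal (1 / (2 * \<eta>\<^sub>V) * (norm (V (Suc k) - V k))\<^sup>2)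
    \<le> aug_lagrangian \<phi> c \<beta> (Rh k) (pol (Suc k)) W (l k) + ereal (1 / (2 * \<eta>\<^sub>V) * (norm (W - V k))\<^sup>2)"
    using admm[of k] by (auto simp: admm_step_def is_arg_min_def not_less)
  then show ?thesis
    unfolding aug_lagrangian_def pen_def phi_eq by simp
qed

lemma multiplier_step: "l (Suc k) = l k + \<beta> *\<^sub>R Rh k (pol (Suc k)) (V (Suc k))"
  using admm[of k] by (simp add: admm_step_def)

text \<open>The multiplier update is exactly what turns the gradient of the empirical penalty into a
  single multiplier \<open>l (Suc k)\<close>. The resulting identity is exact, with the empirical
  matrix of the batch just used.\<close>

lemma value_stationary: "c + transpose (Mh k) *v l (Suc k) + (1 / \<eta>\<^sub>V) *\<^sub>R (V (Suc k) - V k) = 0"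
proof -
  have "c + transpose (Mh k) *v (l k + \<beta> *\<^sub>R (Mh k *v V (Suc k) - r_pol (rh k) (pol (Suc k))))
      + (1 / \<eta>\<^sub>V) *\<^sub>R (V (Suc k) - V k) = 0"
    by (rule value_step_stationary[OF steps(3)])
      (use value_step_le[of k] in \<open>simp add: pen_def bellman_res_def add_ac\<close>)
  then show ?thesis by (simp add: multiplier_step bellman_res_def)
qed

section \<open>A priori bounds on values and multipliers\<close>

lemma invertible_Mh: "invertible (Mh k)"
  by (rule invertible_M_pol[OF policy_in Ph]) (use \<gamma> in auto)

lemmas Mh_bounds = invertible_norm_bounds[OF invertible_Mh kappa_hat[OF policy_in]]

lemma kappa_nonneg: "0 \<le> \<kappa>"
proof -
  obtain b :: "real ^ 's" where "b \<in> Basis" using nonempty_Basis by blast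
  then show ?thesis
    using order_trans[OF norm_ge_zero Mh_bounds(5)[of 0 b]] by simp
qed

lemma norm_rhat_le: "\<exists>C. \<forall>k. norm (r_pol (rh k) (pol (Suc k))) \<le> C"
proof -
  obtain E where E: "err k \<le> E" for k using err_bounded by blast
  have "norm (r_pol (rh k) (pol (Suc k))) \<le> (real CARD('s) * real CARD('a)) * (norm (q_table \<gamma> P r 0) + K * E)" for k
  proof -
    have "norm (q_table \<gamma> (Ph k) (rh k) 0) \<le> norm (q_table \<gamma> P r 0) + K * (err k * (1 + norm (0 :: real ^ 's)))"
      using q_table_noise[of k 0] norm_triangle_sub[of "q_table \<gamma> (Ph k) (rh k) 0" "q_table \<gamma> P r 0"]
      by linarith
    also have "\<dots> \<le> norm (q_table \<gamma> P r 0) + K * E"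
      using E[of k] K_nonneg by (simp add: mult_left_mono)
    finally have q: "norm (q_table \<gamma> (Ph k) (rh k) 0) \<le> norm (q_table \<gamma> P r 0) + K * E" .
    show ?thesis unfolding r_pol_eq[of "rh k" "pol (Suc k)" \<gamma> "Ph k"]
      by (rule order_trans[OF norm_row_prod_le]) (intro mult_mono q norm_policy_le policy_in, auto)
  qed
  then show ?thesis by blast
qed

text \<open>For a frozen batch and the new policy, the value and multiplier steps contract towards
  the solution of a linear system. That solution moves with \<open>k\<close>, so no convergence
  follows, but its size is uniformly bounded and the contraction then keeps the iterates bounded.
  Descent plays no part here, so the bound may enter the constants of the descent estimate.\<close>

lemma values_multipliers_bounded: "\<exists>B. \<forall>k. norm (V k) \<le> B \<and> norm (l k) \<le> B"
proof -
  obtain C where C: "norm (r_pol (rh k) (pol (Suc k))) \<le> C" for k using norm_rhat_le by blast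
  define wn where "wn x y = (norm x)\<^sup>2 / \<eta>\<^sub>V + (norm y)\<^sup>2 / \<beta>" for x y :: "real ^ 's"
  have sq2: "(norm (x + y))\<^sup>2 \<le> 2 * (norm x)\<^sup>2 + 2 * (norm y)\<^sup>2" for x y :: "real ^ 's"
    using power_mono[OF norm_triangle_ineq[of x y], of 2] sum_squares_bound[of "norm x" "norm y"]
    by (simp add: power2_sum)
  have wn_add: "wn (x + x') (y + y') \<le> 2 * wn x y + 2 * wn x' y'" for x x' y y'
  proof -
    have "(norm (x + x'))\<^sup>2 / \<eta>\<^sub>V \<le> (2 * (norm x)\<^sup>2 + 2 * (norm x')\<^sup>2) / \<eta>\<^sub>V"
      "(norm (y + y'))\<^sup>2 / \<beta> \<le> (2 * (norm y)\<^sup>2 + 2 * (norm y')\<^sup>2) / \<beta>"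
      using steps sq2 by (auto intro!: divide_right_mono)
    then show ?thesis unfolding wn_def add_divide_distrib distrib_left by simp
  qed
  have wn_nonneg: "0 \<le> wn x y" for x y using steps by (simp add: wn_def)
  define A where "A = 3 * ((\<kappa> * C)\<^sup>2 / \<eta>\<^sub>V + (\<kappa> * norm c)\<^sup>2 / \<beta>)"
  have rec: "wn (V (Suc k)) (l (Suc k)) \<le> wn (V k) (l k) / 2 + A" for k
  proof -
    define vs where "vs = matrix_inv (Mh k) *v r_pol (rh k) (pol (Suc k))"
    define ls where "ls = - (transpose (matrix_inv (Mh k)) *v c)"
    have Mvs: "Mh k *v vs = r_pol (rh k) (pol (Suc k))" by (simp add: vs_def Mh_bounds(1))
    have Mls: "transpose (Mh k) *v ls = - c"
      unfolding ls_def mult_vec_minus Mh_bounds(3) ..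
    have st: "transpose (Mh k) *v (l (Suc k) - ls) = - ((1 / \<eta>\<^sub>V) *\<^sub>R (V (Suc k) - V k))"
      using value_stationary[of k] unfolding matrix_vector_mult_diff_distrib Mls
      by (simp add: algebra_simps add_eq_0_iff)
    have "61 * wn (V (Suc k) - vs) (l (Suc k) - ls) \<le> wn (V k - vs) (l k - ls)"
      unfolding wn_def
    proof (rule value_multiplier_contraction[where M = "Mh k" and \<kappa> = \<kappa>])
      show "norm x \<le> \<kappa> * norm (Mh k *v x)" "norm x \<le> \<kappa> * norm (transpose (Mh k) *v x)" for x
        by (rule Mh_bounds)+
      show "V k - vs = (V (Suc k) - vs) + \<eta>\<^sub>V *\<^sub>R (transpose (Mh k) *v (l (Suc k) - ls))"
        unfolding st using steps by simp
      show "l k - ls = (l (Suc k) - ls) - \<beta> *\<^sub>R (Mh k *v (V (Suc k) - vs))"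
        unfolding multiplier_step bellman_res_def matrix_vector_mult_diff_distrib Mvs by simp
    qed (use steps margin in auto)
    moreover have "wn (V (Suc k)) (l (Suc k)) \<le> 2 * wn (V (Suc k) - vs) (l (Suc k) - ls) + 2 * wn vs ls"
      using wn_add[of "V (Suc k) - vs" vs "l (Suc k) - ls" ls] by simp
    moreover have "wn (V k - vs) (l k - ls) \<le> 2 * wn (V k) (l k) + 2 * wn (- vs) (- ls)"
      using wn_add[of "V k" "- vs" "l k" "- ls"] by simp
    moreover have "wn (- vs) (- ls) = wn vs ls" by (simp add: wn_def)
    \<comment> \<open>Recentring costs a factor 2 twice: the coefficient of the old norm is 4/61, at
      most 1/2, and that of the fixed point is 2 + 4/61, at most 3.\<close>
    ultimately have "wn (V (Suc k)) (l (Suc k)) \<le> wn (V k) (l k) / 2 + 3 * wn vs ls"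
      using wn_nonneg[of "V k" "l k"] wn_nonneg[of vs ls] by linarith
    moreover have "wn vs ls \<le> (\<kappa> * C)\<^sup>2 / \<eta>\<^sub>V + (\<kappa> * norm c)\<^sup>2 / \<beta>"
    proof -
      have "norm vs \<le> \<kappa> * C" unfolding vs_def
        by (rule order_trans[OF Mh_bounds(5)]) (intro mult_left_mono C kappa_nonneg)
      moreover have "norm ls \<le> \<kappa> * norm c" unfolding ls_def norm_minus_cancel by (rule Mh_bounds(6))
      ultimately show ?thesis unfolding wn_def
        using steps by (intro add_mono divide_right_mono power_mono) auto
    qed
    then have "3 * wn vs ls \<le> A" unfolding A_def by (intro mult_left_mono) auto
    ultimately show ?thesis by linarith
  qed
  define U where "U = max (wn (V 0) (l 0)) (2 * A)"
  have U: "wn (V k) (l k) \<le> U" for k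
    unfolding U_def by (rule affine_recursion_bounded) (rule rec)
  have "norm (V k) \<le> sqrt (U * \<eta>\<^sub>V) \<and> norm (l k) \<le> sqrt (U * \<beta>)" for k
  proof -
    have "0 \<le> (norm (V k))\<^sup>2 / \<eta>\<^sub>V" "0 \<le> (norm (l k))\<^sup>2 / \<beta>" using steps by simp_all
    then have "(norm (V k))\<^sup>2 / \<eta>\<^sub>V \<le> U" "(norm (l k))\<^sup>2 / \<beta> \<le> U"
      using U[of k] unfolding wn_def by linarith+
    then show ?thesis using steps by (auto intro!: real_le_rsqrt simp: field_simps)
  qed
  then show ?thesis
    by (intro exI[of _ "max (sqrt (U * \<eta>\<^sub>V)) (sqrt (U * \<beta>))"]) (auto simp: le_max_iff_disj)
qed

lemma residual_noise_eq:
  "Rh k p W - R p W = row_prod p (q_table \<gamma> P r W - q_table \<gamma> (Ph k) (rh k) W)"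
  by (simp add: bellman_res_eq row_prod.diff_right)

text \<open>Differences are split bilinearly, changing the policy first and the value second. In the
  last bound the error multiplies the distance, because the noise of the residual is again a row
  product, with the table error in place of the table.\<close>

lemma residual_bounds:
  assumes "0 \<le> B"
  obtains C where "0 \<le> C"
    and "\<And>p W. p \<in> policies \<Longrightarrow> norm W \<le> B \<Longrightarrow> norm (R p W) \<le> C"
    and "\<And>k p W. p \<in> policies \<Longrightarrow> norm W \<le> B \<Longrightarrow> norm (Rh k p W - R p W) \<le> C * err k"
    and "\<And>p q W W'. q \<in> policies \<Longrightarrow> norm W \<le> B
      \<Longrightarrow> norm (R p W - R q W') \<le> C * (norm (p - q) + norm (W - W'))"
    and "\<And>k p q W W'. q \<in> policies \<Longrightarrow> norm W \<le> B
      \<Longrightarrow> norm ((Rh k p W - R p W) - (Rh k q W' - R q W')) \<le> C * err k * (norm (p - q) + norm (W - W'))"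
proof -
  define N where "N = real CARD('s) * real CARD('a)"
  define Q0 where "Q0 = norm (q_table \<gamma> P r 0)"
  have N: "0 \<le> N" "\<And>p. p \<in> policies \<Longrightarrow> norm (p :: real ^ 'a ^ 's) \<le> N"
    using norm_policy_le by (auto simp: N_def)
  have Q0: "0 \<le> Q0" by (simp add: Q0_def)
  have QW: "norm (q_table \<gamma> P r W) \<le> Q0 + K * B" if "norm W \<le> B" for W
    using q_table_bound[of W] mult_left_mono[OF that K_nonneg] by (simp add: Q0_def)
  have QnW: "norm (q_table \<gamma> P r W - q_table \<gamma> (Ph k) (rh k) W) \<le> K * (1 + B) * err k" if "norm W \<le> B" for k W
  proof -
    have "norm (q_table \<gamma> P r W - q_table \<gamma> (Ph k) (rh k) W) \<le> K * (err k * (1 + norm W))"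
      using q_table_noise[of k W] by (simp add: norm_minus_commute)
    also have "\<dots> \<le> K * (err k * (1 + B))"
      using that by (intro mult_left_mono K_nonneg err_nonneg) auto
    finally show ?thesis by (simp add: mult_ac)
  qed
  define C1 C2 C3 C4 C5 where "C1 = B + N * (Q0 + K * B)" and "C2 = N * (K * (1 + B))"
    and "C3 = 1 + N * K" and "C4 = Q0 + K * B" and "C5 = K * (1 + B)"
  define C where "C = C1 + C2 + C3 + C4 + C5"
  note defs = C1_def C2_def C3_def C4_def C5_def
  have nn: "0 \<le> C1" "0 \<le> C2" "0 \<le> C3" "0 \<le> C4" "0 \<le> C5"
    using assms N Q0 K_nonneg by (auto simp: defs)
  have NK: "N * K \<le> C3" by (simp add: C3_def)
  have le: "C1 \<le> C" "C2 \<le> C" "C3 \<le> C" "C4 \<le> C" "C5 \<le> C" "0 \<le> C"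
    using nn by (auto simp: C_def)
  show thesis
  proof (rule that[of C])
    fix p q :: "real ^ 'a ^ 's" and W W' :: "real ^ 's" and k
    assume W: "norm W \<le> B"
    show "norm (R p W) \<le> C" if "p \<in> policies"
    proof -
      have "norm (row_prod p (q_table \<gamma> P r W)) \<le> N * (Q0 + K * B)"
        by (rule order_trans[OF norm_row_prod_le]) (intro mult_mono N that QW W, auto)
      then have "norm (R p W) \<le> C1"
        using W norm_triangle_ineq4[of W "row_prod p (q_table \<gamma> P r W)"] by (simp add: C1_def bellman_res_eq)
      then show ?thesis using le by simp
    qed
    show "norm (Rh k p W - R p W) \<le> C * err k" if "p \<in> policies"
    proof -
      have "norm (Rh k p W - R p W) \<le> N * (K * (1 + B) * err k)"
        unfolding residual_noise_eq
        by (rule order_trans[OF norm_row_prod_le]) (intro mult_mono N that QnW W, auto)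
      also have "\<dots> = C2 * err k" by (simp add: C2_def)
      also have "\<dots> \<le> C * err k" by (intro mult_right_mono le err_nonneg)
      finally show ?thesis .
    qed
    assume q: "q \<in> policies"
    show "norm (R p W - R q W') \<le> C * (norm (p - q) + norm (W - W'))"
    proof -
      have eq: "R p W - R q W' = (W - W') - (row_prod (p - q) (q_table \<gamma> P r W)
          + row_prod q (q_table \<gamma> P (\<lambda>_ _. 0) (W - W')))"
        unfolding bellman_res_eq q_table_diff[of \<gamma> P r W W', symmetric]
        by (simp add: row_prod.diff_left row_prod.diff_right)
      have "norm (row_prod (p - q) (q_table \<gamma> P r W)) \<le> norm (p - q) * C4"
        by (rule order_trans[OF norm_row_prod_le]) (use QW[OF W] in \<open>auto simp: C4_def intro: mult_left_mono\<close>)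
      moreover have "norm (row_prod q (q_table \<gamma> P (\<lambda>_ _. 0) (W - W'))) \<le> N * (K * norm (W - W'))"
        by (rule order_trans[OF norm_row_prod_le]) (intro mult_mono N q q_table_linear_bound, auto)
      ultimately have "norm (R p W - R q W') \<le> norm (W - W') + (norm (p - q) * C4 + N * (K * norm (W - W')))"
        unfolding eq
        by (intro order_trans[OF norm_triangle_ineq4] add_mono order_refl order_trans[OF norm_triangle_ineq])
      also have "\<dots> = C4 * norm (p - q) + C3 * norm (W - W')" by (simp add: C3_def algebra_simps)
      also have "\<dots> \<le> C * norm (p - q) + C * norm (W - W')"
        by (intro add_mono mult_right_mono le) auto
      finally show ?thesis by (simp add: distrib_left)
    qed
    show "norm ((Rh k p W - R p W) - (Rh k q W' - R q W')) \<le> C * err k * (norm (p - q) + norm (W - W'))"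
    proof -
      have eq: "(Rh k p W - R p W) - (Rh k q W' - R q W')
          = row_prod (p - q) (q_table \<gamma> P r W - q_table \<gamma> (Ph k) (rh k) W)
            - row_prod q (q_table \<gamma> (Ph k) (\<lambda>_ _. 0) (W - W') - q_table \<gamma> P (\<lambda>_ _. 0) (W - W'))"
        unfolding residual_noise_eq q_table_diff[of \<gamma> "Ph k" "rh k" W W', symmetric]
          q_table_diff[of \<gamma> P r W W', symmetric]
        by (simp add: row_prod.diff_left row_prod.diff_right)
      have "norm (row_prod (p - q) (q_table \<gamma> P r W - q_table \<gamma> (Ph k) (rh k) W)) \<le> norm (p - q) * (C5 * err k)"
        by (rule order_trans[OF norm_row_prod_le]) (use QnW[OF W] in \<open>auto simp: C5_def intro: mult_left_mono\<close>)
      moreover have "norm (row_prod q (q_table \<gamma> (Ph k) (\<lambda>_ _. 0) (W - W') - q_table \<gamma> P (\<lambda>_ _. 0) (W - W')))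
          \<le> N * (K * (err k * norm (W - W')))"
        by (rule order_trans[OF norm_row_prod_le]) (intro mult_mono N q q_table_linear_noise, auto)
      ultimately have "norm ((Rh k p W - R p W) - (Rh k q W' - R q W'))
          \<le> norm (p - q) * (C5 * err k) + N * (K * (err k * norm (W - W')))"
        unfolding eq by (rule order_trans[OF norm_triangle_ineq4 add_mono])
      also have "\<dots> = C5 * (err k * norm (p - q)) + (N * K) * (err k * norm (W - W'))" by (simp add: algebra_simps)
      also have "\<dots> \<le> C * (err k * norm (p - q)) + C * (err k * norm (W - W'))"
        by (intro add_mono mult_right_mono le order_trans[OF NK] mult_nonneg_nonneg err_nonneg norm_ge_zero)
      finally show ?thesis by (simp add: algebra_simps)
    qed
  qed (rule le)
qed

section \<open>Variation of the multipliers\<close>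

lemma multiplier_eq:
  "l (Suc k) = - (transpose (matrix_inv (Mh k)) *v (c + (1 / \<eta>\<^sub>V) *\<^sub>R (V (Suc k) - V k)))"
proof -
  have "transpose (Mh k) *v l (Suc k) = - (c + (1 / \<eta>\<^sub>V) *\<^sub>R (V (Suc k) - V k))"
    using value_stationary[of k] by (simp add: algebra_simps add_eq_0_iff)
  then have "transpose (matrix_inv (Mh k)) *v (transpose (Mh k) *v l (Suc k))
      = transpose (matrix_inv (Mh k)) *v (- (c + (1 / \<eta>\<^sub>V) *\<^sub>R (V (Suc k) - V k)))" by simp
  then show ?thesis unfolding Mh_bounds(4) mult_vec_minus .
qed

lemma Mh_noise: "norm (Mh k *v x - M (pol (Suc k)) *v x) \<le> real CARD('s) * real CARD('a) * K * err k * norm x"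
proof -
  have "Mh k *v x - M (pol (Suc k)) *v x
      = - row_prod (pol (Suc k)) (q_table \<gamma> (Ph k) (\<lambda>_ _. 0) x - q_table \<gamma> P (\<lambda>_ _. 0) x)"
    by (simp add: M_pol_mult_vec row_prod.diff_right)
  also have "norm \<dots> \<le> (real CARD('s) * real CARD('a)) * (K * (err k * norm x))"
    unfolding norm_minus_cancel
    by (rule order_trans[OF norm_row_prod_le]) (intro mult_mono norm_policy_le policy_in q_table_linear_noise, auto)
  finally show ?thesis by (simp add: mult_ac)
qed

definition K' :: real where "K' = real CARD('s) * real CARD('a) * K"

text \<open>The Lipschitz assumption concerns the true kernel, so the comparison passes through
  \<open>M\<close> at both policies; each passage costs the error of its own batch.\<close>

lemma Mh_diff:
  "norm ((Mh k - Mh (Suc k)) *v x)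
    \<le> (L\<^sub>M * norm (pol (Suc (Suc k)) - pol (Suc k)) + K' * (err (Suc k) + err k)) * norm x"
proof -
  have eq: "(Mh k - Mh (Suc k)) *v x = (Mh k *v x - M (pol (Suc k)) *v x)
     - ((M (pol (Suc (Suc k))) - M (pol (Suc k))) *v x)
     - (Mh (Suc k) *v x - M (pol (Suc (Suc k))) *v x)"
    by (simp add: matrix_vector_mult_diff_rdistrib)
  have "norm ((M (pol (Suc (Suc k))) - M (pol (Suc k))) *v x)
      \<le> (L\<^sub>M * norm (pol (Suc (Suc k)) - pol (Suc k))) * norm x"
    by (rule order_trans[OF norm_mult_vec_le_spectral mult_right_mono[OF lipschitz]])
      (auto intro: policy_in)
  then have "norm ((Mh k - Mh (Suc k)) *v x) \<le> K' * err k * norm x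
      + (L\<^sub>M * norm (pol (Suc (Suc k)) - pol (Suc k))) * norm x + K' * err (Suc k) * norm x"
    unfolding eq K'_def
    by (intro order_trans[OF norm_triangle_ineq4] add_mono Mh_noise)
  then show ?thesis by (simp add: algebra_simps)
qed

text \<open>The multiplier is an explicit function of the inverse matrix and the value increment.
  Subtracting two such formulas involves two consecutive value increments, which is why the Lyapunov
  function carries the previous one. The matrices are compared only through their action on
  \<open>c\<close>, hence the factor \<open>norm c\<close>.\<close>

lemma multiplier_diff_bound:
  "norm (l (Suc (Suc k)) - l (Suc k))
    \<le> \<kappa> / \<eta>\<^sub>V * norm (V (Suc (Suc k)) - V (Suc k)) + \<kappa> / \<eta>\<^sub>V * norm (V (Suc k) - V k)
      + \<kappa>\<^sup>2 * norm c * L\<^sub>M * norm (pol (Suc (Suc k)) - pol (Suc k))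
      + \<kappa>\<^sup>2 * norm c * K' * (err (Suc k) + err k)"
proof -
  define T where "T j = transpose (matrix_inv (Mh j))" for j
  have T: "norm (T j *v x) \<le> \<kappa> * norm x" for j x unfolding T_def by (rule Mh_bounds)
  define \<epsilon> where "\<epsilon> = L\<^sub>M * norm (pol (Suc (Suc k)) - pol (Suc k)) + K' * (err (Suc k) + err k)"
  \<comment> \<open>Resolvent identity: the difference of two inverses is the difference of the
    matrices between the two inverses.\<close>
  have diff: "T (Suc k) *v c - T k *v c
      = T k *v (transpose (Mh k - Mh (Suc k)) *v (T (Suc k) *v c))"
    unfolding T_def transpose_diff matrix_vector_mult_diff_rdistrib matrix_vector_mult_diff_distrib
      Mh_bounds(3,4) ..
  have D1: "norm (T (Suc k) *v c - T k *v c) \<le> \<kappa> * (\<epsilon> * (\<kappa> * norm c))"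
  proof -
    have "norm ((Mh k - Mh (Suc k)) *v x) \<le> \<epsilon> * norm x" for x unfolding \<epsilon>_def by (rule Mh_diff)
    then have 1: "norm (transpose (Mh k - Mh (Suc k)) *v y) \<le> \<epsilon> * norm y" for y
      by (rule norm_transpose_mult_vec_le)
    \<comment> \<open>The sign of \<epsilon> is read off the bound itself, as
      \<open>L\<^sub>M\<close> is just a real constant in the locale.\<close>
    obtain b :: "real ^ 's" where "b \<in> Basis" using nonempty_Basis by blast
    then have \<epsilon>: "0 \<le> \<epsilon>" using order_trans[OF norm_ge_zero 1[of b]] by simp
    show ?thesis unfolding diff
      by (intro order_trans[OF T] mult_left_mono kappa_nonneg order_trans[OF 1] \<epsilon> T)
  qed
  have D2: "l (Suc (Suc k)) - l (Suc k) = (1 / \<eta>\<^sub>V) *\<^sub>R (T k *v (V (Suc k) - V k))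
      - (1 / \<eta>\<^sub>V) *\<^sub>R (T (Suc k) *v (V (Suc (Suc k)) - V (Suc k))) - (T (Suc k) *v c - T k *v c)"
    unfolding multiplier_eq[of k] multiplier_eq[of "Suc k"] T_def[symmetric]
      matrix_vector_right_distrib matrix_vector_mult_scaleR by simp
  have D3: "norm ((1 / \<eta>\<^sub>V) *\<^sub>R (T j *v x)) \<le> \<kappa> / \<eta>\<^sub>V * norm x" for j x
    using divide_right_mono[OF T[of j x], of \<eta>\<^sub>V] steps by simp
  have "norm (l (Suc (Suc k)) - l (Suc k))
      \<le> \<kappa> / \<eta>\<^sub>V * norm (V (Suc k) - V k) + \<kappa> / \<eta>\<^sub>V * norm (V (Suc (Suc k)) - V (Suc k)) + \<kappa> * (\<epsilon> * (\<kappa> * norm c))"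
    unfolding D2
    by (rule order_trans[OF norm_triangle_ineq4 add_mono[OF order_trans[OF norm_triangle_ineq4
          add_mono[OF D3 D3]] D1]])
  then show ?thesis unfolding \<epsilon>_def by (simp add: algebra_simps power2_eq_square)
qed

section \<open>The Lyapunov function and its descent\<close>

definition lag :: "nat \<Rightarrow> real" where
  "lag k = phir k + c \<bullet> V k + pen (l k) (R (pol k) (V k))"

text \<open>The linear bookkeeping of the descent, with all products replaced by opaque reals. The
  proximal gains are three units \<open>a1\<close>, and three units \<open>b1\<close> plus
  \<open>b4\<close>. One \<open>a1\<close> and one \<open>b1\<close> pay for the noise, one of each
  for the multiplier increment; the last \<open>b1\<close> is stored as potential, and
  \<open>a1 + b4\<close> is the net decrease.\<close>

lemma descent_arith:
  fixes pX pX' pY pY' :: real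
  assumes "\<bar>(pX' - pX) - (pY' - pY)\<bar> \<le> N" "f' + v' + pX' + A + B \<le> f + v + pY'"
    "L' = f' + v' + pX + i" "L = f + v + pY" "i \<le> q + t1" "q \<le> b1 + b0 + a1 + t2"
    "N \<le> a1 + b1 + t3" "t3 + t1 + t2 \<le> T" "A = a1 + a1 + a1" "B = b1 + b1 + b1 + b4"
  shows "L' + b1 \<le> L + b0 - (a1 + b4) + T"
  using assms by linarith

lemma pen_add: "pen (w + w') z = pen w z + w' \<bullet> z"
  by (simp add: pen_def inner_add_left)

text \<open>
  The true Lagrangian is evaluated along the noisy iteration, so the noise enters only through
  its increments: an error term of order \<open>err * step\<close>, absorbed by Young's inequality at the
  price of \<open>err\<^sup>2\<close>.
\<close>

lemma lyapunov_descent: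
  obtains C where "0 \<le> C" and "\<And>k.
    lag (Suc (Suc k)) + (norm (V (Suc (Suc k)) - V (Suc k)))\<^sup>2 / (12 * \<eta>\<^sub>V)
    \<le> lag (Suc k) + (norm (V (Suc k) - V k))\<^sup>2 / (12 * \<eta>\<^sub>V)
      - ((norm (pol (Suc (Suc k)) - pol (Suc k)))\<^sup>2 / (6 * \<eta>\<^sub>\<pi>)
         + (norm (V (Suc (Suc k)) - V (Suc k)))\<^sup>2 / (4 * \<eta>\<^sub>V))
      + C * ((err (Suc k))\<^sup>2 + (err k)\<^sup>2)"
proof -
  obtain B where B: "\<And>k. norm (V k) \<le> B" "\<And>k. norm (l k) \<le> B"
    using values_multipliers_bounded by blast
  have B0: "0 \<le> B" using order_trans[OF norm_ge_zero B(1)] .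
  obtain E where E: "\<And>k. err k \<le> E" using err_bounded by blast
  obtain C where C: "0 \<le> C"
    and C1: "\<And>p W. p \<in> policies \<Longrightarrow> norm W \<le> B \<Longrightarrow> norm (R p W) \<le> C"
    and C2: "\<And>k p W. p \<in> policies \<Longrightarrow> norm W \<le> B \<Longrightarrow> norm (Rh k p W - R p W) \<le> C * err k"
    and C3: "\<And>p q W W'. q \<in> policies \<Longrightarrow> norm W \<le> B
      \<Longrightarrow> norm (R p W - R q W') \<le> C * (norm (p - q) + norm (W - W'))"
    and C4: "\<And>k p q W W'. q \<in> policies \<Longrightarrow> norm W \<le> B
      \<Longrightarrow> norm ((Rh k p W - R p W) - (Rh k q W' - R q W')) \<le> C * err k * (norm (p - q) + norm (W - W'))"
    using residual_bounds[OF B0] by blast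
  define D where "D = B * C + 2 * \<beta> * C\<^sup>2 + \<beta> * C\<^sup>2 * E"
  define G where "G = 3 / 2 * \<eta>\<^sub>\<pi> * D\<^sup>2 + 3 * \<eta>\<^sub>V * D\<^sup>2 + \<beta> * C\<^sup>2"
  define H where "H = 5 / \<beta> * (\<kappa>\<^sup>2 * norm c * K')\<^sup>2"
  have G0: "0 \<le> G" "0 \<le> H" using steps by (auto simp: G_def H_def intro!: add_nonneg_nonneg)
  show thesis
  proof (rule that[of "G + 2 * H"])
    show "0 \<le> G + 2 * H" using G0 by simp
    fix k
    define n where "n = Suc k"
    define a b b0 d e e0 where "a = norm (pol (Suc n) - pol n)" and "b = norm (V (Suc n) - V n)"
      and "b0 = norm (V n - V k)" and "d = norm (l (Suc n) - l n)" and "e = err n" and "e0 = err k"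
    define X Y where "X = R (pol (Suc n)) (V (Suc n))" and "Y = R (pol n) (V n)"
    define dX dY where "dX = Rh n (pol (Suc n)) (V (Suc n)) - X" and "dY = Rh n (pol n) (V n) - Y"
    have e: "0 \<le> e" "0 \<le> e0" by (auto simp: e_def e0_def err_nonneg)
    have Rhs: "Rh n (pol (Suc n)) (V (Suc n)) = X + dX" "Rh n (pol n) (V n) = Y + dY"
      by (auto simp: dX_def dY_def)
    have dXn: "norm dX \<le> C * e" unfolding dX_def X_def e_def by (intro C2 policy_in B)
    have f1: "\<bar>(pen (l n) (X + dX) - pen (l n) X) - (pen (l n) (Y + dY) - pen (l n) Y)\<bar> \<le> D * (e * (a + b))"
      unfolding pen_def D_def
    proof (rule penalty_noise_diff_le)
      show "norm (l n) \<le> B" by (rule B)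
      show "norm Y \<le> C" unfolding Y_def by (intro C1 policy_in B)
      show "norm (X - Y) \<le> C * (a + b)" unfolding X_def Y_def a_def b_def by (intro C3 policy_in B)
      show "norm dY \<le> C * e" unfolding dY_def Y_def e_def by (intro C2 policy_in B)
      show "norm (dX - dY) \<le> C * e * (a + b)"
        unfolding dX_def dY_def X_def Y_def a_def b_def e_def by (intro C4 policy_in B)
      show "e \<le> E" unfolding e_def by (rule E)
      show "0 \<le> a + b" unfolding a_def b_def by simp
    qed (use dXn e C steps in auto)
    \<comment> \<open>The value step is tested against the old value \<open>V n\<close>, so the
      intermediate penalty at the new policy and the old value cancels.\<close>
    have f2: "phir (Suc n) + c \<bullet> V (Suc n) + pen (l n) (X + dX) + 1 / (2 * \<eta>\<^sub>\<pi>) * a\<^sup>2 + 1 / (2 * \<eta>\<^sub>V) * b\<^sup>2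
        \<le> phir n + c \<bullet> V n + pen (l n) (Y + dY)"
      using policy_descent[of n] value_step_le[of n "V n"] unfolding Rhs a_def b_def by simp
    have f3: "lag (Suc n) = phir (Suc n) + c \<bullet> V (Suc n) + pen (l n) X + (l (Suc n) - l n) \<bullet> X"
      using pen_add[of "l n" "l (Suc n) - l n" X] by (simp add: lag_def X_def)
    have f4: "lag n = phir n + c \<bullet> V n + pen (l n) Y" by (simp add: lag_def Y_def)
    \<comment> \<open>The multiplier follows the empirical residual, so the true one is the scaled
      multiplier increment minus \<open>dX\<close>. The factor 5/4 is the exact term 1 plus 1/4
      spent in Young's inequality on the cross term.\<close>
    have f5: "(l (Suc n) - l n) \<bullet> X \<le> 5 / 4 * (d\<^sup>2 / \<beta>) + \<beta> * C\<^sup>2 * e\<^sup>2"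
    proof -
      have "X = (1 / \<beta>) *\<^sub>R (l (Suc n) - l n) - dX"
        using steps multiplier_step[of n] by (simp add: Rhs)
      then have "(l (Suc n) - l n) \<bullet> X = d\<^sup>2 / \<beta> - (l (Suc n) - l n) \<bullet> dX"
        by (simp add: inner_diff_right d_def power2_norm_eq_inner)
      also have "\<dots> \<le> d\<^sup>2 / \<beta> + d * (C * e)"
      proof -
        have "\<bar>(l (Suc n) - l n) \<bullet> dX\<bar> \<le> d * (C * e)"
          unfolding d_def
          by (rule order_trans[OF Cauchy_Schwarz_ineq2]) (intro mult_left_mono dXn norm_ge_zero)
        then show ?thesis by linarith
      qed
      also have "d * (C * e) \<le> d\<^sup>2 / \<beta> / 4 + \<beta> * C\<^sup>2 * e\<^sup>2"
        using young_le[of "1 / (4 * \<beta>)" d "C * e"] steps by (simp add: power_mult_distrib mult_ac)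
      finally show ?thesis by simp
    qed
    \<comment> \<open>Four contributions give the factor 4, and 4 * 5/4 = 5. The two margins are
      precisely what brings the value and policy parts below twelfths and a sixth.\<close>
    have f6: "5 / 4 * (d\<^sup>2 / \<beta>) \<le> b\<^sup>2 / (12 * \<eta>\<^sub>V) + b0\<^sup>2 / (12 * \<eta>\<^sub>V) + a\<^sup>2 / (6 * \<eta>\<^sub>\<pi>) + 2 * H * (e\<^sup>2 + e0\<^sup>2)"
    proof -
      define x1 x2 x3 x4 where "x1 = \<kappa> / \<eta>\<^sub>V * b" and "x2 = \<kappa> / \<eta>\<^sub>V * b0"
        and "x3 = \<kappa>\<^sup>2 * norm c * L\<^sub>M * a" and "x4 = \<kappa>\<^sup>2 * norm c * K' * (e + e0)"
      have "d \<le> x1 + x2 + x3 + x4"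
        using multiplier_diff_bound[of k]
        by (simp add: d_def x1_def x2_def x3_def x4_def a_def b_def b0_def e_def e0_def n_def)
      then have "d\<^sup>2 \<le> (x1 + x2 + x3 + x4)\<^sup>2" by (intro power_mono) (auto simp: d_def)
      also have "\<dots> \<le> 4 * (x1\<^sup>2 + x2\<^sup>2 + x3\<^sup>2 + x4\<^sup>2)" by (rule square_sum4_le)
      finally have "5 / 4 * (d\<^sup>2 / \<beta>) \<le> 5 / 4 * ((4 * (x1\<^sup>2 + x2\<^sup>2 + x3\<^sup>2 + x4\<^sup>2)) / \<beta>)"
        using steps by (intro mult_left_mono divide_right_mono) auto
      also have "\<dots> = 5 / \<beta> * x1\<^sup>2 + 5 / \<beta> * x2\<^sup>2 + 5 / \<beta> * x3\<^sup>2 + 5 / \<beta> * x4\<^sup>2"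
        by (simp add: add_divide_distrib distrib_left)
      also have "\<dots> \<le> b\<^sup>2 / (12 * \<eta>\<^sub>V) + b0\<^sup>2 / (12 * \<eta>\<^sub>V) + a\<^sup>2 / (6 * \<eta>\<^sub>\<pi>) + 2 * H * (e\<^sup>2 + e0\<^sup>2)"
      proof (intro add_mono)
        have V: "5 / \<beta> * (\<kappa> / \<eta>\<^sub>V * z)\<^sup>2 \<le> z\<^sup>2 / (12 * \<eta>\<^sub>V)" for z
        proof -
          have "60 * \<kappa>\<^sup>2 * z\<^sup>2 \<le> \<beta> * \<eta>\<^sub>V * z\<^sup>2" by (intro mult_right_mono margin) auto
          then show ?thesis using steps by (simp add: field_simps power2_eq_square)
        qed
        show "5 / \<beta> * x1\<^sup>2 \<le> b\<^sup>2 / (12 * \<eta>\<^sub>V)" "5 / \<beta> * x2\<^sup>2 \<le> b0\<^sup>2 / (12 * \<eta>\<^sub>V)"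
          unfolding x1_def x2_def by (rule V)+
        show "5 / \<beta> * x3\<^sup>2 \<le> a\<^sup>2 / (6 * \<eta>\<^sub>\<pi>)"
        proof -
          have "30 * \<eta>\<^sub>\<pi> * \<kappa> ^ 4 * L\<^sub>M\<^sup>2 * (norm c)\<^sup>2 * a\<^sup>2 \<le> \<beta> * a\<^sup>2" by (intro mult_right_mono margin) auto
          then show ?thesis using steps
            by (simp add: x3_def field_simps power2_eq_square eval_nat_numeral)
        qed
        show "5 / \<beta> * x4\<^sup>2 \<le> 2 * H * (e\<^sup>2 + e0\<^sup>2)"
        proof -
          have "5 / \<beta> * x4\<^sup>2 = H * (e + e0)\<^sup>2" by (simp add: x4_def H_def power_mult_distrib)
          also have "\<dots> \<le> H * (2 * (e\<^sup>2 + e0\<^sup>2))"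
            using sum_squares_bound[of e e0] by (intro mult_left_mono G0) (simp add: power2_sum)
          finally show ?thesis by (simp add: mult_ac)
        qed
      qed
      finally show ?thesis .
    qed
    \<comment> \<open>The Young weights are the shares of the proximal terms reserved for noise;
      only multiples of \<open>e\<^sup>2\<close> remain.\<close>
    have f7: "D * (e * (a + b)) \<le> a\<^sup>2 / (6 * \<eta>\<^sub>\<pi>) + b\<^sup>2 / (12 * \<eta>\<^sub>V)
        + (3 / 2 * \<eta>\<^sub>\<pi> * D\<^sup>2 + 3 * \<eta>\<^sub>V * D\<^sup>2) * e\<^sup>2"
    proof -
      have "a * (D * e) \<le> a\<^sup>2 / (6 * \<eta>\<^sub>\<pi>) + 3 / 2 * \<eta>\<^sub>\<pi> * D\<^sup>2 * e\<^sup>2"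
        using young_le[of "1 / (6 * \<eta>\<^sub>\<pi>)" a "D * e"] steps by (simp add: power_mult_distrib mult_ac)
      moreover have "b * (D * e) \<le> b\<^sup>2 / (12 * \<eta>\<^sub>V) + 3 * \<eta>\<^sub>V * D\<^sup>2 * e\<^sup>2"
        using young_le[of "1 / (12 * \<eta>\<^sub>V)" b "D * e"] steps by (simp add: power_mult_distrib mult_ac)
      moreover have "D * (e * (a + b)) = a * (D * e) + b * (D * e)" by (simp add: algebra_simps)
      ultimately show ?thesis unfolding distrib_right by linarith
    qed
    have f8: "(3 / 2 * \<eta>\<^sub>\<pi> * D\<^sup>2 + 3 * \<eta>\<^sub>V * D\<^sup>2) * e\<^sup>2 + \<beta> * C\<^sup>2 * e\<^sup>2 + 2 * H * (e\<^sup>2 + e0\<^sup>2)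
        \<le> (G + 2 * H) * (e\<^sup>2 + e0\<^sup>2)"
    proof -
      have "(3 / 2 * \<eta>\<^sub>\<pi> * D\<^sup>2 + 3 * \<eta>\<^sub>V * D\<^sup>2) * e\<^sup>2 + \<beta> * C\<^sup>2 * e\<^sup>2 = G * e\<^sup>2"
        unfolding G_def distrib_right ..
      also have "\<dots> \<le> G * (e\<^sup>2 + e0\<^sup>2)" by (intro mult_left_mono G0) simp
      finally show ?thesis by (simp add: distrib_right)
    qed
    have f9: "1 / (2 * \<eta>\<^sub>\<pi>) * a\<^sup>2 = a\<^sup>2 / (6 * \<eta>\<^sub>\<pi>) + a\<^sup>2 / (6 * \<eta>\<^sub>\<pi>) + a\<^sup>2 / (6 * \<eta>\<^sub>\<pi>)"
      "1 / (2 * \<eta>\<^sub>V) * b\<^sup>2 = b\<^sup>2 / (12 * \<eta>\<^sub>V) + b\<^sup>2 / (12 * \<eta>\<^sub>V) + b\<^sup>2 / (12 * \<eta>\<^sub>V) + b\<^sup>2 / (4 * \<eta>\<^sub>V)"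
      using steps by (simp_all add: field_simps)
    have "lag (Suc n) + b\<^sup>2 / (12 * \<eta>\<^sub>V) \<le> lag n + b0\<^sup>2 / (12 * \<eta>\<^sub>V)
        - (a\<^sup>2 / (6 * \<eta>\<^sub>\<pi>) + b\<^sup>2 / (4 * \<eta>\<^sub>V)) + (G + 2 * H) * (e\<^sup>2 + e0\<^sup>2)"
      by (rule descent_arith[OF f1 f2 f3 f4 f5 f6 f7 f8 f9])
    then show "lag (Suc (Suc k)) + (norm (V (Suc (Suc k)) - V (Suc k)))\<^sup>2 / (12 * \<eta>\<^sub>V)
      \<le> lag (Suc k) + (norm (V (Suc k) - V k))\<^sup>2 / (12 * \<eta>\<^sub>V)
        - ((norm (pol (Suc (Suc k)) - pol (Suc k)))\<^sup>2 / (6 * \<eta>\<^sub>\<pi>)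
           + (norm (V (Suc (Suc k)) - V (Suc k)))\<^sup>2 / (4 * \<eta>\<^sub>V))
        + (G + 2 * H) * ((err (Suc k))\<^sup>2 + (err k)\<^sup>2)"
      by (simp add: a_def b_def b0_def e_def e0_def n_def)
  qed
qed

text \<open>The Lagrangian is bounded below along the path: \<open>\<phi>\<close> is bounded below,
  values and multipliers are bounded and the squared residual is nonnegative. The descent compares
  steps \<open>Suc k\<close> and \<open>k\<close>, so summability is first obtained for the shifted
  sequences.\<close>

lemma increments_summable:
  "summable (\<lambda>k. (norm (pol (Suc k) - pol k))\<^sup>2)" "summable (\<lambda>k. (norm (V (Suc k) - V k))\<^sup>2)"
proof -
  define a b where "a k = (norm (pol (Suc k) - pol k))\<^sup>2" and "b k = (norm (V (Suc k) - V k))\<^sup>2" for k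
  obtain C where C: "0 \<le> C" and descent: "\<And>k. lag (Suc (Suc k)) + b (Suc k) / (12 * \<eta>\<^sub>V)
    \<le> lag (Suc k) + b k / (12 * \<eta>\<^sub>V) - (a (Suc k) / (6 * \<eta>\<^sub>\<pi>) + b (Suc k) / (4 * \<eta>\<^sub>V))
      + C * ((err (Suc k))\<^sup>2 + (err k)\<^sup>2)"
    unfolding a_def b_def by (rule lyapunov_descent) blast
  obtain B where B: "\<And>k. norm (V k) \<le> B" "\<And>k. norm (l k) \<le> B"
    using values_multipliers_bounded by blast
  have B0: "0 \<le> B" using order_trans[OF norm_ge_zero B(1)] .
  obtain C' where C': "\<And>p W. p \<in> policies \<Longrightarrow> norm W \<le> B \<Longrightarrow> norm (R p W) \<le> C'"
    by (rule residual_bounds[OF B0], rule that)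
  obtain \<phi>0 where \<phi>0: "\<And>k. \<phi>0 \<le> phir k" using phir_bounded_below by blast
  have lag_lower: "\<phi>0 - norm c * B - B * C' \<le> lag k" for k
  proof -
    have "\<bar>c \<bullet> V k\<bar> \<le> norm c * B"
      by (rule order_trans[OF Cauchy_Schwarz_ineq2]) (intro mult_left_mono B norm_ge_zero)
    moreover have "\<bar>l k \<bullet> R (pol k) (V k)\<bar> \<le> B * C'"
      by (rule order_trans[OF Cauchy_Schwarz_ineq2]) (intro mult_mono B C' policy_in B0 norm_ge_zero)
    moreover have "0 \<le> \<beta> / 2 * (norm (R (pol k) (V k)))\<^sup>2" using steps by simp
    ultimately show ?thesis using \<phi>0[of k] unfolding lag_def pen_def by linarith
  qed
  have nn: "0 \<le> a k" "0 \<le> b k" for k by (simp_all add: a_def b_def)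
  have "summable (\<lambda>k. a (Suc k) / (6 * \<eta>\<^sub>\<pi>) + b (Suc k) / (4 * \<eta>\<^sub>V))"
  proof (rule summable_of_descent[where a = "\<lambda>k. lag (Suc k) + b k / (12 * \<eta>\<^sub>V)"
        and d = "\<lambda>k. C * ((err (Suc k))\<^sup>2 + (err k)\<^sup>2)"])
    show "\<phi>0 - norm c * B - B * C' \<le> lag (Suc k) + b k / (12 * \<eta>\<^sub>V)" for k
    proof -
      have "0 \<le> b k / (12 * \<eta>\<^sub>V)" using nn steps by simp
      then show ?thesis using lag_lower[of "Suc k"] by linarith
    qed
    show "summable (\<lambda>k. C * ((err (Suc k))\<^sup>2 + (err k)\<^sup>2))"
      using summable_ignore_initial_segment[OF summable_err_sq, of 1]
      by (intro summable_mult summable_add summable_err_sq) simp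
  qed (use descent nn steps C in auto)
  then have *: "summable (\<lambda>k. a k / (6 * \<eta>\<^sub>\<pi>) + b k / (4 * \<eta>\<^sub>V))" by (subst (asm) summable_Suc_iff)
  have "summable (\<lambda>k. a k / (6 * \<eta>\<^sub>\<pi>))"
    by (rule summable_comparison_test'[OF *]) (use nn steps in auto)
  from summable_mult[OF this, of "6 * \<eta>\<^sub>\<pi>"]
  show "summable (\<lambda>k. (norm (pol (Suc k) - pol k))\<^sup>2)" using steps by (simp add: a_def)
  have "summable (\<lambda>k. b k / (4 * \<eta>\<^sub>V))"
    by (rule summable_comparison_test'[OF *]) (use nn steps in auto)
  from summable_mult[OF this, of "4 * \<eta>\<^sub>V"]
  show "summable (\<lambda>k. (norm (V (Suc k) - V k))\<^sup>2)" using steps by (simp add: b_def)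
qed

lemma tendsto_zero_of_summable_sq:
  fixes x :: "nat \<Rightarrow> 'x::real_normed_vector"
  assumes "summable (\<lambda>k. (norm (x k))\<^sup>2)"
  shows "x \<longlonglongrightarrow> 0"
proof -
  have "(\<lambda>k. norm (x k)) \<longlonglongrightarrow> 0"
    using tendsto_real_sqrt[OF summable_LIMSEQ_zero[OF assms]] by simp
  then show ?thesis by (rule tendsto_norm_zero_cancel)
qed

lemma policy_increments: "(\<lambda>k. pol (Suc k) - pol k) \<longlonglongrightarrow> 0"
  and value_increments: "(\<lambda>k. V (Suc k) - V k) \<longlonglongrightarrow> 0"
  by (rule tendsto_zero_of_summable_sq[OF increments_summable(1)],
      rule tendsto_zero_of_summable_sq[OF increments_summable(2)])

lemma multiplier_increments: "(\<lambda>k. l (Suc k) - l k) \<longlonglongrightarrow> 0"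
proof (rule LIMSEQ_imp_Suc, rule Lim_null_comparison[OF always_eventually[OF allI[OF multiplier_diff_bound]]])
  have "(\<lambda>k. \<kappa> / \<eta>\<^sub>V * norm (V (Suc (Suc k)) - V (Suc k)) + \<kappa> / \<eta>\<^sub>V * norm (V (Suc k) - V k)
      + \<kappa>\<^sup>2 * norm c * L\<^sub>M * norm (pol (Suc (Suc k)) - pol (Suc k))
      + \<kappa>\<^sup>2 * norm c * K' * (err (Suc k) + err k))
    \<longlonglongrightarrow> \<kappa> / \<eta>\<^sub>V * norm (0 :: real ^ 's) + \<kappa> / \<eta>\<^sub>V * norm (0 :: real ^ 's)
      + \<kappa>\<^sup>2 * norm c * L\<^sub>M * norm (0 :: real ^ 'a ^ 's) + \<kappa>\<^sup>2 * norm c * K' * (0 + 0)"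
    by (intro tendsto_intros value_increments policy_increments LIMSEQ_Suc[OF value_increments]
        LIMSEQ_Suc[OF policy_increments] err_tendsto LIMSEQ_Suc[OF err_tendsto])
  then show "(\<lambda>k. \<kappa> / \<eta>\<^sub>V * norm (V (Suc (Suc k)) - V (Suc k)) + \<kappa> / \<eta>\<^sub>V * norm (V (Suc k) - V k)
      + \<kappa>\<^sup>2 * norm c * L\<^sub>M * norm (pol (Suc (Suc k)) - pol (Suc k))
      + \<kappa>\<^sup>2 * norm c * K' * (err (Suc k) + err k)) \<longlonglongrightarrow> 0" by simp
qed

text \<open>The empirical residual at the end of step \<open>k\<close> is the multiplier increment
  divided by \<open>\<beta>\<close>, and it differs from the true one by
  \<open>O(err k)\<close>.\<close>

lemma residual_tendsto: "(\<lambda>k. R (pol k) (V k)) \<longlonglongrightarrow> 0"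
proof (rule LIMSEQ_imp_Suc)
  obtain B where B: "\<And>k. norm (V k) \<le> B" using values_multipliers_bounded by blast
  have B0: "0 \<le> B" using order_trans[OF norm_ge_zero B] .
  obtain C where C: "\<And>k p W. p \<in> policies \<Longrightarrow> norm W \<le> B \<Longrightarrow> norm (Rh k p W - R p W) \<le> C * err k"
    by (rule residual_bounds[OF B0], rule that)
  have eq: "R (pol (Suc k)) (V (Suc k)) = (1 / \<beta>) *\<^sub>R (l (Suc k) - l k)
      - (Rh k (pol (Suc k)) (V (Suc k)) - R (pol (Suc k)) (V (Suc k)))" for k
    using steps by (simp add: multiplier_step)
  have "(\<lambda>k. Rh k (pol (Suc k)) (V (Suc k)) - R (pol (Suc k)) (V (Suc k))) \<longlonglongrightarrow> 0"
  proof (rule Lim_null_comparison)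
    show "\<forall>\<^sub>F k in sequentially. norm (Rh k (pol (Suc k)) (V (Suc k)) - R (pol (Suc k)) (V (Suc k))) \<le> C * err k"
      by (intro always_eventually allI C policy_in B)
    show "(\<lambda>k. C * err k) \<longlonglongrightarrow> 0" using tendsto_mult_left[OF err_tendsto, of C] by simp
  qed
  from tendsto_diff[OF tendsto_scaleR[OF tendsto_const[of "1 / \<beta>"] multiplier_increments] this]
  show "(\<lambda>k. R (pol (Suc k)) (V (Suc k))) \<longlonglongrightarrow> 0"
    unfolding eq[symmetric] by simp
qed

section \<open>First-order conditions and their limits\<close>

abbreviation "\<psi> \<equiv> \<lambda>p. \<phi> p + indicator_fun policies p"

text \<open>The residual is affine in the policy, so the smooth part of the subproblem is exactly
  quadratic. Minimality therefore yields a global minorant of \<open>\<psi>\<close> with slope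
  \<open>v\<close> and a quadratic defect, which is a regular subgradient by definition; no calculus
  rule for the nonsmooth \<open>\<phi>\<close> is involved.\<close>

lemma regular_subdiff_step:
  "row_scale (l k + \<beta> *\<^sub>R Rh k (pol (Suc k)) (V k)) (q_table \<gamma> (Ph k) (rh k) (V k))
     - (1 / \<eta>\<^sub>\<pi>) *\<^sub>R (pol (Suc k) - pol k) \<in> regular_subdiff \<psi> (pol (Suc k))"
proof -
  define x where "x = pol (Suc k)"
  define Q where "Q = q_table \<gamma> (Ph k) (rh k) (V k)"
  define w where "w = l k + \<beta> *\<^sub>R Rh k x (V k)"
  define v where "v = row_scale w Q - (1 / \<eta>\<^sub>\<pi>) *\<^sub>R (x - pol k)"
  define G where "G = \<beta> / 2 * (norm Q)\<^sup>2 + 1 / (2 * \<eta>\<^sub>\<pi>)"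
  have x: "x \<in> policies" unfolding x_def by (rule policy_in)
  have \<phi>x: "\<phi> x = ereal (phir (Suc k))" unfolding x_def by (rule phi_eq)
  have lower: "phir (Suc k) + v \<bullet> (y - x) - G * (norm (y - x))\<^sup>2 \<le> a" if "y \<in> policies" "\<phi> y = ereal a" for y a
  proof -
    have Ry: "Rh k y (V k) = Rh k x (V k) + (- 1) *\<^sub>R row_prod (y - x) Q"
      by (simp add: bellman_res_eq Q_def row_prod.diff_left)
    have yx: "y - pol k = (x - pol k) + 1 *\<^sub>R (y - x)" by simp
    have "pen (l k) (Rh k y (V k)) = pen (l k) (Rh k x (V k)) - w \<bullet> row_prod (y - x) Q
        + \<beta> / 2 * (norm (row_prod (y - x) Q))\<^sup>2"
      unfolding pen_def Ry quadratic_expand w_def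
      by (simp add: inner_add_left inner_add_right inner_diff_right algebra_simps)
    moreover have "w \<bullet> row_prod (y - x) Q = row_scale w Q \<bullet> (y - x)"
      by (metis inner_commute inner_row_prod)
    moreover have "1 / (2 * \<eta>\<^sub>\<pi>) * (norm (y - pol k))\<^sup>2 = 1 / (2 * \<eta>\<^sub>\<pi>) * (norm (x - pol k))\<^sup>2
        + 1 / \<eta>\<^sub>\<pi> * ((x - pol k) \<bullet> (y - x)) + 1 / (2 * \<eta>\<^sub>\<pi>) * (norm (y - x))\<^sup>2"
      unfolding yx quadratic_expand using steps by (simp add: field_simps)
    moreover have "\<beta> / 2 * (norm (row_prod (y - x) Q))\<^sup>2 \<le> \<beta> / 2 * ((norm Q)\<^sup>2 * (norm (y - x))\<^sup>2)"
    proof -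
      have "(norm (row_prod (y - x) Q))\<^sup>2 \<le> (norm (y - x) * norm Q)\<^sup>2"
        by (intro power_mono norm_row_prod_le norm_ge_zero)
      then show ?thesis using steps by (intro mult_left_mono) (auto simp: power_mult_distrib mult_ac)
    qed
    moreover have "phir (Suc k) + (pen (l k) (Rh k x (V k)) + 1 / (2 * \<eta>\<^sub>\<pi>) * (norm (x - pol k))\<^sup>2)
        \<le> a + (pen (l k) (Rh k y (V k)) + 1 / (2 * \<eta>\<^sub>\<pi>) * (norm (y - pol k))\<^sup>2)"
      using policy_step_le[OF that(1), of k] unfolding that(2) x_def[symmetric] \<phi>x by simp
    moreover have "v \<bullet> (y - x) = row_scale w Q \<bullet> (y - x) - 1 / \<eta>\<^sub>\<pi> * ((x - pol k) \<bullet> (y - x))"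
      by (simp add: v_def inner_diff_left)
    moreover have "G * (norm (y - x))\<^sup>2 = \<beta> / 2 * ((norm Q)\<^sup>2 * (norm (y - x))\<^sup>2) + 1 / (2 * \<eta>\<^sub>\<pi>) * (norm (y - x))\<^sup>2"
      by (simp add: G_def algebra_simps)
    ultimately show ?thesis by linarith
  qed
  \<comment> \<open>Outside the domain of \<open>\<psi>\<close> the quotient is infinite; inside,
    the quadratic defect divided by the distance tends to zero.\<close>
  have quot: "ereal (- G * norm (y - x)) \<le> (\<psi> y - \<psi> x - ereal (v \<bullet> (y - x))) / ereal (norm (y - x))"
    if "y \<noteq> x" for y
  proof (cases "y \<in> policies \<and> \<phi> y \<noteq> \<infinity>")
    case True
    then obtain a where a: "\<phi> y = ereal a" using phi_not_MInf[of y] by (cases "\<phi> y") auto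
    have "- G * norm (y - x) * norm (y - x) \<le> a - phir (Suc k) - v \<bullet> (y - x)"
      using lower[OF conjunct1[OF True] a] by (simp add: power2_eq_square mult_ac)
    then have "- G * norm (y - x) \<le> (a - phir (Suc k) - v \<bullet> (y - x)) / norm (y - x)"
      using that by (simp add: pos_le_divide_eq)
    then show ?thesis using True x that by (simp add: indicator_fun_def a \<phi>x)
  next
    case False
    then have y: "\<psi> y = \<infinity>" by (cases "y \<in> policies") (auto simp: indicator_fun_def)
    have x: "\<psi> x = ereal (phir (Suc k))" using x by (simp add: indicator_fun_def \<phi>x)
    show ?thesis unfolding x y using that by simp
  qed
  have "((\<lambda>y. ereal (- G * norm (y - x))) \<longlongrightarrow> ereal (- G * norm (x - x))) (at x)"
    by (intro tendsto_intros)
  then have "Liminf (at x) (\<lambda>y. ereal (- G * norm (y - x))) = 0"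
    by (subst lim_imp_Liminf) (auto simp: zero_ereal_def)
  moreover have "Liminf (at x) (\<lambda>y. ereal (- G * norm (y - x)))
      \<le> Liminf (at x) (\<lambda>y. (\<psi> y - \<psi> x - ereal (v \<bullet> (y - x))) / ereal (norm (y - x)))"
    by (rule Liminf_mono) (use quot in \<open>auto simp: eventually_at_filter\<close>)
  ultimately have "0 \<le> Liminf (at x) (\<lambda>y. (\<psi> y - \<psi> x - ereal (v \<bullet> (y - x))) / ereal (norm (y - x)))"
    by simp
  moreover have "\<bar>\<psi> x\<bar> \<noteq> \<infinity>" using x by (simp add: indicator_fun_def \<phi>x)
  ultimately have "v \<in> regular_subdiff \<psi> x" unfolding regular_subdiff_def by blast
  then show ?thesis by (simp add: v_def w_def Q_def x_def)
qed

lemma q_table_tendsto: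
  assumes "(W \<longlongrightarrow> W0) F"
  shows "((\<lambda>x. q_table \<gamma> P r (W x)) \<longlongrightarrow> q_table \<gamma> P r W0) F"
  unfolding q_table_def by (intro tendsto_intros assms)

text \<open>Since increments vanish, inputs and outputs of the steps share their limits along the
  subsequence. The delicate point is that the limiting subdifferential requires convergence of the
  costs \<open>\<phi>\<close>: lower semicontinuity gives one half, and minimality against the limit
  \<open>p\<close> as competitor the other.\<close>

lemma limit_point_kkt:
  assumes n: "filterlim n at_top sequentially"
    and p: "(\<lambda>j. pol (Suc (n j))) \<longlonglongrightarrow> p" and W: "(\<lambda>j. V (Suc (n j))) \<longlonglongrightarrow> W"
    and w: "(\<lambda>j. l (Suc (n j))) \<longlonglongrightarrow> w"
  shows "kkt_point \<phi> c \<gamma> P r p W w"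
proof -
  have err: "(\<lambda>j. err (n j)) \<longlonglongrightarrow> 0" by (rule filterlim_compose[OF err_tendsto n])
  have p': "(\<lambda>j. pol (n j)) \<longlonglongrightarrow> p"
    using tendsto_diff[OF p filterlim_compose[OF policy_increments n]] by simp
  have W': "(\<lambda>j. V (n j)) \<longlonglongrightarrow> W"
    using tendsto_diff[OF W filterlim_compose[OF value_increments n]] by simp
  have w': "(\<lambda>j. l (n j)) \<longlonglongrightarrow> w"
    using tendsto_diff[OF w filterlim_compose[OF multiplier_increments n]] by simp
  have pin: "p \<in> policies"
    using closed_sequentially[OF closed_policies _ p] policy_in by blast
  have Res0: "R p W = 0"
  proof (rule LIMSEQ_unique)
    show "(\<lambda>j. R (pol (Suc (n j))) (V (Suc (n j)))) \<longlonglongrightarrow> R p W"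
      unfolding bellman_res_eq by (intro tendsto_intros row_prod.tendsto q_table_tendsto p W)
    show "(\<lambda>j. R (pol (Suc (n j))) (V (Suc (n j)))) \<longlonglongrightarrow> 0"
      by (rule filterlim_compose[OF LIMSEQ_Suc[OF residual_tendsto] n])
  qed
  have Qh: "(\<lambda>j. q_table \<gamma> (Ph (n j)) (rh (n j)) (V (n j))) \<longlonglongrightarrow> q_table \<gamma> P r W"
  proof -
    have "(\<lambda>j. K * (err (n j) * (1 + norm (V (n j))))) \<longlonglongrightarrow> K * (0 * (1 + norm W))"
      by (intro tendsto_intros err W')
    then have "(\<lambda>j. q_table \<gamma> (Ph (n j)) (rh (n j)) (V (n j)) - q_table \<gamma> P r (V (n j))) \<longlonglongrightarrow> 0"
      by (intro Lim_null_comparison[OF always_eventually[OF allI[OF q_table_noise]]]) simp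
    from tendsto_add[OF this q_table_tendsto[OF W']] show ?thesis by simp
  qed
  have Rh: "(\<lambda>j. Rh (n j) (q j) (V (n j))) \<longlonglongrightarrow> R q0 W" if "q \<longlonglongrightarrow> q0" for q q0
    unfolding bellman_res_eq by (intro tendsto_intros row_prod.tendsto Qh W' that)

  have "(\<lambda>j. c + transpose (Mh (n j)) *v l (Suc (n j)) + (1 / \<eta>\<^sub>V) *\<^sub>R (V (Suc (n j)) - V (n j)))
      \<longlonglongrightarrow> c + transpose (M p) *v w + (1 / \<eta>\<^sub>V) *\<^sub>R 0"
  proof (intro tendsto_intros filterlim_compose[OF value_increments n])
    have Ph: "(\<lambda>j. Ph (n j) s a s') \<longlonglongrightarrow> P s a s'" for s a s'
    proof -
      have "(\<lambda>j. Ph (n j) s a s' - P s a s') \<longlonglongrightarrow> 0"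
        by (rule Lim_null_comparison[OF _ err]) (simp add: err_entries)
      from tendsto_add[OF this tendsto_const[of "P s a s'"]] show ?thesis by simp
    qed
    have pc: "(\<lambda>j. pol (Suc (n j)) $ s $ a) \<longlonglongrightarrow> p $ s $ a" for s a
      by (intro tendsto_vec_nth p)
    show "(\<lambda>j. transpose (Mh (n j)) *v l (Suc (n j))) \<longlonglongrightarrow> transpose (M p) *v w"
      unfolding transpose_def matrix_vector_mult_def M_pol_def P_pol_def
      by (intro tendsto_vec_lambda) (simp, intro tendsto_intros Ph pc w)
  qed
  then have stat: "c + transpose (M p) *v w = 0"
    unfolding value_stationary by (simp add: LIMSEQ_const_iff)

  \<comment> \<open>By how much the finite part of the subproblem at the competitor \<open>q\<close>
    exceeds that at the minimizer. It converges for every \<open>q\<close>, and to zero for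
    \<open>q = p\<close>.\<close>
  define gap where "gap q j = pen (l (n j)) (Rh (n j) q (V (n j))) + 1 / (2 * \<eta>\<^sub>\<pi>) * (norm (q - pol (n j)))\<^sup>2
      - (pen (l (n j)) (Rh (n j) (pol (Suc (n j))) (V (n j)))
         + 1 / (2 * \<eta>\<^sub>\<pi>) * (norm (pol (Suc (n j)) - pol (n j)))\<^sup>2)" for q j
  have gap: "gap q \<longlonglongrightarrow> pen w (R q W) + 1 / (2 * \<eta>\<^sub>\<pi>) * (norm (q - p))\<^sup>2
      - (pen w (R p W) + 1 / (2 * \<eta>\<^sub>\<pi>) * (norm (p - p))\<^sup>2)" for q
    unfolding gap_def pen_def by (intro tendsto_intros w' Rh p p')
  have upper: "phir (Suc (n j)) \<le> a + gap q j" if "q \<in> policies" "\<phi> q = ereal a" for q a j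
    using policy_step_le[OF that(1), of "n j"] unfolding that(2) phi_eq gap_def by simp
  \<comment> \<open>\<open>lsc_on\<close> uses punctured neighbourhoods, and an iterate may equal
    \<open>p\<close>; this case is covered by the assumption on \<open>y\<close> itself.\<close>
  have lower: "\<forall>\<^sub>F j in sequentially. y < phir (Suc (n j))" if "ereal y < \<phi> p" for y
  proof -
    have "ereal y < Liminf (at p within policies) \<phi>"
      using phi(2) pin that unfolding lsc_on_def by (meson less_le_trans)
    then have "\<forall>\<^sub>F q in at p within policies. ereal y < \<phi> q" by (rule less_LiminfD)
    then have "\<forall>\<^sub>F q in nhds p. q \<in> policies \<longrightarrow> ereal y < \<phi> q"
      unfolding eventually_at_filter by eventually_elim (use that in auto)
    from eventually_compose_filterlim[OF this p]
    show ?thesis by eventually_elim (use policy_in phi_eq in auto)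
  qed
  \<comment> \<open>Testing with \<open>pol 0\<close> bounds the costs from above, whereas lower
    semicontinuity would drive them to infinity.\<close>
  have "\<phi> p \<noteq> \<infinity>"
  proof
    assume inf: "\<phi> p = \<infinity>"
    obtain L where "gap (pol 0) \<longlonglongrightarrow> L" using gap by blast
    then have "\<forall>\<^sub>F j in sequentially. gap (pol 0) j < L + 1" by (rule order_tendstoD) simp
    moreover have "\<forall>\<^sub>F j in sequentially. phir 0 + L + 1 < phir (Suc (n j))"
      by (rule lower) (simp add: inf)
    ultimately have "\<forall>\<^sub>F j in sequentially. False"
      by eventually_elim (use upper[OF policy_in phi_eq, of _ 0] in \<open>smt (verit)\<close>)
    then show False by simp
  qed
  then obtain a where a: "\<phi> p = ereal a" using phi_not_MInf[OF pin] by (cases "\<phi> p") auto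
  have "(\<lambda>j. phir (Suc (n j))) \<longlonglongrightarrow> a"
  proof (rule order_tendstoI)
    fix y assume "a < y"
    then have "\<forall>\<^sub>F j in sequentially. gap p j < y - a"
      using gap[of p] by (intro order_tendstoD(2)[OF gap]) simp
    then show "\<forall>\<^sub>F j in sequentially. phir (Suc (n j)) < y"
      by eventually_elim (use upper[OF pin a] in \<open>smt (verit)\<close>)
  qed (use lower a in auto)
  then have psi: "(\<lambda>j. \<psi> (pol (Suc (n j)))) \<longlonglongrightarrow> \<psi> p"
    using policy_in pin by (simp add: indicator_fun_def phi_eq a)
  define v where "v j = row_scale (l (n j) + \<beta> *\<^sub>R Rh (n j) (pol (Suc (n j))) (V (n j)))
      (q_table \<gamma> (Ph (n j)) (rh (n j)) (V (n j))) - (1 / \<eta>\<^sub>\<pi>) *\<^sub>R (pol (Suc (n j)) - pol (n j))" for j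
  have "v \<longlonglongrightarrow> row_scale (w + \<beta> *\<^sub>R R p W) (q_table \<gamma> P r W) - (1 / \<eta>\<^sub>\<pi>) *\<^sub>R (p - p)"
    unfolding v_def by (intro tendsto_intros tendsto_row_scale w' Rh p p' Qh)
  \<comment> \<open>The penalty contribution to the gradient disappears since the limit is feasible,
    leaving the multiplier \<open>w\<close> alone.\<close>
  then have v: "v \<longlonglongrightarrow> row_scale w (q_table \<gamma> P r W)" by (simp add: Res0)
  have "v j \<in> regular_subdiff \<psi> (pol (Suc (n j)))" for j
    unfolding v_def by (rule regular_subdiff_step)
  then have "row_scale w (q_table \<gamma> P r W) \<in> limiting_subdiff \<psi> p"
    unfolding limiting_subdiff_def using p psi v pin a by (auto simp: indicator_fun_def)
  then have "0 \<in> (\<lambda>g. g + adjoint (J_pol \<gamma> P r p W) w) ` limiting_subdiff \<psi> p"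
    by (rule rev_image_eqI) (simp add: adjoint_J_pol)
  then show ?thesis unfolding kkt_point_def using stat Res0 by blast
qed

theorem noisy_admm_convergence:
  "(\<lambda>k. pol (Suc k) - pol k) \<longlonglongrightarrow> 0 \<and> (\<lambda>k. V (Suc k) - V k) \<longlonglongrightarrow> 0 \<and>
   (\<lambda>k. l (Suc k) - l k) \<longlonglongrightarrow> 0 \<and> (\<lambda>k. R (pol k) (V k)) \<longlonglongrightarrow> 0 \<and>
   (\<forall>p W w f. strict_mono f \<and> (\<lambda>j. (pol (f j), V (f j), l (f j))) \<longlonglongrightarrow> (p, W, w)
      \<longrightarrow> kkt_point \<phi> c \<gamma> P r p W w)"
proof (intro conjI policy_increments value_increments multiplier_increments residual_tendsto allI impI)
  fix p W w f
  assume "strict_mono (f :: nat \<Rightarrow> nat) \<and> (\<lambda>j. (pol (f j), V (f j), l (f j))) \<longlonglongrightarrow> (p, W, w)"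
  then have f: "strict_mono f" and lim: "(\<lambda>j. (pol (f j), V (f j), l (f j))) \<longlonglongrightarrow> (p, W, w)" by auto
  \<comment> \<open>Each index has to be the output of a step. Since \<open>f (Suc j)\<close> is at
    least \<open>Suc j\<close>, a predecessor exists after the first term is dropped.\<close>
  define n where "n j = f (Suc j) - 1" for j
  have Suc_n: "Suc (n j) = f (Suc j)" for j
    using strict_mono_imp_increasing[OF f, of "Suc j"] by (simp add: n_def)
  have lim': "(\<lambda>j. (pol (Suc (n j)), V (Suc (n j)), l (Suc (n j)))) \<longlonglongrightarrow> (p, W, w)"
    unfolding Suc_n by (rule LIMSEQ_Suc[OF lim])
  have "filterlim n at_top sequentially"
  proof (rule filterlim_at_top_mono[OF filterlim_ident always_eventually[OF allI]])
    fix j show "j \<le> n j" using strict_mono_imp_increasing[OF f, of "Suc j"] Suc_n[of j] by simp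
  qed
  then show "kkt_point \<phi> c \<gamma> P r p W w"
    by (rule limit_point_kkt)
      (use tendsto_fst[OF lim'] tendsto_fst[OF tendsto_snd[OF lim']] tendsto_snd[OF tendsto_snd[OF lim']] in simp_all)
qed

end


section \<open>Estimation errors of a batch\<close>

text \<open>Sum and expectation of nonnegative terms may be exchanged, and a variable of finite
  expectation is almost surely finite. Only the individual expectations matter, so the batches may
  depend on each other.\<close>

lemma (in prob_space) AE_summable_of_expectation_le:
  fixes U :: "nat \<Rightarrow> 'a \<Rightarrow> real"
  assumes int: "\<And>k. integrable M (U k)" and nn: "\<And>k \<omega>. 0 \<le> U k \<omega>"
    and le: "\<And>k. expectation (U k) \<le> d k" and d: "summable d"
  shows "AE \<omega> in M. summable (\<lambda>k. U k \<omega>)"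
proof -
  have d0: "0 \<le> d k" for k
    using order_trans[OF integral_nonneg_AE[of "U k" M] le] nn by auto
  have [measurable]: "U k \<in> borel_measurable M" for k using int by auto
  have "(\<integral>\<^sup>+\<omega>. (\<Sum>k. ennreal (U k \<omega>)) \<partial>M) = (\<Sum>k. \<integral>\<^sup>+\<omega>. ennreal (U k \<omega>) \<partial>M)"
    by (rule nn_integral_suminf) auto
  also have "\<dots> = (\<Sum>k. ennreal (expectation (U k)))"
    using int nn by (intro suminf_cong nn_integral_eq_integral) auto
  also have "\<dots> \<le> (\<Sum>k. ennreal (d k))"
    by (intro suminf_le ennreal_leI le) auto
  also have "\<dots> = ennreal (\<Sum>k. d k)" by (rule suminf_ennreal2[OF d0 d])
  finally have "(\<integral>\<^sup>+\<omega>. (\<Sum>k. ennreal (U k \<omega>)) \<partial>M) \<noteq> \<infinity>"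
    by (auto simp: top_unique)
  then have "AE \<omega> in M. (\<Sum>k. ennreal (U k \<omega>)) \<noteq> \<infinity>"
    by (intro nn_integral_noteq_infinite) auto
  then show ?thesis
    by eventually_elim (rule summable_suminf_not_top, auto simp: nn)
qed

lemma card_filter_eq_sum: "finite X \<Longrightarrow> real (card {x \<in> X. Q x}) = (\<Sum>x\<in>X. if Q x then 1 else 0)"
  by (simp add: sum.inter_filter[symmetric])

lemma mult_if_zero: "x * (if b then y else 0) = (if b then x * y else (0 :: real))"
  by simp

section \<open>Martingale differences of the reset chain\<close>

locale reset_chain = prob_space \<Omega>
  for \<Omega> :: "'w measure" +
  fixes F :: "nat \<Rightarrow> nat \<Rightarrow> 'w measure"
    and P :: "'s::finite \<Rightarrow> 'a::finite \<Rightarrow> 's \<Rightarrow> real"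
    and \<rho> :: "'s \<Rightarrow> real"
    and \<gamma> :: real
    and m :: "nat \<Rightarrow> nat"
    and bp :: "nat \<Rightarrow> 'w \<Rightarrow> real ^ 'a ^ 's"
    and S :: "nat \<Rightarrow> nat \<Rightarrow> 'w \<Rightarrow> 's"
    and A :: "nat \<Rightarrow> nat \<Rightarrow> 'w \<Rightarrow> 'a"
    and Z :: "nat \<Rightarrow> nat \<Rightarrow> 'w \<Rightarrow> bool"
  assumes mdp: "discounted_mdp P \<rho> \<gamma>"
    and sampling: "reset_sampling \<Omega> F P \<rho> \<gamma> m bp S A Z"
begin

lemma P: "prob_vec (P s a)" and \<rho>: "prob_vec \<rho>" and \<gamma>: "0 < \<gamma>" "\<gamma> < 1"
  using mdp by (auto simp: discounted_mdp_def)

lemma subalg: "t \<le> m k \<Longrightarrow> subalgebra \<Omega> (F k t)"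
  using sampling by (auto simp: reset_sampling_def)

lemma subalg_Suc: "t < m k \<Longrightarrow> subalgebra (F k (Suc t)) (F k t)"
  using sampling by (auto simp: reset_sampling_def)

lemma subalg_start: "t \<le> m k \<Longrightarrow> subalgebra (F k t) (F k 0)"
proof (induction t)
  case (Suc t)
  then have "subalgebra (F k t) (F k 0)" "subalgebra (F k (Suc t)) (F k t)"
    using subalg_Suc[of t k] by auto
  then show ?case by (auto simp: subalgebra_def)
qed (simp add: subalgebra_def)

lemma S_meas: "t \<le> m k \<Longrightarrow> S k t \<in> measurable (F k t) (count_space UNIV)"
  using sampling by (auto simp: reset_sampling_def)

lemma AZ_meas:
  assumes "t < m k"
  shows "A k t \<in> measurable (F k (Suc t)) (count_space UNIV)"
    and "Z k t \<in> measurable (F k (Suc t)) (count_space UNIV)"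
  using sampling assms by (auto simp: reset_sampling_def)

lemma bp_meas: "t \<le> m k \<Longrightarrow> bp k \<in> borel_measurable (F k t)"
  using sampling measurable_from_subalg[OF subalg_start[of t k], of "bp k" borel]
  by (auto simp: reset_sampling_def)

lemma bp_prob: "\<omega> \<in> space \<Omega> \<Longrightarrow> prob_vec (\<lambda>a. bp k \<omega> $ s $ a)"
  using sampling by (auto simp: reset_sampling_def policies_def)

definition outcome :: "nat \<Rightarrow> nat \<Rightarrow> 'w \<Rightarrow> 'a \<times> bool \<times> 's" where
  "outcome k t \<omega> = (A k t \<omega>, Z k t \<omega>, S k (Suc t) \<omega>)"

definition law :: "nat \<Rightarrow> nat \<Rightarrow> 'w \<Rightarrow> 'a \<times> bool \<times> 's \<Rightarrow> real" where
  "law k t \<omega> x = bp k \<omega> $ S k t \<omega> $ fst x *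
     (if fst (snd x) then (1 - \<gamma>) * \<rho> (snd (snd x)) else \<gamma> * P (S k t \<omega>) (fst x) (snd (snd x)))"

text \<open>A version of the conditional expectation of \<open>h\<close> at step \<open>t\<close>
  given \<open>F k t\<close>, written as a finite sum so that bounds and measurability are
  elementary. The corresponding \<open>noise\<close> is a martingale difference for bounded
  \<open>h\<close>.\<close>

definition step_mean :: "('s \<Rightarrow> 'a \<times> bool \<times> 's \<Rightarrow> real) \<Rightarrow> nat \<Rightarrow> nat \<Rightarrow> 'w \<Rightarrow> real" where
  "step_mean h k t \<omega> = (\<Sum>x\<in>UNIV. law k t \<omega> x * h (S k t \<omega>) x)"

definition noise :: "('s \<Rightarrow> 'a \<times> bool \<times> 's \<Rightarrow> real) \<Rightarrow> nat \<Rightarrow> nat \<Rightarrow> 'w \<Rightarrow> real" where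
  "noise h k t \<omega> = h (S k t \<omega>) (outcome k t \<omega>) - step_mean h k t \<omega>"

lemma sum_law:
  "(\<Sum>x\<in>UNIV. law k t \<omega> x * g x) = (\<Sum>a\<in>UNIV. bp k \<omega> $ S k t \<omega> $ a *
     ((1 - \<gamma>) * (\<Sum>s'\<in>UNIV. \<rho> s' * g (a, True, s')) + \<gamma> * (\<Sum>s'\<in>UNIV. P (S k t \<omega>) a s' * g (a, False, s'))))"
proof -
  have "(\<Sum>x\<in>UNIV. law k t \<omega> x * g x) = (\<Sum>a\<in>UNIV. \<Sum>z\<in>UNIV. \<Sum>s'\<in>UNIV. law k t \<omega> (a, z, s') * g (a, z, s'))"
    by (simp add: sum.cartesian_product UNIV_Times_UNIV[symmetric] del: UNIV_Times_UNIV)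
  also have "\<dots> = (\<Sum>a\<in>UNIV. bp k \<omega> $ S k t \<omega> $ a *
     ((1 - \<gamma>) * (\<Sum>s'\<in>UNIV. \<rho> s' * g (a, True, s')) + \<gamma> * (\<Sum>s'\<in>UNIV. P (S k t \<omega>) a s' * g (a, False, s'))))"
    by (intro sum.cong refl) (simp add: UNIV_bool law_def sum_distrib_left distrib_left mult_ac)
  finally show ?thesis .
qed

lemma law_nonneg: "\<omega> \<in> space \<Omega> \<Longrightarrow> 0 \<le> law k t \<omega> x"
  using bp_prob[of \<omega> k "S k t \<omega>"] P \<rho> \<gamma> by (auto simp: law_def prob_vec_def)

lemma law_total: "\<omega> \<in> space \<Omega> \<Longrightarrow> (\<Sum>x\<in>UNIV. law k t \<omega> x) = 1"
  using sum_law[of k t \<omega> "\<lambda>_. 1"] bp_prob[of \<omega> k "S k t \<omega>"] P \<rho> by (simp add: prob_vec_def)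

lemma abs_step_mean_le:
  assumes "\<omega> \<in> space \<Omega>" "\<And>s x. \<bar>h s x\<bar> \<le> 1"
  shows "\<bar>step_mean h k t \<omega>\<bar> \<le> 1"
proof -
  have "\<bar>step_mean h k t \<omega>\<bar> \<le> (\<Sum>x\<in>UNIV. \<bar>law k t \<omega> x * h (S k t \<omega>) x\<bar>)"
    unfolding step_mean_def by (rule sum_abs)
  also have "\<dots> \<le> (\<Sum>x\<in>UNIV. law k t \<omega> x)"
    using assms law_nonneg by (intro sum_mono) (auto simp: abs_mult mult_left_le)
  finally show ?thesis using law_total[OF assms(1)] by simp
qed

lemma abs_noise_le:
  assumes "\<omega> \<in> space \<Omega>" "\<And>s x. \<bar>h s x\<bar> \<le> 1"
  shows "\<bar>noise h k t \<omega>\<bar> \<le> 2"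
  using abs_step_mean_le[of \<omega> h k t, OF assms] assms(2)[of "S k t \<omega>" "outcome k t \<omega>"]
  unfolding noise_def by linarith

lemma state_fun_meas: "t \<le> m k \<Longrightarrow> (\<lambda>\<omega>. f (S k t \<omega>) :: real) \<in> borel_measurable (F k t)"
  by (rule measurable_compose[OF S_meas]) auto

lemma law_meas: "t \<le> m k \<Longrightarrow> (\<lambda>\<omega>. law k t \<omega> x) \<in> borel_measurable (F k t)"
proof -
  assume t: "t \<le> m k"
  have "(\<lambda>\<omega>. bp k \<omega> $ s $ a) \<in> borel_measurable (F k t)" for s a
    by (rule measurable_compose[OF bp_meas[OF t]])
      (intro borel_measurable_continuous_onI continuous_intros)
  then have "(\<lambda>\<omega>. bp k \<omega> $ S k t \<omega> $ fst x) \<in> borel_measurable (F k t)"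
    by (rule measurable_compose_countable[OF _ S_meas[OF t]])
  moreover have "(\<lambda>\<omega>. if fst (snd x) then (1 - \<gamma>) * \<rho> (snd (snd x)) else \<gamma> * P (S k t \<omega>) (fst x) (snd (snd x)))
      \<in> borel_measurable (F k t)"
    using t by (rule state_fun_meas)
  ultimately show ?thesis unfolding law_def by (rule borel_measurable_times)
qed

lemma step_mean_meas: "t \<le> m k \<Longrightarrow> step_mean h k t \<in> borel_measurable (F k t)"
  unfolding step_mean_def
  by (intro borel_measurable_sum borel_measurable_times law_meas state_fun_meas)

lemma noise_meas:
  assumes "t < m k"
  shows "noise h k t \<in> borel_measurable (F k (Suc t))"
proof -
  let ?G = "F k (Suc t)"
  have S: "S k t \<in> measurable ?G (count_space UNIV)" "S k (Suc t) \<in> measurable ?G (count_space UNIV)"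
    using measurable_from_subalg[OF subalg_Suc[OF assms] S_meas] S_meas assms by auto
  have mean: "step_mean h k t \<in> borel_measurable ?G"
    using measurable_from_subalg[OF subalg_Suc[OF assms] step_mean_meas] assms by auto
  have 1: "(\<lambda>\<omega>. h s (a, z, S k (Suc t) \<omega>)) \<in> borel_measurable ?G" for s a z
    by (rule measurable_compose[OF S(2)]) simp
  have 2: "(\<lambda>\<omega>. h s (a, Z k t \<omega>, S k (Suc t) \<omega>)) \<in> borel_measurable ?G" for s a
    by (rule measurable_compose_countable[OF 1 AZ_meas(2)[OF assms]])
  have 3: "(\<lambda>\<omega>. h s (A k t \<omega>, Z k t \<omega>, S k (Suc t) \<omega>)) \<in> borel_measurable ?G" for s
    by (rule measurable_compose_countable[OF 2 AZ_meas(1)[OF assms]])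
  have "(\<lambda>\<omega>. h (S k t \<omega>) (A k t \<omega>, Z k t \<omega>, S k (Suc t) \<omega>)) \<in> borel_measurable ?G"
    by (rule measurable_compose_countable[OF 3 S(1)])
  then show ?thesis unfolding noise_def outcome_def using mean by (rule borel_measurable_diff)
qed

text \<open>The clause of \<open>reset_sampling\<close> on the conditional law, in integrated form:
  indicators of single outcomes tested against bounded variables known before the step.\<close>

lemma expectation_outcome:
  assumes t: "t < m k" and X: "X \<in> borel_measurable (F k t)" and C: "\<And>\<omega>. \<omega> \<in> space \<Omega> \<Longrightarrow> \<bar>X \<omega>\<bar> \<le> C"
  shows "expectation (\<lambda>\<omega>. X \<omega> * (if outcome k t \<omega> = x then 1 else 0)) = expectation (\<lambda>\<omega>. X \<omega> * law k t \<omega> x)"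
proof -
  obtain a z s' where x: "x = (a, z, s')" by (cases x)
  have sub: "subalgebra \<Omega> (F k t)" using t by (intro subalg) simp
  interpret fin: finite_measure_subalgebra \<Omega> "F k t"
    by standard (rule sub)
  define E where "E = {\<omega> \<in> space \<Omega>. A k t \<omega> = a \<and> Z k t \<omega> = z \<and> S k (Suc t) \<omega> = s'}"
  have sub': "subalgebra \<Omega> (F k (Suc t))" using t by (intro subalg) simp
  have [measurable]: "A k t \<in> measurable \<Omega> (count_space UNIV)" "Z k t \<in> measurable \<Omega> (count_space UNIV)"
    "S k (Suc t) \<in> measurable \<Omega> (count_space UNIV)"
    using measurable_from_subalg[OF sub'] AZ_meas[OF t] S_meas[of "Suc t" k] t by auto
  have [measurable]: "E \<in> sets \<Omega>" unfolding E_def by measurable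
  have [measurable]: "X \<in> borel_measurable \<Omega>" by (rule measurable_from_subalg[OF sub X])
  have "(\<lambda>\<omega>. law k t \<omega> x) \<in> borel_measurable \<Omega>"
    using measurable_from_subalg[OF sub law_meas] t by simp
  note [measurable] = this
  have cond: "AE \<omega> in \<Omega>. real_cond_exp \<Omega> (F k t) (indicator E) \<omega> = law k t \<omega> x"
  proof -
    have "\<forall>k t. t < m k \<longrightarrow> (\<forall>a z s'. AE \<omega> in \<Omega>. real_cond_exp \<Omega> (F k t)
        (indicator {\<omega> \<in> space \<Omega>. A k t \<omega> = a \<and> Z k t \<omega> = z \<and> S k (Suc t) \<omega> = s'}) \<omega>
          = bp k \<omega> $ S k t \<omega> $ a * (if z then (1 - \<gamma>) * \<rho> s' else \<gamma> * P (S k t \<omega>) a s'))"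
      using sampling unfolding reset_sampling_def by (elim conjE)
    then show ?thesis using t unfolding E_def law_def x fst_conv snd_conv by blast
  qed
  have int: "integrable \<Omega> (\<lambda>\<omega>. X \<omega> * indicator E \<omega>)"
  proof (rule integrable_const_bound[of _ C])
    show "AE \<omega> in \<Omega>. norm (X \<omega> * indicator E \<omega>) \<le> C"
    proof (rule AE_I2)
      fix \<omega> assume "\<omega> \<in> space \<Omega>"
      then show "norm (X \<omega> * indicator E \<omega>) \<le> C" using C[of \<omega>] by (auto simp: indicator_def)
    qed
  qed measurable
  have "expectation (\<lambda>\<omega>. X \<omega> * (if outcome k t \<omega> = x then 1 else 0)) = expectation (\<lambda>\<omega>. X \<omega> * indicator E \<omega>)"
    by (intro Bochner_Integration.integral_cong refl) (auto simp: E_def outcome_def x indicator_def)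
  also have "\<dots> = expectation (\<lambda>\<omega>. X \<omega> * real_cond_exp \<Omega> (F k t) (indicator E) \<omega>)"
    by (rule fin.real_cond_exp_intg(2)[symmetric, OF int X]) measurable
  also have "\<dots> = expectation (\<lambda>\<omega>. X \<omega> * law k t \<omega> x)"
    using cond by (intro integral_cong_AE) auto
  finally show ?thesis .
qed

text \<open>A function of state and outcome is a finite combination of outcome indicators with
  coefficients \<open>h (S k t \<omega>) x\<close>. These are known before the step and can be
  absorbed into the test variable.\<close>

lemma expectation_noise:
  assumes t: "t < m k" and X: "X \<in> borel_measurable (F k t)" and C: "\<And>\<omega>. \<omega> \<in> space \<Omega> \<Longrightarrow> \<bar>X \<omega>\<bar> \<le> C"
    and h: "\<And>s x. \<bar>h s x\<bar> \<le> 1"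
  shows "expectation (\<lambda>\<omega>. X \<omega> * noise h k t \<omega>) = 0"
proof -
  define X' where "X' x \<omega> = X \<omega> * h (S k t \<omega>) x" for x \<omega>
  have X': "X' x \<in> borel_measurable (F k t)" for x
    unfolding X'_def using X state_fun_meas t by (intro borel_measurable_times) auto
  have X'C: "\<bar>X' x \<omega>\<bar> \<le> C" if "\<omega> \<in> space \<Omega>" for x \<omega>
  proof -
    have "\<bar>X' x \<omega>\<bar> \<le> \<bar>X \<omega>\<bar> * 1" unfolding X'_def abs_mult by (intro mult_left_mono h) auto
    then show ?thesis using C[OF that] by simp
  qed
  have sub: "subalgebra \<Omega> (F k t)" "subalgebra \<Omega> (F k (Suc t))" using t by (auto intro: subalg)
  have [measurable]: "X' x \<in> borel_measurable \<Omega>" "(\<lambda>\<omega>. law k t \<omega> x) \<in> borel_measurable \<Omega>" for x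
    using measurable_from_subalg[OF sub(1) X'] measurable_from_subalg[OF sub(1) law_meas] t by auto
  have "(\<lambda>\<omega>. outcome k t \<omega>) \<in> measurable \<Omega> (count_space UNIV)"
  proof -
    have [measurable]: "A k t \<in> measurable \<Omega> (count_space UNIV)" "Z k t \<in> measurable \<Omega> (count_space UNIV)"
      "S k (Suc t) \<in> measurable \<Omega> (count_space UNIV)"
      using measurable_from_subalg[OF sub(2)] AZ_meas[OF t] S_meas[of "Suc t" k] t by auto
    show ?thesis unfolding outcome_def by measurable
  qed
  note [measurable] = this
  have i1: "integrable \<Omega> (\<lambda>\<omega>. X' x \<omega> * (if outcome k t \<omega> = x then 1 else 0))" for x
  proof (rule integrable_const_bound[of _ C])
    show "AE \<omega> in \<Omega>. norm (X' x \<omega> * (if outcome k t \<omega> = x then 1 else 0)) \<le> C"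
    proof (rule AE_I2)
      fix \<omega> assume "\<omega> \<in> space \<Omega>"
      then show "norm (X' x \<omega> * (if outcome k t \<omega> = x then 1 else 0)) \<le> C" using X'C[of \<omega> x] by auto
    qed
  qed measurable
  have law1: "law k t \<omega> x \<le> 1" if "\<omega> \<in> space \<Omega>" for \<omega> x
    using member_le_sum[of x UNIV "law k t \<omega>"] law_total[OF that] law_nonneg[OF that] by auto
  have i2: "integrable \<Omega> (\<lambda>\<omega>. X' x \<omega> * law k t \<omega> x)" for x
  proof (rule integrable_const_bound[of _ C])
    show "AE \<omega> in \<Omega>. norm (X' x \<omega> * law k t \<omega> x) \<le> C"
    proof (rule AE_I2)
      fix \<omega> assume \<omega>: "\<omega> \<in> space \<Omega>"
      have "norm (X' x \<omega> * law k t \<omega> x) \<le> \<bar>X' x \<omega>\<bar> * 1"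
        unfolding real_norm_def abs_mult
        by (intro mult_left_mono) (use law1[OF \<omega>] law_nonneg[OF \<omega>] in auto)
      then show "norm (X' x \<omega> * law k t \<omega> x) \<le> C" using X'C[OF \<omega>, of x] by simp
    qed
  qed measurable
  have "expectation (\<lambda>\<omega>. X \<omega> * noise h k t \<omega>)
      = expectation (\<lambda>\<omega>. \<Sum>x\<in>UNIV. X' x \<omega> * (if outcome k t \<omega> = x then 1 else 0) - X' x \<omega> * law k t \<omega> x)"
  proof (intro Bochner_Integration.integral_cong refl)
    fix \<omega>
    have "h (S k t \<omega>) (outcome k t \<omega>) = (\<Sum>x\<in>UNIV. h (S k t \<omega>) x * (if outcome k t \<omega> = x then 1 else 0))"
      by (simp add: mult_if_zero sum.delta')
    then show "X \<omega> * noise h k t \<omega> = (\<Sum>x\<in>UNIV. X' x \<omega> * (if outcome k t \<omega> = x then 1 else 0) - X' x \<omega> * law k t \<omega> x)"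
      by (simp add: noise_def step_mean_def X'_def sum_subtractf right_diff_distrib sum_distrib_left mult_ac)
  qed
  also have "\<dots> = (\<Sum>x\<in>UNIV. expectation (\<lambda>\<omega>. X' x \<omega> * (if outcome k t \<omega> = x then 1 else 0))
      - expectation (\<lambda>\<omega>. X' x \<omega> * law k t \<omega> x))"
    using i1 i2 by (simp add: Bochner_Integration.integral_sum)
  also have "\<dots> = 0"
    by (simp add: expectation_outcome[OF t X' X'C])
  finally show ?thesis .
qed

text \<open>Orthogonality of martingale differences: the past sum is an admissible test variable, so
  the cross term has mean zero, and each square is at most 4. Measurability and integrability travel
  through the induction because the cross term needs them.\<close>

lemma noise_sum_second_moment:
  assumes n: "n \<le> m k" and h: "\<And>s x. \<bar>h s x\<bar> \<le> 1"
  shows "(\<lambda>\<omega>. \<Sum>t<n. noise h k t \<omega>) \<in> borel_measurable (F k n) \<and>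
    integrable \<Omega> (\<lambda>\<omega>. (\<Sum>t<n. noise h k t \<omega>)\<^sup>2) \<and>
    expectation (\<lambda>\<omega>. (\<Sum>t<n. noise h k t \<omega>)\<^sup>2) \<le> 4 * real n"
  using n
proof (induction n)
  case (Suc n)
  define D where "D \<omega> = (\<Sum>t<n. noise h k t \<omega>)" for \<omega>
  have n: "n < m k" "n \<le> m k" using Suc.prems by auto
  have IH: "D \<in> borel_measurable (F k n)" "integrable \<Omega> (\<lambda>\<omega>. (D \<omega>)\<^sup>2)" "expectation (\<lambda>\<omega>. (D \<omega>)\<^sup>2) \<le> 4 * real n"
    using Suc.IH n unfolding D_def by auto
  have Db: "\<bar>D \<omega>\<bar> \<le> real n * 2" if "\<omega> \<in> space \<Omega>" for \<omega>
  proof -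
    have "\<bar>D \<omega>\<bar> \<le> (\<Sum>t<n. \<bar>noise h k t \<omega>\<bar>)" unfolding D_def by (rule sum_abs)
    also have "\<dots> \<le> real (card {..<n}) * 2"
      by (rule sum_bounded_above) (rule abs_noise_le[OF that h])
    finally show ?thesis by simp
  qed
  have subs: "subalgebra (F k (Suc n)) (F k n)" "subalgebra \<Omega> (F k (Suc n))"
    using subalg_Suc[OF n(1)] subalg[OF Suc.prems] by auto
  have \<xi>: "noise h k n \<in> borel_measurable (F k (Suc n))" by (rule noise_meas[OF n(1)])
  have D': "D \<in> borel_measurable (F k (Suc n))" by (rule measurable_from_subalg[OF subs(1) IH(1)])
  have [measurable]: "noise h k n \<in> borel_measurable \<Omega>" "D \<in> borel_measurable \<Omega>"
    using measurable_from_subalg[OF subs(2)] \<xi> D' by auto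
  have i1: "integrable \<Omega> (\<lambda>\<omega>. D \<omega> * noise h k n \<omega>)"
  proof (rule integrable_const_bound[of _ "real n * 2 * 2"])
    show "AE \<omega> in \<Omega>. norm (D \<omega> * noise h k n \<omega>) \<le> real n * 2 * 2"
      unfolding real_norm_def abs_mult by (intro AE_I2 mult_mono Db abs_noise_le h) auto
  qed measurable
  have sq: "(noise h k n \<omega>)\<^sup>2 \<le> 4" if "\<omega> \<in> space \<Omega>" for \<omega>
    using power_mono[OF abs_noise_le[OF that h], where n = 2] by simp
  have i2: "integrable \<Omega> (\<lambda>\<omega>. (noise h k n \<omega>)\<^sup>2)"
    by (rule integrable_const_bound[of _ 4]) (use sq in auto)
  have eq: "(\<Sum>t<Suc n. noise h k t \<omega>)\<^sup>2 = (D \<omega>)\<^sup>2 + 2 * (D \<omega> * noise h k n \<omega>) + (noise h k n \<omega>)\<^sup>2" for \<omega>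
    by (simp add: D_def power2_sum)
  have "expectation (\<lambda>\<omega>. (noise h k n \<omega>)\<^sup>2) \<le> expectation (\<lambda>_. 4)"
    by (rule integral_mono[OF i2]) (use sq in auto)
  then have e2: "expectation (\<lambda>\<omega>. (noise h k n \<omega>)\<^sup>2) \<le> 4" by (simp add: prob_space)
  have "expectation (\<lambda>\<omega>. D \<omega> * noise h k n \<omega>) = 0"
    by (rule expectation_noise[OF n(1) IH(1) Db h])
  then have "expectation (\<lambda>\<omega>. (D \<omega>)\<^sup>2 + 2 * (D \<omega> * noise h k n \<omega>) + (noise h k n \<omega>)\<^sup>2)
      = expectation (\<lambda>\<omega>. (D \<omega>)\<^sup>2) + expectation (\<lambda>\<omega>. (noise h k n \<omega>)\<^sup>2)"
    using IH(2) i1 i2 by simp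
  moreover have "(\<lambda>\<omega>. \<Sum>t<Suc n. noise h k t \<omega>) = (\<lambda>\<omega>. D \<omega> + noise h k n \<omega>)" by (simp add: D_def)
  ultimately show ?case
    unfolding eq using IH e2 i1 i2 D' \<xi> by (auto intro!: borel_measurable_add)
qed simp

lemmas noise_sum = noise_sum_second_moment[THEN conjunct2, THEN conjunct1]
  noise_sum_second_moment[THEN conjunct2, THEN conjunct2]

section \<open>Counting functionals of the batch\<close>

definition visit :: "'s \<Rightarrow> 'a \<Rightarrow> 's \<Rightarrow> 'a \<times> bool \<times> 's \<Rightarrow> real" where
  "visit s a s0 x = (if s0 = s \<and> fst x = a \<and> \<not> fst (snd x) then 1 else 0)"

text \<open>Refers to the state after the step, which is the one whose conditional probability
  resets bound from below.\<close>

definition arrival :: "'s \<Rightarrow> 's \<Rightarrow> 'a \<times> bool \<times> 's \<Rightarrow> real" where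
  "arrival s s0 x = (if snd (snd x) = s then 1 else 0)"

definition deviation :: "'s \<Rightarrow> 'a \<Rightarrow> 's \<Rightarrow> 's \<Rightarrow> 'a \<times> bool \<times> 's \<Rightarrow> real" where
  "deviation s a s' s0 x = visit s a s0 x * ((if snd (snd x) = s' then 1 else 0) - P s a s')"

lemma P_le_1: "0 \<le> P s a s'" "P s a s' \<le> 1"
  using abs_prob_vec_le[OF P, of s a s'] P[of s a] by (auto simp: prob_vec_def)

lemma abs_functionals_le: "\<bar>visit s a s0 x\<bar> \<le> 1" "\<bar>arrival s s0 x\<bar> \<le> 1" "\<bar>deviation s a s' s0 x\<bar> \<le> 1"
  using P_le_1[of s a s'] by (auto simp: visit_def arrival_def deviation_def)

lemma step_mean_visit:
  "step_mean (visit s a) k t \<omega> = (if S k t \<omega> = s then \<gamma> * bp k \<omega> $ s $ a else 0)"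
proof -
  have "step_mean (visit s a) k t \<omega> = (\<Sum>a'\<in>UNIV. bp k \<omega> $ S k t \<omega> $ a' *
      (if S k t \<omega> = s \<and> a' = a then \<gamma> else 0))"
    unfolding step_mean_def sum_law
    by (intro sum.cong refl) (use P in \<open>auto simp: visit_def prob_vec_def\<close>)
  then show ?thesis
    by (simp add: mult_if_zero mult.commute)
qed

text \<open>Minorization by resets: whatever the state and action, a reset lands in \<open>s\<close>
  with probability \<open>(1 - \<gamma>) * \<rho> s\<close>.\<close>

lemma step_mean_arrival:
  assumes "\<omega> \<in> space \<Omega>"
  shows "(1 - \<gamma>) * \<rho> s \<le> step_mean (arrival s) k t \<omega>"
proof -
  have eq: "step_mean (arrival s) k t \<omega> = (\<Sum>a\<in>UNIV. bp k \<omega> $ S k t \<omega> $ a *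
      ((1 - \<gamma>) * \<rho> s + \<gamma> * P (S k t \<omega>) a s))"
    unfolding step_mean_def sum_law arrival_def
    by (simp add: mult_if_zero)
  have "(1 - \<gamma>) * \<rho> s = (\<Sum>a\<in>UNIV. bp k \<omega> $ S k t \<omega> $ a * ((1 - \<gamma>) * \<rho> s))"
    using bp_prob[OF assms] by (simp add: sum_distrib_right[symmetric] prob_vec_def)
  also have "\<dots> \<le> step_mean (arrival s) k t \<omega>"
    unfolding eq using bp_prob[OF assms, of k "S k t \<omega>"] \<gamma> P_le_1
    by (intro sum_mono mult_left_mono) (auto simp: prob_vec_def)
  finally show ?thesis .
qed

text \<open>A reset contributes zero because \<open>visit\<close> excludes it; without a reset, at
  the pair in question, the next state has law \<open>P s a\<close> and is centred by it.\<close>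

lemma step_mean_deviation: "step_mean (deviation s a s') k t \<omega> = 0"
proof -
  have "(\<Sum>s1\<in>UNIV. P s a s1 * ((if s1 = s' then 1 else 0) - P s a s')) = 0"
    using P[of s a]
    by (simp add: right_diff_distrib sum_subtractf sum_distrib_right[symmetric] prob_vec_def mult_if_zero)
  then have "bp k \<omega> $ S k t \<omega> $ a' * ((1 - \<gamma>) * (\<Sum>s1\<in>UNIV. \<rho> s1 * deviation s a s' (S k t \<omega>) (a', True, s1))
      + \<gamma> * (\<Sum>s1\<in>UNIV. P (S k t \<omega>) a' s1 * deviation s a s' (S k t \<omega>) (a', False, s1))) = 0" for a'
    by (auto simp: deviation_def visit_def)
  then show ?thesis unfolding step_mean_def sum_law by (intro sum.neutral) simp
qed

abbreviation "visits k \<omega> s a \<equiv> env_visits m S A Z k \<omega> s a"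

lemma finite_visits: "finite (visits k \<omega> s a)"
  by (rule finite_subset[of _ "{..<m k}"]) (auto simp: env_visits_def)

lemma card_visits: "real (card (visits k \<omega> s a)) = (\<Sum>t<m k. visit s a (S k t \<omega>) (outcome k t \<omega>))"
proof -
  have eq: "visits k \<omega> s a = {t \<in> {..<m k}. \<not> Z k t \<omega> \<and> S k t \<omega> = s \<and> A k t \<omega> = a}"
    by (auto simp: env_visits_def)
  show ?thesis
    unfolding eq card_filter_eq_sum[OF finite_lessThan] visit_def outcome_def
    by (intro sum.cong refl) auto
qed

text \<open>On a visited pair this martingale is the visit count times the error of the empirical
  transition probability.\<close>

lemma deviation_sum:
  "(\<Sum>t<m k. noise (deviation s a s') k t \<omega>)
    = real (card {t \<in> visits k \<omega> s a. S k (Suc t) \<omega> = s'}) - real (card (visits k \<omega> s a)) * P s a s'"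
proof -
  have eq: "{t \<in> visits k \<omega> s a. S k (Suc t) \<omega> = s'}
      = {t \<in> {..<m k}. (\<not> Z k t \<omega> \<and> S k t \<omega> = s \<and> A k t \<omega> = a) \<and> S k (Suc t) \<omega> = s'}"
    by (auto simp: env_visits_def)
  have c: "real (card {t \<in> visits k \<omega> s a. S k (Suc t) \<omega> = s'})
      = (\<Sum>t<m k. visit s a (S k t \<omega>) (outcome k t \<omega>) * (if S k (Suc t) \<omega> = s' then 1 else 0))"
    unfolding eq card_filter_eq_sum[OF finite_lessThan] visit_def outcome_def
    by (intro sum.cong refl) auto
  show ?thesis unfolding c card_visits
    by (simp add: noise_def step_mean_deviation deviation_def outcome_def sum_subtractf
        right_diff_distrib sum_distrib_right)
qed

end

section \<open>Visit counts under coverage and mean squared errors\<close>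

locale covered_reset_chain = reset_chain \<Omega> F P \<rho> \<gamma> m bp S A Z
  for \<Omega> :: "'w measure" and F
    and P :: "'s::finite \<Rightarrow> 'a::finite \<Rightarrow> 's \<Rightarrow> real" and \<rho> \<gamma> m bp S A Z +
  fixes \<rho>_min \<alpha> :: real
  assumes coverage: "\<rho>_min > 0" "\<alpha> > 0" "\<And>s. \<rho> s \<ge> \<rho>_min"
      "\<And>k \<omega> s a. \<omega> \<in> space \<Omega> \<Longrightarrow> bp k \<omega> $ s $ a \<ge> \<alpha>"
    and batch: "\<And>k. m k \<ge> 1"
begin

text \<open>A lower bound on the probability of moving by reset into a given state and then choosing
  a given action there without resetting.\<close>

definition rate :: real where "rate = \<gamma> * \<alpha> * ((1 - \<gamma>) * \<rho>_min)"

lemma alpha_le_1: "\<alpha> \<le> 1"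
proof -
  obtain \<omega> where \<omega>: "\<omega> \<in> space \<Omega>" using not_empty by blast
  have "\<bar>bp 0 \<omega> $ s $ a\<bar> \<le> 1" for s a using abs_prob_vec_le[OF bp_prob[OF \<omega>]] .
  then show ?thesis using coverage(4)[OF \<omega>] by (meson abs_le_D1 order_trans)
qed

lemma rate_bounds: "0 < rate" "rate \<le> 1"
proof -
  show "0 < rate" using \<gamma> coverage by (simp add: rate_def)
  have "\<rho>_min \<le> 1" using coverage(3) abs_prob_vec_le[OF \<rho>] by (meson abs_le_D1 order_trans)
  then have "\<gamma> * \<alpha> * ((1 - \<gamma>) * \<rho>_min) \<le> 1 * 1 * (1 * 1)"
    using \<gamma> coverage alpha_le_1 by (intro mult_mono) auto
  then show "rate \<le> 1" by (simp add: rate_def)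
qed

abbreviation "visit_noise k \<omega> s a \<equiv> (\<Sum>t<m k. noise (visit s a) k t \<omega>)"
abbreviation "arrival_noise k \<omega> s \<equiv> (\<Sum>t<m k - 1. noise (arrival s) k t \<omega>)"
abbreviation "deviation_noise k \<omega> s a s' \<equiv> (\<Sum>t<m k. noise (deviation s a s') k t \<omega>)"

text \<open>
  The first state of a batch is arbitrary, so only the \<open>m k - 1\<close> later ones are known to hit
  \<open>s\<close> with probability at least \<open>(1 - \<gamma>) \<rho>_min\<close>.
\<close>

lemma card_visits_ge:
  assumes \<omega>: "\<omega> \<in> space \<Omega>"
  shows "visit_noise k \<omega> s a + \<gamma> * \<alpha> * arrival_noise k \<omega> s + rate * (real (m k) - 1)
    \<le> real (card (visits k \<omega> s a))"
proof -
  define n where "n = m k - 1"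
  have mk: "m k = Suc n" using batch[of k] by (simp add: n_def)
  define hit where "hit t = (if S k t \<omega> = s then 1 else 0 :: real)" for t
  have "rate * (real (m k) - 1) = \<gamma> * \<alpha> * (\<Sum>t<n. (1 - \<gamma>) * \<rho>_min)"
    by (simp add: rate_def mk mult_ac)
  also have "\<dots> \<le> \<gamma> * \<alpha> * (\<Sum>t<n. step_mean (arrival s) k t \<omega>)"
  proof (intro mult_left_mono sum_mono)
    fix t
    have "(1 - \<gamma>) * \<rho>_min \<le> (1 - \<gamma>) * \<rho> s" using \<gamma> coverage by (intro mult_left_mono) auto
    then show "(1 - \<gamma>) * \<rho>_min \<le> step_mean (arrival s) k t \<omega>"
      using step_mean_arrival[OF \<omega>] order_trans by blast
  qed (use \<gamma> coverage in auto)
  \<comment> \<open>Arrivals are compensated first, then visits given the state; the arrival noise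
    therefore carries the factor \<open>\<gamma> * \<alpha>\<close>.\<close>
  also have "(\<Sum>t<n. step_mean (arrival s) k t \<omega>) = (\<Sum>t<n. hit (Suc t)) - arrival_noise k \<omega> s"
    unfolding n_def[symmetric] by (simp add: noise_def sum_subtractf hit_def arrival_def outcome_def)
  finally have 1: "\<gamma> * \<alpha> * arrival_noise k \<omega> s + rate * (real (m k) - 1) \<le> \<gamma> * \<alpha> * (\<Sum>t<n. hit (Suc t))"
    by (simp add: algebra_simps)
  have "\<gamma> * \<alpha> * (\<Sum>t<n. hit (Suc t)) \<le> \<gamma> * \<alpha> * (\<Sum>t<m k. hit t)"
    unfolding mk sum.lessThan_Suc_shift using \<gamma> coverage by (intro mult_left_mono) (auto simp: hit_def)
  also have "\<dots> = (\<Sum>t<m k. \<gamma> * \<alpha> * hit t)" by (rule sum_distrib_left)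
  also have "\<dots> \<le> (\<Sum>t<m k. step_mean (visit s a) k t \<omega>)"
    using \<gamma> coverage(4)[OF \<omega>, of k s a] by (intro sum_mono) (simp add: step_mean_visit hit_def)
  also have "\<dots> = real (card (visits k \<omega> s a)) - visit_noise k \<omega> s a"
    by (simp add: card_visits noise_def sum_subtractf)
  finally show ?thesis using 1 by linarith
qed

definition error_bound :: "'s \<Rightarrow> 'a \<Rightarrow> 's \<Rightarrow> nat \<Rightarrow> 'w \<Rightarrow> real" where
  "error_bound s a s' k \<omega> = 4 / (rate * real (m k))\<^sup>2 *
     ((deviation_noise k \<omega> s a s')\<^sup>2 + (visit_noise k \<omega> s a)\<^sup>2 + (arrival_noise k \<omega> s)\<^sup>2 + 1)"

text \<open>Division by the random visit count is avoided. Since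
  \<open>\<bar>e\<bar> \<le> 1\<close>, any shortfall of the count below
  \<open>rate * real (m k)\<close> is charged to the error at full price, and the rest is the
  product of error and count. Rarely visited pairs thus need no separate event; an unvisited pair
  satisfies the last premise trivially.\<close>

lemma error_sq_le:
  assumes \<omega>: "\<omega> \<in> space \<Omega>" and e: "\<bar>e\<bar> \<le> 1"
    and D: "\<bar>e * real (card (visits k \<omega> s a))\<bar> \<le> \<bar>deviation_noise k \<omega> s a s'\<bar>"
  shows "e\<^sup>2 \<le> error_bound s a s' k \<omega>"
proof -
  define d x y N where "d = \<bar>deviation_noise k \<omega> s a s'\<bar>" and "x = \<bar>visit_noise k \<omega> s a\<bar>"
    and "y = \<bar>arrival_noise k \<omega> s\<bar>" and "N = real (card (visits k \<omega> s a))"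
  have "\<bar>\<gamma> * \<alpha> * arrival_noise k \<omega> s\<bar> \<le> 1 * y"
    unfolding abs_mult y_def using \<gamma> coverage(2) alpha_le_1
    by (intro mult_right_mono) (auto simp: mult_le_one)
  then have rm: "rate * real (m k) \<le> N + x + y + 1"
    using card_visits_ge[OF \<omega>, of s a k] rate_bounds
    unfolding right_diff_distrib x_def N_def by linarith
  have "\<bar>e\<bar> * (rate * real (m k)) \<le> \<bar>e\<bar> * (N + x + y + 1)" by (rule mult_left_mono[OF rm]) simp
  also have "\<dots> = \<bar>e * N\<bar> + \<bar>e\<bar> * x + \<bar>e\<bar> * y + \<bar>e\<bar>" by (simp add: abs_mult N_def distrib_left)
  also have "\<dots> \<le> d + x + y + 1"
    using D e unfolding d_def N_def by (intro add_mono mult_left_le_one_le) (auto simp: x_def y_def)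
  finally have "(\<bar>e\<bar> * (rate * real (m k)))\<^sup>2 \<le> (d + x + y + 1)\<^sup>2"
    using rate_bounds by (intro power_mono) auto
  also have "\<dots> \<le> 4 * (d\<^sup>2 + x\<^sup>2 + y\<^sup>2 + 1\<^sup>2)" by (rule square_sum4_le)
  finally have "e\<^sup>2 * (rate * real (m k))\<^sup>2 \<le> 4 * (d\<^sup>2 + x\<^sup>2 + y\<^sup>2 + 1)"
    by (simp add: power_mult_distrib)
  moreover have "0 < (rate * real (m k))\<^sup>2" using rate_bounds batch[of k] by simp
  ultimately have "e\<^sup>2 \<le> 4 * (d\<^sup>2 + x\<^sup>2 + y\<^sup>2 + 1) / (rate * real (m k))\<^sup>2"
    by (simp add: pos_le_divide_eq)
  then show ?thesis by (simp add: error_bound_def d_def x_def y_def)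
qed

lemma error_bound_summable:
  assumes "summable (\<lambda>k. 1 / real (m k))"
  shows "AE \<omega> in \<Omega>. summable (\<lambda>k. error_bound s a s' k \<omega>)"
proof (rule AE_summable_of_expectation_le)
  fix k
  note D = noise_sum[of "m k" k "deviation s a s'", OF order_refl abs_functionals_le(3)]
  note X = noise_sum[of "m k" k "visit s a", OF order_refl abs_functionals_le(1)]
  note Y = noise_sum[of "m k - 1" k "arrival s", OF diff_le_self abs_functionals_le(2)]
  show "integrable \<Omega> (error_bound s a s' k)" unfolding error_bound_def
    by (intro integrable_mult_right Bochner_Integration.integrable_add D(1) X(1) Y(1)) simp
  show "0 \<le> error_bound s a s' k \<omega>" for \<omega> unfolding error_bound_def by simp
  have "expectation (error_bound s a s' k) = 4 / (rate * real (m k))\<^sup>2 *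
     (expectation (\<lambda>\<omega>. (deviation_noise k \<omega> s a s')\<^sup>2) + expectation (\<lambda>\<omega>. (visit_noise k \<omega> s a)\<^sup>2)
      + expectation (\<lambda>\<omega>. (arrival_noise k \<omega> s)\<^sup>2) + 1)"
    unfolding error_bound_def using D(1) X(1) Y(1) by (simp add: prob_space del: One_nat_def)
  \<comment> \<open>Three second moments of at most \<open>4 * real (m k)\<close> each, and 1 is at
    most \<open>real (m k)\<close>; 4 * 13 then gives 52.\<close>
  also have "\<dots> \<le> 4 / (rate * real (m k))\<^sup>2 * (13 * real (m k))"
    using D(2) X(2) Y(2) batch[of k] by (intro mult_left_mono) auto
  also have "\<dots> = 52 / rate\<^sup>2 * (1 / real (m k))"
    using batch[of k] rate_bounds by (simp add: power2_eq_square field_simps)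
  finally show "expectation (error_bound s a s' k) \<le> 52 / rate\<^sup>2 * (1 / real (m k))" .
qed (use assms in \<open>rule summable_mult\<close>)

lemma P_hat_error_le:
  assumes \<omega>: "\<omega> \<in> space \<Omega>" and P0: "prob_vec (P0 s a)"
  shows "(P_hat P0 m S A Z k \<omega> s a s' - P s a s')\<^sup>2 \<le> error_bound s a s' k \<omega>"
proof (rule error_sq_le[OF \<omega>])
  define N c where "N = card (visits k \<omega> s a)" and "c = card {t \<in> visits k \<omega> s a. S k (Suc t) \<omega> = s'}"
  have "0 \<le> P_hat P0 m S A Z k \<omega> s a s' \<and> P_hat P0 m S A Z k \<omega> s a s' \<le> 1"
  proof -
    have "c \<le> N" unfolding c_def N_def by (rule card_mono[OF finite_visits]) auto
    then have "real c / real N \<le> 1" by (cases "N = 0") (auto simp: divide_le_eq_1)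
    then show ?thesis
      using abs_prob_vec_le[OF P0, of s'] P0 by (auto simp: P_hat_def c_def N_def prob_vec_def)
  qed
  then show "\<bar>P_hat P0 m S A Z k \<omega> s a s' - P s a s'\<bar> \<le> 1" using P_le_1[of s a s'] by auto
  show "\<bar>(P_hat P0 m S A Z k \<omega> s a s' - P s a s') * real (card (visits k \<omega> s a))\<bar> \<le> \<bar>deviation_noise k \<omega> s a s'\<bar>"
  proof (cases "visits k \<omega> s a = {}")
    case False
    then have "real N \<noteq> 0" using finite_visits by (simp add: N_def)
    then have "(P_hat P0 m S A Z k \<omega> s a s' - P s a s') * real N = real c - real N * P s a s'"
      using False by (simp add: P_hat_def left_diff_distrib c_def N_def)
    then show ?thesis unfolding deviation_sum by (simp add: N_def c_def)
  qed simp
qed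

text \<open>Exact rewards leave an error only on unvisited pairs. There the visit count is zero, so
  \<open>error_sq_le\<close> with \<open>e = 1\<close> shows the bound to be at least 1. The state
  \<open>s'\<close> is arbitrary.\<close>

lemma r_hat_error_le:
  assumes \<omega>: "\<omega> \<in> space \<Omega>"
    and Y: "\<And>t. t < m k \<Longrightarrow> \<not> Z k t \<omega> \<Longrightarrow> Y k t \<omega> = r (S k t \<omega>) (A k t \<omega>)"
  shows "(r_hat r0 m S A Z Y k \<omega> s a - r s a)\<^sup>2 \<le> (r0 s a - r s a)\<^sup>2 * error_bound s a s' k \<omega>"
proof (cases "visits k \<omega> s a = {}")
  case True
  have "1\<^sup>2 \<le> error_bound s a s' k \<omega>" by (rule error_sq_le[OF \<omega>]) (auto simp: True)
  then show ?thesis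
    using True mult_left_mono[of 1 "error_bound s a s' k \<omega>" "(r0 s a - r s a)\<^sup>2"] by (simp add: r_hat_def)
next
  case False
  have "(\<Sum>t\<in>visits k \<omega> s a. Y k t \<omega>) = (\<Sum>t\<in>visits k \<omega> s a. r s a)"
    by (rule sum.cong) (auto simp: env_visits_def Y)
  then have "r_hat r0 m S A Z Y k \<omega> s a = r s a"
    using False finite_visits by (simp add: r_hat_def)
  moreover have "0 \<le> error_bound s a s' k \<omega>" unfolding error_bound_def by simp
  ultimately show ?thesis by simp
qed

end

section \<open>Almost every sample path meets the assumptions of the pathwise theorem\<close>

lemma P_hat_prob_vec:
  assumes "prob_vec (P0 s a)"
  shows "prob_vec (P_hat P0 m S A Z k \<omega> s a)"
proof (cases "env_visits m S A Z k \<omega> s a = {}")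
  case True
  then show ?thesis using assms by (simp add: prob_vec_def P_hat_def)
next
  case False
  define vis where "vis = env_visits m S A Z k \<omega> s a"
  have fin: "finite vis" unfolding vis_def
    by (rule finite_subset[of _ "{..<m k}"]) (auto simp: env_visits_def)
  have "(\<Sum>s'\<in>UNIV. card {t \<in> vis. S k (Suc t) \<omega> = s'}) = card vis"
    using sum.group[of vis UNIV "\<lambda>t. S k (Suc t) \<omega>" "\<lambda>_. 1 :: nat"] fin by simp
  then have "(\<Sum>s'\<in>UNIV. real (card {t \<in> vis. S k (Suc t) \<omega> = s'})) = real (card vis)"
    by (simp only: of_nat_sum[symmetric])
  then show ?thesis
    using False fin by (simp add: prob_vec_def P_hat_def vis_def[symmetric] sum_divide_distrib[symmetric])
qed

theorem theorem4p7:
  fixes P :: "'s::finite \<Rightarrow> 'a::finite \<Rightarrow> 's \<Rightarrow> real"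
    and r :: "'s \<Rightarrow> 'a \<Rightarrow> real"
    and \<rho> :: "'s \<Rightarrow> real"
    and \<gamma> :: real
    and c :: "real ^ 's"
    and \<phi> :: "real ^ 'a ^ 's \<Rightarrow> ereal"
    and \<Omega> :: "'w measure"
    and F :: "nat \<Rightarrow> nat \<Rightarrow> 'w measure"
    and m :: "nat \<Rightarrow> nat"
    and S :: "nat \<Rightarrow> nat \<Rightarrow> 'w \<Rightarrow> 's"
    and A :: "nat \<Rightarrow> nat \<Rightarrow> 'w \<Rightarrow> 'a"
    and Z :: "nat \<Rightarrow> nat \<Rightarrow> 'w \<Rightarrow> bool"
    and Y :: "nat \<Rightarrow> nat \<Rightarrow> 'w \<Rightarrow> real"
    and bp \<pi> :: "nat \<Rightarrow> 'w \<Rightarrow> real ^ 'a ^ 's"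
    and V l :: "nat \<Rightarrow> 'w \<Rightarrow> real ^ 's"
    and P0 :: "'s \<Rightarrow> 'a \<Rightarrow> 's \<Rightarrow> real"
    and r0 :: "'s \<Rightarrow> 'a \<Rightarrow> real"
    and \<pi>\<^sub>0 :: "real ^ 'a ^ 's"
    and \<beta> \<eta>\<^sub>\<pi> \<eta>\<^sub>V \<kappa> L\<^sub>M \<rho>_min \<alpha> R_max :: real
  defines "Ph \<equiv> P_hat P0 m S A Z"
    and "rh \<equiv> r_hat r0 m S A Z Y"
  assumes mdp: "discounted_mdp P \<rho> \<gamma>"
    and phi: "proper_on policies \<phi>" "lsc_on policies \<phi>" "bdd_below_on policies \<phi>"
    and prob: "prob_space \<Omega>"
    and sampling: "reset_sampling \<Omega> F P \<rho> \<gamma> m bp S A Z"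
    and batch: "\<And>k. m k \<ge> 1"
    and fallback: "\<And>s a. prob_vec (P0 s a)"
    and exact_rewards:
      "\<And>k t \<omega>. \<omega> \<in> space \<Omega> \<Longrightarrow> t < m k \<Longrightarrow> \<not> Z k t \<omega> \<Longrightarrow> Y k t \<omega> = r (S k t \<omega>) (A k t \<omega>)"
    and kappa: "\<And>p. p \<in> policies \<Longrightarrow> spectral_norm (matrix_inv (M_pol \<gamma> P p)) \<le> \<kappa>"
      "\<And>p k \<omega>. p \<in> policies \<Longrightarrow> \<omega> \<in> space \<Omega> \<Longrightarrow>
         spectral_norm (matrix_inv (M_pol \<gamma> (Ph k \<omega>) p)) \<le> \<kappa>"
    and steps: "\<beta> > 0" "\<eta>\<^sub>\<pi> > 0" "\<eta>\<^sub>V > 0"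
    and predetermined: "\<And>k. \<pi> k \<in> borel_measurable (F k 0)"
      "\<And>k. V k \<in> borel_measurable (F k 0)" "\<And>k. l k \<in> borel_measurable (F k 0)"
    and admm: "\<And>k \<omega>. \<omega> \<in> space \<Omega> \<Longrightarrow>
        admm_step \<phi> c \<beta> \<eta>\<^sub>\<pi> \<eta>\<^sub>V (bellman_res \<gamma> (Ph k \<omega>) (rh k \<omega>))
          (\<pi> k \<omega>) (V k \<omega>) (l k \<omega>) (\<pi> (Suc k) \<omega>) (V (Suc k) \<omega>) (l (Suc k) \<omega>)"
    and coverage: "\<rho>_min > 0" "\<alpha> > 0" "\<And>s. \<rho> s \<ge> \<rho>_min"
      "\<And>k \<omega> s a. \<omega> \<in> space \<Omega> \<Longrightarrow> bp k \<omega> $ s $ a \<ge> \<alpha>"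
      "\<And>s a. \<bar>r s a\<bar> \<le> R_max"
    and init_policy: "\<And>\<omega>. \<omega> \<in> space \<Omega> \<Longrightarrow> \<pi> 0 \<omega> = \<pi>\<^sub>0"
      "\<phi> \<pi>\<^sub>0 + indicator_fun policies \<pi>\<^sub>0 < \<infinity>"
    and lipschitz: "\<And>p q. p \<in> policies \<Longrightarrow> q \<in> policies \<Longrightarrow>
        spectral_norm (M_pol \<gamma> P q - M_pol \<gamma> P p) \<le> L\<^sub>M * norm (q - p)"
    and reduced_bdd: "bdd_below_on policies
        (\<lambda>p. \<phi> p + ereal (c \<bullet> (matrix_inv (M_pol \<gamma> P p) *v r_pol r p)))"
    and margin: "\<beta> > max (60 * \<kappa>\<^sup>2 / \<eta>\<^sub>V) (30 * \<eta>\<^sub>\<pi> * \<kappa> ^ 4 * L\<^sub>M\<^sup>2 * (norm c)\<^sup>2)"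
    and moments: "integrable \<Omega> (\<lambda>\<omega>. norm (V 0 \<omega>) ^ 4)" "integrable \<Omega> (\<lambda>\<omega>. norm (l 0 \<omega>) ^ 4)"
    and summable: "summable (\<lambda>k. 1 / real (m k))"
  shows "AE \<omega> in \<Omega>.
      (\<lambda>k. \<pi> (Suc k) \<omega> - \<pi> k \<omega>) \<longlonglongrightarrow> 0 \<and>
      (\<lambda>k. V (Suc k) \<omega> - V k \<omega>) \<longlonglongrightarrow> 0 \<and>
      (\<lambda>k. l (Suc k) \<omega> - l k \<omega>) \<longlonglongrightarrow> 0 \<and>
      (\<lambda>k. bellman_res \<gamma> P r (\<pi> k \<omega>) (V k \<omega>)) \<longlonglongrightarrow> 0 \<and>
      (\<forall>\<pi>' V' l' f. strict_mono f \<and>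
         (\<lambda>j. (\<pi> (f j) \<omega>, V (f j) \<omega>, l (f j) \<omega>)) \<longlonglongrightarrow> (\<pi>', V', l') \<longrightarrow>
         kkt_point \<phi> c \<gamma> P r \<pi>' V' l')"
proof -
  interpret chain: covered_reset_chain \<Omega> F P \<rho> \<gamma> m bp S A Z \<rho>_min \<alpha>
  proof (intro covered_reset_chain.intro reset_chain.intro reset_chain_axioms.intro
      covered_reset_chain_axioms.intro)
  qed (use prob mdp sampling coverage batch in auto)
  have Ph: "prob_vec (Ph k \<omega> s a)" for k \<omega> s a
    unfolding Ph_def by (rule P_hat_prob_vec[OF fallback])
  have init: "\<pi>\<^sub>0 \<in> policies \<and> \<phi> \<pi>\<^sub>0 \<noteq> \<infinity>"
    using init_policy(2) by (cases "\<pi>\<^sub>0 \<in> policies") (auto simp: indicator_fun_def)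
  \<comment> \<open>One null set for all triples at once, as the index types are finite.\<close>
  have "AE \<omega> in \<Omega>. \<forall>s a s'. summable (\<lambda>k. chain.error_bound s a s' k \<omega>)"
    by (simp add: AE_all_countable chain.error_bound_summable[OF summable])
  then show ?thesis
  proof (rule AE_mp, intro AE_I2 impI)
    fix \<omega> assume \<omega>: "\<omega> \<in> space \<Omega>"
      and err: "\<forall>s a s'. summable (\<lambda>k. chain.error_bound s a s' k \<omega>)"
    have "noisy_admm P r \<gamma> c \<phi> \<beta> \<eta>\<^sub>\<pi> \<eta>\<^sub>V \<kappa> L\<^sub>M (\<lambda>k. Ph k \<omega>) (\<lambda>k. rh k \<omega>)
        (\<lambda>k. \<pi> k \<omega>) (\<lambda>k. V k \<omega>) (\<lambda>k. l k \<omega>)"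
    proof
      show "prob_vec (P s a)" "prob_vec (Ph k \<omega> s a)" for s a k by (rule chain.P Ph)+
      show "0 < \<gamma>" "\<gamma> < 1" by (rule chain.\<gamma>)+
      show "\<pi> 0 \<omega> \<in> policies" "\<phi> (\<pi> 0 \<omega>) \<noteq> \<infinity>" using init init_policy(1)[OF \<omega>] by auto
      show "60 * \<kappa>\<^sup>2 \<le> \<beta> * \<eta>\<^sub>V" "30 * \<eta>\<^sub>\<pi> * \<kappa> ^ 4 * L\<^sub>M\<^sup>2 * (norm c)\<^sup>2 \<le> \<beta>"
        using margin steps by (simp_all add: pos_divide_less_eq)
      show "summable (\<lambda>k. (Ph k \<omega> s a s' - P s a s')\<^sup>2)" for s a s'
      proof (rule summable_comparison_test')
        show "summable (\<lambda>k. chain.error_bound s a s' k \<omega>)" using err by blast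
        show "norm ((Ph k \<omega> s a s' - P s a s')\<^sup>2) \<le> chain.error_bound s a s' k \<omega>" for k
          using chain.P_hat_error_le[OF \<omega> fallback, where k = k] unfolding Ph_def by simp
      qed
      show "summable (\<lambda>k. (rh k \<omega> s a - r s a)\<^sup>2)" for s a
      proof (rule summable_comparison_test')
        \<comment> \<open>The reward estimate is valid for every next state, so
          \<open>undefined\<close> merely picks one.\<close>
        show "summable (\<lambda>k. (r0 s a - r s a)\<^sup>2 * chain.error_bound s a undefined k \<omega>)"
          using err by (intro summable_mult) blast
        show "norm ((rh k \<omega> s a - r s a)\<^sup>2) \<le> (r0 s a - r s a)\<^sup>2 * chain.error_bound s a undefined k \<omega>" for k
          unfolding rh_def using chain.r_hat_error_le[where Y = Y and r = r and k = k, OF \<omega> exact_rewards[OF \<omega>]]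
          by simp
      qed
    qed (use phi kappa \<omega> steps admm lipschitz in auto)
    then show "(\<lambda>k. \<pi> (Suc k) \<omega> - \<pi> k \<omega>) \<longlonglongrightarrow> 0 \<and>
      (\<lambda>k. V (Suc k) \<omega> - V k \<omega>) \<longlonglongrightarrow> 0 \<and>
      (\<lambda>k. l (Suc k) \<omega> - l k \<omega>) \<longlonglongrightarrow> 0 \<and>
      (\<lambda>k. bellman_res \<gamma> P r (\<pi> k \<omega>) (V k \<omega>)) \<longlonglongrightarrow> 0 \<and>
      (\<forall>\<pi>' V' l' f. strict_mono f \<and>
         (\<lambda>j. (\<pi> (f j) \<omega>, V (f j) \<omega>, l (f j) \<omega>)) \<longlonglongrightarrow> (\<pi>', V', l') \<longrightarrow>
         kkt_point \<phi> c \<gamma> P r \<pi>' V' l')"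
      by (rule noisy_admm.noisy_admm_convergence)
  qed
qed

end
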